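(* Let $m\ge2$, $M=\{1,\ldots,m\}$, $I^m=[0,1]^m$, and let $\mathbf{X}_i=(X_{i1},\ldots,X_{im})$, $i=1,2,\ldots$, be independent random vectors with the uniform distribution on $I^m$. Let $\mathbb{F}_n$ be the empirical distribution function of $\mathbf{X}_1,\ldots,\mathbf{X}_n$ and $\mathbb{F}_{j,n}$ the marginal empirical distribution function of $X_{1j},\ldots,X_{nj}$, $j=1,\ldots,m$. For any $V\subset M$, with $V^c=M\setminus V$, the empirical process $$W_{V,n}(\mathbf{x})=\sqrt{n}\Big(\mathbb{F}_n(\mathbf{x})-\prod_{i\in V}x_i\prod_{j\in V^c}\mathbb{F}_{j,n}(x_j)\Big),\quad \mathbf{x}=(x_1,\ldots,x_m)\in I^m,$$ converges weakly, as $n\to\infty$, in the Skorohod space $D(I^m)$ to a centered Gaussian process $W_V(\mathbf{x})$ with covariance function $$\mathcal{G}_{\mathcal{M}_V}(\mathbf{x},\boldsymbol{\xi})=\prod_{j=1}^m\min(x_j,\xi_j)-\sum_{U\in\mathcal{M}_V}a_U\prod_{j\in M\setminus U}\min(x_j,\xi_j)\prod_{i\in U}x_i\xi_i,\quad \mathbf{x},\boldsymbol{\xi}\in I^m,$$ where $$\mathcal{M}_V=\{M\}\cup\{M\setminus U: U\subset V^c,\ |U|=1\}$$ and the coefficients $a_U$, $U\in\mathcal{M}_V$, are defined recurrently by $$\sum_{W\subset U,\ W\in\mathcal{M}_V}a_W=1\quad\text{for all } U\in\mathcal{M}_V.$$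
   Context: $\mathbb{F}_n(\mathbf{x})=n^{-1}\sum_{i=1}^n\prod_{j=1}^m\mathbb{I}(X_{ij}\le x_j)$ and $\mathbb{F}_{j,n}(x_j)=n^{-1}\sum_{i=1}^n\mathbb{I}(X_{ij}\le x_j)$, where $\mathbb{I}$ denotes the indicator. Empty products equal $1$. The Skorohod space $D(I^m)$ (in the sense of Neuhaus) is the $m$-parameter generalization of $D[0,1]$: it consists of functions $f:I^m\to\mathbb{R}$ such that at each point $\mathbf{x}\in I^m$ the limit of $f(\mathbf{y})$ as $\mathbf{y}\to\mathbf{x}$ exists within each of the (at most $2^m$) quadrants $\{\mathbf{y}\in I^m: y_j\ge x_j \text{ for } j\in A,\ y_j<x_j \text{ for } j\notin A\}$, $A\subset M$ (whenever nonempty), and $f$ is continuous at $\mathbf{x}$ from the "upper right" quadrant ($A=M$). It is endowed with the Skorohod metric $d(f,g)=\inf_\lambda\max\{\sup_{\mathbf{x}}|f(\mathbf{x})-g(\lambda(\mathbf{x}))|,\ \sup_{\mathbf{x}}|\lambda(\mathbf{x})-\mathbf{x}|\}$, the infimum being over maps $\lambda(\mathbf{x})=(\lambda_1(x_1),\ldots,\lambda_m(x_m))$ with each $\lambda_j$ an increasing homeomorphism of $[0,1]$. Weak convergence means convergence in distribution of random elements of this metric space (with its Borel $\sigma$-algebra). *)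

theory Defs
  imports "HOL-Probability.Probability"
begin

section \<open>The Skorohod space on the unit cube\<close>

text \<open>
  The index set M = {1,...,m} is the finite type 'm (so M is UNIV and m is CARD('m)), and
  the cube is cbox 0 1. A function on the cube is represented by an extensional function.
\<close>

definition quadrant :: "real^'m \<Rightarrow> 'm set \<Rightarrow> (real^'m) set" where
  "quadrant x A = {y \<in> cbox 0 1. (\<forall>j\<in>A. y $ j \<ge> x $ j) \<and> (\<forall>j\<in>UNIV - A. y $ j < x $ j)}"

definition skorohod_space :: "(real^'m \<Rightarrow> real) set" where
  "skorohod_space = {f \<in> extensional (cbox 0 1). \<forall>x\<in>cbox 0 1.
     (\<forall>A. quadrant x A \<noteq> {} \<longrightarrow> (\<exists>l. (f \<longlongrightarrow> l) (at x within quadrant x A))) \<and>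
     continuous (at x within quadrant x UNIV) f}"

definition time_change :: "(real \<Rightarrow> real) \<Rightarrow> bool" where
  "time_change l \<longleftrightarrow> strict_mono_on {0..1} l \<and> (\<exists>l'. homeomorphism {0..1} {0..1} l l')"

definition apply_time_changes :: "('m \<Rightarrow> real \<Rightarrow> real) \<Rightarrow> real^'m \<Rightarrow> real^'m" where
  "apply_time_changes l x = (\<chi> j. l j (x $ j))"

text \<open>
  Elements of the Skorohod space are bounded, so both suprema are suprema of bounded nonempty sets.
  The value off the space is irrelevant for the topology; it is 0 only because the locale
  \<^locale>\<open>Metric_space\<close> demands nonnegativity and symmetry of the distance on the whole type.
\<close>

definition skorohod_dist :: "(real^'m \<Rightarrow> real) \<Rightarrow> (real^'m \<Rightarrow> real) \<Rightarrow> real" where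
  "skorohod_dist f g =
     (if f \<in> skorohod_space \<and> g \<in> skorohod_space then
        (INF l\<in>{l. \<forall>j. time_change (l j)}.
           max (SUP x\<in>cbox 0 1. \<bar>f x - g (apply_time_changes l x)\<bar>)
               (SUP x\<in>cbox 0 1. norm (apply_time_changes l x - x)))
      else 0)"

definition skorohod_topology :: "(real^'m \<Rightarrow> real) topology" where
  "skorohod_topology = Metric_space.mtopology skorohod_space skorohod_dist"


section \<open>Convergence in distribution and Gaussian processes\<close>

definition borel_sigma :: "'a topology \<Rightarrow> 'a measure" where
  "borel_sigma T = sigma (topspace T) {U. openin T U}"

definition converges_in_distribution ::
  "'a topology \<Rightarrow> 'w measure \<Rightarrow> (nat \<Rightarrow> 'w \<Rightarrow> 'a) \<Rightarrow> 'v measure \<Rightarrow> ('v \<Rightarrow> 'a) \<Rightarrow> bool" where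
  "converges_in_distribution T P Z N Y \<longleftrightarrow>
     (\<forall>n. Z n \<in> measurable P (borel_sigma T)) \<and> Y \<in> measurable N (borel_sigma T) \<and>
     (\<forall>h. continuous_map T euclideanreal h \<and> bounded (h ` topspace T) \<longrightarrow>
        (\<lambda>n. \<integral>\<omega>. h (Z n \<omega>) \<partial>P) \<longlonglongrightarrow> (\<integral>\<omega>. h (Y \<omega>) \<partial>N))"

text \<open>Degenerate (zero-variance) normal laws are included.\<close>

definition normal_rv :: "'w measure \<Rightarrow> ('w \<Rightarrow> real) \<Rightarrow> bool" where
  "normal_rv N Y \<longleftrightarrow> Y \<in> borel_measurable N \<and>
     ((\<exists>\<mu> \<sigma>. \<sigma> > 0 \<and> distributed N lborel Y (normal_density \<mu> \<sigma>)) \<or> (\<exists>c. AE \<omega> in N. Y \<omega> = c))"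

text \<open>All finite-dimensional laws are multivariate normal, i.e. all linear combinations are normal.\<close>

definition gaussian_process :: "'w measure \<Rightarrow> 't set \<Rightarrow> ('t \<Rightarrow> 'w \<Rightarrow> real) \<Rightarrow> bool" where
  "gaussian_process N T Y \<longleftrightarrow>
     (\<forall>F c. finite F \<and> F \<subseteq> T \<longrightarrow> normal_rv N (\<lambda>\<omega>. \<Sum>t\<in>F. c t * Y t \<omega>))"

definition covariance :: "'w measure \<Rightarrow> ('w \<Rightarrow> real) \<Rightarrow> ('w \<Rightarrow> real) \<Rightarrow> real" where
  "covariance N Y Z =
     (\<integral>\<omega>. (Y \<omega> - (\<integral>\<eta>. Y \<eta> \<partial>N)) * (Z \<omega> - (\<integral>\<eta>. Z \<eta> \<partial>N)) \<partial>N)"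

definition centered_gaussian_process ::
  "'w measure \<Rightarrow> 't set \<Rightarrow> ('t \<Rightarrow> 'w \<Rightarrow> real) \<Rightarrow> ('t \<Rightarrow> 't \<Rightarrow> real) \<Rightarrow> bool" where
  "centered_gaussian_process N T Y K \<longleftrightarrow> gaussian_process N T Y \<and>
     (\<forall>t\<in>T. (\<integral>\<omega>. Y t \<omega> \<partial>N) = 0) \<and> (\<forall>s\<in>T. \<forall>t\<in>T. covariance N (Y s) (Y t) = K s t)"


section \<open>The empirical process\<close>

definition emp_cdf :: "(nat \<Rightarrow> 'w \<Rightarrow> real^'m) \<Rightarrow> nat \<Rightarrow> 'w \<Rightarrow> real^'m \<Rightarrow> real" where
  "emp_cdf X n \<omega> x = (\<Sum>i=1..n. \<Prod>j\<in>UNIV. of_bool (X i \<omega> $ j \<le> x $ j)) / real n"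

definition marg_emp_cdf :: "(nat \<Rightarrow> 'w \<Rightarrow> real^'m) \<Rightarrow> 'm \<Rightarrow> nat \<Rightarrow> 'w \<Rightarrow> real \<Rightarrow> real" where
  "marg_emp_cdf X j n \<omega> t = (\<Sum>i=1..n. of_bool (X i \<omega> $ j \<le> t)) / real n"

text \<open>For n = 0 this is the zero function.\<close>

definition emp_process :: "(nat \<Rightarrow> 'w \<Rightarrow> real^'m) \<Rightarrow> 'm set \<Rightarrow> nat \<Rightarrow> 'w \<Rightarrow> real^'m \<Rightarrow> real" where
  "emp_process X V n \<omega> = (\<lambda>x\<in>cbox 0 1.
     sqrt (real n) *
       (emp_cdf X n \<omega> x - (\<Prod>i\<in>V. x $ i) * (\<Prod>j\<in>UNIV - V. marg_emp_cdf X j n \<omega> (x $ j))))"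

definition index_family :: "'m::finite set \<Rightarrow> 'm set set" where
  "index_family V = {UNIV} \<union> {UNIV - U |U. U \<subseteq> UNIV - V \<and> card U = 1}"

definition cov_fun :: "'m set set \<Rightarrow> ('m set \<Rightarrow> real) \<Rightarrow> real^'m \<Rightarrow> real^'m \<Rightarrow> real" where
  "cov_fun \<M> a x \<xi> =
     (\<Prod>j\<in>UNIV. min (x $ j) (\<xi> $ j)) -
     (\<Sum>U\<in>\<M>. a U * (\<Prod>j\<in>UNIV - U. min (x $ j) (\<xi> $ j)) * (\<Prod>i\<in>U. x $ i * \<xi> $ i))"

definition recurrent_coeffs :: "'m set set \<Rightarrow> ('m set \<Rightarrow> real) \<Rightarrow> bool" where
  "recurrent_coeffs \<M> a \<longleftrightarrow> (\<forall>U\<in>\<M>. (\<Sum>W\<in>{W\<in>\<M>. W \<subseteq> U}. a W) = 1)"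

lemma recurrent_coeffs_split:
  fixes \<M> :: "'m::finite set set"
  assumes "U \<in> \<M>"
  shows "(\<Sum>W\<in>{W\<in>\<M>. W \<subseteq> U}. a W) = a U + (\<Sum>W\<in>{W\<in>\<M>. W \<subset> U}. a W :: real)"
proof -
  have "{W\<in>\<M>. W \<subseteq> U} = insert U {W\<in>\<M>. W \<subset> U}" using assms by auto
  then show ?thesis by simp
qed

lemma recurrent_coeffs_unique:
  fixes \<M> :: "'m::finite set set"
  assumes a: "recurrent_coeffs \<M> a" and b: "recurrent_coeffs \<M> b" and "U \<in> \<M>"
  shows "a U = b U"
  using \<open>U \<in> \<M>\<close>
proof (induction "card U" arbitrary: U rule: less_induct)
  case less
  have "(\<Sum>W\<in>{W\<in>\<M>. W \<subset> U}. a W) = (\<Sum>W\<in>{W\<in>\<M>. W \<subset> U}. b W)"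
    by (rule sum.cong) (auto intro!: less.hyps psubset_card_mono)
  with a b less.prems show ?case
    using recurrent_coeffs_split[of U \<M> a] recurrent_coeffs_split[of U \<M> b]
    unfolding recurrent_coeffs_def by force
qed

lemma recurrent_coeffs_exist:
  fixes \<M> :: "'m::finite set set"
  shows "\<exists>a. recurrent_coeffs \<M> a"
proof -
  define R where "R = inv_image {(x, y). x < y} (card :: 'm set \<Rightarrow> nat)"
  define a where "a = wfrec R (\<lambda>f U. 1 - (\<Sum>W\<in>{W\<in>\<M>. W \<subset> U}. f W :: real))"
  have "wf R" unfolding R_def by (intro wf_inv_image wf)
  have "a U = 1 - (\<Sum>W\<in>{W\<in>\<M>. W \<subset> U}. a W)" for U
    unfolding a_def
    by (subst wfrec[OF \<open>wf R\<close>], intro arg_cong2[where f = minus] refl sum.cong)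
       (auto simp: cut_apply R_def psubset_card_mono)
  then have "recurrent_coeffs \<M> a"
    unfolding recurrent_coeffs_def using recurrent_coeffs_split[of _ \<M> a] by (metis diff_add_cancel)
  then show ?thesis by blast
qed

end

theory Submission
  imports Defs
begin

text \<open>
  Let \<open>U\<^sub>n(x) = \<surd>n (F\<^sub>n(x) - \<Prod> x\<^sub>j)\<close>. Since the margins of \<open>F\<^sub>n\<close> are read off at the points with all
  coordinates but one equal to 1, expanding \<open>\<Prod> F\<^bsub>j,n\<^esub>(x\<^sub>j)\<close> to first order turns the process of the theorem into
  \<open>\<Phi>(U\<^sub>n)\<close> up to an error of order \<open>sup \<bar>U\<^sub>n\<bar>\<^sup>2 / \<surd>n\<close>, where \<open>\<Phi>\<close> is linear and Lipschitz for the sup norm.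
  Dyadic chaining, with exponential moments bounding the increments between neighbours of a grid and monotonicity
  of \<open>F\<^sub>n\<close> below scale \<open>1/n\<close>, shows that \<open>U\<^sub>n\<close> is uniformly close to its step function
  interpolation on a dyadic grid, with probability close to 1 uniformly in \<open>n\<close>. The same chaining applied to a
  Gaussian family on the dyadic points (a Cholesky factorisation of the kernel of \<open>U\<^sub>n\<close> applied to independent
  normal variables) gives the limit bridge \<open>B\<close> with continuous paths, and \<open>\<Phi>(B)\<close> is the limit.
  On a fixed grid the one-dimensional central limit theorem and the Cramer--Wold device apply. Finally, bounded
  Lipschitz functions suffice for convergence in distribution in a metric space, and the Skorohod distance is
  dominated by the sup norm.
\<close>

section \<open>Cadlag functions on the cube\<close>

text \<open>Increments over a cell of side \<open>2^-r\<close> have standard deviation of order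
  \<open>2^(-r/2)\<close>. They are asked to stay below \<open>2^(-r/4)\<close>: this is summable
  over \<open>r\<close>, and the spare factor \<open>2^(r/4)\<close> gives tails
  \<open>exp(-2^(r/4))\<close>, which beat the \<open>2^(2mr)\<close> pairs of grid points. For
  \<open>U_n\<close> the exponential bound holds only for parameters up to \<open>sqrt n\<close>,
  that is for \<open>2^r \<le> n\<close>; this is why monotonicity has to take over there.

  Two obstacles come from the target space. Moving a jump is a large change in the sup norm, so
  measurability of the process is obtained by rounding the sample, which a small time change undoes.
  And the limit must lie in the space for every \<open>\<omega>\<close>, so its paths are set to
  zero off a measurable set of probability one.

  Compactness of laws is not invoked: the limit is built beforehand, and a fixed grid is compared
  with both processes before it is refined. That the kernel is positive semidefinite is read off
  from the sample itself, its quadratic form being a variance; hence the Gaussian laws are derived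
  over a given sample.\<close>

definition cadlag :: "(real^'m::finite \<Rightarrow> real) \<Rightarrow> bool" where
  "cadlag f \<longleftrightarrow> (\<forall>x\<in>cbox 0 1.
     (\<forall>A. \<exists>l. (f \<longlongrightarrow> l) (at x within quadrant x A)) \<and> (f \<longlongrightarrow> f x) (at x within quadrant x UNIV))"

lemma quadrant_subset: "quadrant x A \<subseteq> cbox 0 1"
  by (auto simp: quadrant_def)

lemma zero_in_cube: "(0::real^'m::finite) \<in> cbox 0 1"
  by (auto simp: mem_box_cart)

lemma tendsto_restrict_quadrant:
  fixes f :: "real^'m::finite \<Rightarrow> real"
  shows "(restrict f (cbox 0 1) \<longlongrightarrow> l) (at x within quadrant x A) \<longleftrightarrow> (f \<longlongrightarrow> l) (at x within quadrant x A)"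
  using quadrant_subset[of x A]
  by (intro filterlim_cong refl) (auto simp: eventually_at_filter restrict_def intro!: always_eventually)

lemma restrict_in_skorohod_space:
  assumes "cadlag f"
  shows "restrict f (cbox 0 1) \<in> skorohod_space"
  using assms unfolding skorohod_space_def cadlag_def continuous_within
  by (simp add: tendsto_restrict_quadrant)

text \<open>On an empty quadrant the filter is trivial, so the limit demanded by
  \<open>cadlag\<close> exists vacuously.\<close>

lemma skorohod_space_cadlag:
  fixes f :: "real^'m::finite \<Rightarrow> real"
  assumes "f \<in> skorohod_space"
  shows "cadlag f"
  unfolding cadlag_def
proof (intro ballI conjI allI)
  fix x :: "real^'m" and A assume x: "x \<in> cbox 0 1"
  show "\<exists>l. (f \<longlongrightarrow> l) (at x within quadrant x A)"
    using assms x by (cases "quadrant x A = {}") (auto simp: skorohod_space_def)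
  show "(f \<longlongrightarrow> f x) (at x within quadrant x UNIV)"
    using assms x by (auto simp: skorohod_space_def continuous_within)
qed

lemma cadlag_continuous:
  assumes "continuous_on (cbox 0 1) f"
  shows "cadlag f"
  using assms quadrant_subset tendsto_within_subset
  unfolding cadlag_def continuous_on_def by blast

lemma cadlag_const: "cadlag (\<lambda>_. c)"
  by (auto simp: cadlag_def)

lemma cadlag_add: "cadlag f \<Longrightarrow> cadlag g \<Longrightarrow> cadlag (\<lambda>x. f x + g x)"
  unfolding cadlag_def by (blast intro: tendsto_add)

lemma cadlag_mult: "cadlag f \<Longrightarrow> cadlag g \<Longrightarrow> cadlag (\<lambda>x. f x * g x)"
  unfolding cadlag_def by (blast intro: tendsto_mult)

lemma cadlag_diff: "cadlag f \<Longrightarrow> cadlag g \<Longrightarrow> cadlag (\<lambda>x. f x - g x)"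
  unfolding cadlag_def by (blast intro: tendsto_diff)

lemma cadlag_sum: "(\<And>i. i \<in> I \<Longrightarrow> cadlag (f i)) \<Longrightarrow> cadlag (\<lambda>x. \<Sum>i\<in>I. f i x)"
  by (induction I rule: infinite_finite_induct) (auto simp: cadlag_const cadlag_add)

lemma cadlag_prod: "(\<And>i. i \<in> I \<Longrightarrow> cadlag (f i)) \<Longrightarrow> cadlag (\<lambda>x. \<Prod>i\<in>I. f i x)"
  by (induction I rule: infinite_finite_induct) (auto simp: cadlag_const cadlag_mult)

text \<open>For \<open>j \<in> A\<close> the truth value of \<open>c \<le> y $ j\<close> near
  \<open>x\<close> is that of \<open>c \<le> x $ j\<close>; for \<open>j \<notin> A\<close> the
  approach is strictly from below and the limit is the indicator of \<open>c < x $ j\<close>. The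
  weak inequality makes the indicator continuous from the upper right. Empirical distribution
  functions and dyadic step functions are assembled from these indicators.\<close>

lemma cadlag_ge_indicator:
  fixes j :: "'m::finite"
  shows "cadlag (\<lambda>x. of_bool (c \<le> x $ j))"
proof -
  have ev1: "\<forall>\<^sub>F y in at x within S. y $ j < c" if "x $ j < c" for x :: "real^'m" and S
    by (rule order_tendstoD[OF _ that]) (intro tendsto_intros)
  have ev2: "\<forall>\<^sub>F y in at x within S. c < y $ j" if "c < x $ j" for x :: "real^'m" and S
    by (rule order_tendstoD[OF _ that]) (intro tendsto_intros)
  have evq: "\<forall>\<^sub>F y in at x within S. y \<in> S" for x :: "real^'m" and S
    by (simp add: eventually_at_filter)
  have ge: "((\<lambda>x. of_bool (c \<le> x $ j) :: real) \<longlongrightarrow> of_bool (c \<le> x $ j)) (at x within quadrant x A)"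
    if "j \<in> A" for x :: "real^'m" and A
  proof (rule tendsto_eventually, cases "c \<le> x $ j")
    case True
    show "\<forall>\<^sub>F y in at x within quadrant x A. (of_bool (c \<le> y $ j) :: real) = of_bool (c \<le> x $ j)"
      using evq by eventually_elim (use True that in \<open>auto simp: quadrant_def of_bool_def intro: order_trans\<close>)
  next
    case False
    then have "x $ j < c" by simp
    from ev1[OF this]
    show "\<forall>\<^sub>F y in at x within quadrant x A. (of_bool (c \<le> y $ j) :: real) = of_bool (c \<le> x $ j)"
      by eventually_elim (use False in auto)
  qed
  have lt: "((\<lambda>x. of_bool (c \<le> x $ j) :: real) \<longlongrightarrow> of_bool (c < x $ j)) (at x within quadrant x A)"
    if "j \<notin> A" for x :: "real^'m" and A
  proof (rule tendsto_eventually, cases "c < x $ j")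
    case True
    from ev2[OF this]
    show "\<forall>\<^sub>F y in at x within quadrant x A. (of_bool (c \<le> y $ j) :: real) = of_bool (c < x $ j)"
      by eventually_elim (use True in auto)
  next
    case False
    show "\<forall>\<^sub>F y in at x within quadrant x A. (of_bool (c \<le> y $ j) :: real) = of_bool (c < x $ j)"
      using evq
    proof eventually_elim
      case (elim y)
      then have "y $ j < x $ j" using that by (auto simp: quadrant_def)
      then show ?case using False by simp
    qed
  qed
  show ?thesis
    unfolding cadlag_def using ge lt by blast
qed

lemma in_own_quadrant: "y \<in> cbox 0 1 \<Longrightarrow> y \<in> quadrant x {j. x $ j \<le> y $ j}"
  by (auto simp: quadrant_def)

text \<open>Finitely many quadrants meet at a point, so finitely many limits bound \<open>f\<close>
  near it, and compactness of the cube makes the bound global. This is what makes the suprema in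
  \<open>skorohod_dist\<close> suprema of bounded sets.\<close>

lemma cadlag_bounded:
  fixes f :: "real^'m::finite \<Rightarrow> real"
  assumes "cadlag f"
  shows "bounded (f ` cbox 0 1)"
proof -
  have "\<exists>B U. open U \<and> x \<in> U \<and> (\<forall>y\<in>U \<inter> cbox 0 1. \<bar>f y\<bar> \<le> B)" if x: "x \<in> cbox 0 1" for x
  proof -
    obtain l where l: "\<And>A. (f \<longlongrightarrow> l A) (at x within quadrant x A)"
      using assms x unfolding cadlag_def by metis
    have "\<forall>\<^sub>F y in at x. y \<in> quadrant x A \<longrightarrow> \<bar>f y\<bar> < \<bar>l A\<bar> + 1" for A
    proof -
      have "\<forall>\<^sub>F y in at x within quadrant x A. \<bar>f y\<bar> < \<bar>l A\<bar> + 1"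
        by (rule order_tendstoD(2)[OF tendsto_rabs[OF l]]) simp
      then show ?thesis
        by (simp add: eventually_at_filter imp_conjL)
    qed
    then have "\<forall>\<^sub>F y in at x. \<forall>A\<in>UNIV. y \<in> quadrant x A \<longrightarrow> \<bar>f y\<bar> < \<bar>l A\<bar> + 1"
      by (intro eventually_ball_finite) auto
    then obtain U where U: "open U" "x \<in> U"
      "\<And>y A. y \<in> U \<Longrightarrow> y \<noteq> x \<Longrightarrow> y \<in> quadrant x A \<Longrightarrow> \<bar>f y\<bar> < \<bar>l A\<bar> + 1"
      unfolding eventually_at_topological by blast
    \<comment> \<open>Limits at \<open>x\<close> do not see the value at \<open>x\<close>; the
      summand \<open>\<bar>f x\<bar>\<close> covers it.\<close>
    define B where "B = Max (range (\<lambda>A. \<bar>l A\<bar> + 1)) + \<bar>f x\<bar>"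
    have "\<bar>f y\<bar> \<le> B" if y: "y \<in> U \<inter> cbox 0 1" for y
    proof (cases "y = x")
      case True
      have "0 \<le> \<bar>l {}\<bar> + 1" by simp
      also have "\<dots> \<le> Max (range (\<lambda>A. \<bar>l A\<bar> + 1))" by (intro Max_ge) auto
      finally show ?thesis using True by (simp add: B_def)
    next
      case False
      define A where "A = {j. x $ j \<le> y $ j}"
      have "\<bar>f y\<bar> < \<bar>l A\<bar> + 1" using U(3)[of y A] y False in_own_quadrant[of y x] by (auto simp: A_def)
      also have "\<dots> \<le> Max (range (\<lambda>A. \<bar>l A\<bar> + 1))" by (intro Max_ge) auto
      finally show ?thesis by (simp add: B_def)
    qed
    then show ?thesis using U by blast
  qed
  then obtain B U where BU: "\<And>x. x \<in> cbox 0 1 \<Longrightarrow> open (U x) \<and> x \<in> U x \<and> (\<forall>y\<in>U x \<inter> cbox 0 1. \<bar>f y\<bar> \<le> B x)"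
    by metis
  obtain C where C: "C \<subseteq> cbox 0 1" "finite C" "cbox 0 1 \<subseteq> (\<Union>c\<in>C. U c)"
    by (rule compactE_image[of "cbox (0::real^'m) 1" "cbox 0 1" U]) (use BU in \<open>auto intro: compact_cbox\<close>)
  show ?thesis
    unfolding bounded_iff
  proof (intro exI ballI)
    fix z assume "z \<in> f ` cbox 0 1"
    then obtain y where y: "y \<in> cbox 0 1" "z = f y" by auto
    then obtain c where c: "c \<in> C" "y \<in> U c" using C by auto
    have "\<bar>f y\<bar> \<le> B c" using BU c C y by auto
    also have "\<dots> \<le> Max (B ` C)" using c C by auto
    finally show "norm z \<le> Max (B ` C)" using y by simp
  qed
qed

section \<open>The Skorohod metric\<close>

lemma time_change_id: "time_change (\<lambda>x. x)"
  unfolding time_change_def by (auto intro!: strict_mono_onI exI[of _ "\<lambda>x. x"] simp: homeomorphism_def)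

lemma time_change_image: "time_change l \<Longrightarrow> l ` {0..1} = {0..1}"
  by (auto simp: time_change_def homeomorphism_def)

lemma time_change_in: "time_change l \<Longrightarrow> t \<in> {0..1} \<Longrightarrow> l t \<in> {0..1}"
  using time_change_image[of l] by blast

lemma time_change_le_iff:
  assumes "time_change l" "s \<in> {0..1}" "t \<in> {0..1}"
  shows "l s \<le> l t \<longleftrightarrow> s \<le> t"
  using assms unfolding time_change_def
  by (meson strict_mono_on_leD linorder_not_less strict_mono_onD)

lemma time_change_1:
  assumes "time_change l" shows "l 1 = 1"
proof -
  have "(1::real) \<in> l ` {0..1}" using time_change_image[OF assms] by simp
  then obtain t where t: "t \<in> {0..1}" "1 = l t" by (rule imageE)
  then have "l t \<le> l 1" using time_change_le_iff[OF assms, of t 1] by simp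
  moreover have "l 1 \<in> {0..1}" by (rule time_change_in[OF assms]) simp
  ultimately show ?thesis using t by simp
qed

lemma time_change_compose:
  assumes "time_change k" "time_change l" shows "time_change (\<lambda>t. k (l t))"
proof -
  obtain k' l' where *: "homeomorphism {0..1} {0..1} k k'" "homeomorphism {0..1} {0..1} l l'"
    using assms by (auto simp: time_change_def)
  have "homeomorphism {0..1} {0..1} (k \<circ> l) (l' \<circ> k')"
    by (rule homeomorphism_compose[OF *(2,1)])
  moreover have "strict_mono_on {0..1} (\<lambda>t. k (l t))"
    using assms time_change_in[OF assms(2)] by (auto simp: time_change_def strict_mono_on_def)
  ultimately show ?thesis by (auto simp: time_change_def comp_def)
qed

lemma time_change_inverse:
  assumes "time_change l"
  obtains k where "time_change k" "\<And>t. t \<in> {0..1} \<Longrightarrow> k (l t) = t" "\<And>t. t \<in> {0..1} \<Longrightarrow> l (k t) = t"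
proof -
  obtain k where k: "homeomorphism {0..1} {0..1} l k"
    using assms by (auto simp: time_change_def)
  have kl: "k (l t) = t" "l (k t) = t" if "t \<in> {0..1}" for t
    using k that by (auto simp: homeomorphism_def)
  have kin: "k t \<in> {0..1}" if "t \<in> {0..1}" for t
    using k that by (auto simp: homeomorphism_def)
  have "strict_mono_on {0..1} k"
  proof (rule strict_mono_onI)
    fix r s :: real assume rs: "r \<in> {0..1}" "s \<in> {0..1}" "r < s"
    then show "k r < k s"
      using time_change_le_iff[OF assms kin[of s] kin[of r]] kl(2) by force
  qed
  then have "time_change k"
    using homeomorphism_symD[OF k] by (auto simp: time_change_def)
  with kl show ?thesis using that by blast
qed

lemma apply_time_changes_nth [simp]: "apply_time_changes l x $ j = l j (x $ j)"
  by (simp add: apply_time_changes_def)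

lemma apply_time_changes_cube:
  assumes "\<forall>j. time_change (l j)" "x \<in> cbox 0 1"
  shows "apply_time_changes l x \<in> cbox 0 (1::real^'m::finite)"
proof -
  have "x $ j \<in> {0..1}" for j using assms(2) by (auto simp: mem_box_cart)
  then have "l j (x $ j) \<in> {0..1}" for j using time_change_in assms(1) by blast
  then show ?thesis by (auto simp: mem_box_cart)
qed

text \<open>The infimum need not be attained, so the metric axioms are all derived from this strict
  form. It hands out one time change together with one radius \<open>r < e\<close> that serves both
  suprema.\<close>

lemma skorohod_dist_less_iff:
  fixes f g :: "real^'m::finite \<Rightarrow> real"
  assumes f: "f \<in> skorohod_space" and g: "g \<in> skorohod_space"
  shows "skorohod_dist f g < e \<longleftrightarrow> (\<exists>l r. (\<forall>j. time_change (l j)) \<and> r < e \<and>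
    (\<forall>x\<in>cbox 0 1. \<bar>f x - g (apply_time_changes l x)\<bar> \<le> r \<and> norm (apply_time_changes l x - x) \<le> r))"
proof -
  define T where "T = {l :: 'm \<Rightarrow> real \<Rightarrow> real. \<forall>j. time_change (l j)}"
  define s1 where "s1 l = (SUP x\<in>cbox 0 1. \<bar>f x - g (apply_time_changes l x)\<bar>)" for l
  define s2 where "s2 l = (SUP x\<in>cbox 0 1. norm (apply_time_changes l x - (x::real^'m)))" for l
  have ne: "cbox 0 (1::real^'m) \<noteq> {}" using zero_in_cube by blast
  obtain b1 where b1: "\<And>x. x \<in> cbox 0 1 \<Longrightarrow> \<bar>f x\<bar> \<le> b1"
    using cadlag_bounded[OF skorohod_space_cadlag[OF f]] by (auto simp: bounded_iff)
  obtain b2 where b2: "\<And>x. x \<in> cbox 0 1 \<Longrightarrow> \<bar>g x\<bar> \<le> b2"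
    using cadlag_bounded[OF skorohod_space_cadlag[OF g]] by (auto simp: bounded_iff)
  obtain b3 where b3: "\<And>x. x \<in> cbox 0 (1::real^'m) \<Longrightarrow> norm x \<le> b3"
    using bounded_cbox[of 0 "1::real^'m"] by (auto simp: bounded_iff)
  have bd1: "bdd_above ((\<lambda>x. \<bar>f x - g (apply_time_changes l x)\<bar>) ` cbox 0 1)" if "l \<in> T" for l
  proof (rule bdd_aboveI2[where M = "b1 + b2"])
    fix x :: "real^'m" assume x: "x \<in> cbox 0 1"
    show "\<bar>f x - g (apply_time_changes l x)\<bar> \<le> b1 + b2"
      using b1[OF x] b2[OF apply_time_changes_cube[OF _ x, of l]] that by (auto simp: T_def)
  qed
  have bd2: "bdd_above ((\<lambda>x. norm (apply_time_changes l x - (x::real^'m))) ` cbox 0 1)" if "l \<in> T" for l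
  proof (rule bdd_aboveI2[where M = "b3 + b3"])
    fix x :: "real^'m" assume x: "x \<in> cbox 0 1"
    show "norm (apply_time_changes l x - x) \<le> b3 + b3"
      using b3[OF x] b3[OF apply_time_changes_cube[OF _ x, of l]] that
        norm_triangle_ineq4[of "apply_time_changes l x" x] by (auto simp: T_def)
  qed
  have s1_le: "s1 l \<le> r \<longleftrightarrow> (\<forall>x\<in>cbox 0 1. \<bar>f x - g (apply_time_changes l x)\<bar> \<le> r)" if "l \<in> T" for l r
    unfolding s1_def by (rule cSUP_le_iff[OF ne bd1[OF that]])
  have s2_le: "s2 l \<le> r \<longleftrightarrow> (\<forall>x\<in>cbox 0 1. norm (apply_time_changes l x - (x::real^'m)) \<le> r)" if "l \<in> T" for l r
    unfolding s2_def by (rule cSUP_le_iff[OF ne bd2[OF that]])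
  have s2_ge: "0 \<le> s2 l" if "l \<in> T" for l
    using s2_le[OF that, of "s2 l"] ne norm_ge_zero order_trans by blast
  have Tne: "T \<noteq> {}" using time_change_id by (auto simp: T_def)
  have "skorohod_dist f g = (INF l\<in>T. max (s1 l) (s2 l))"
    using f g by (simp add: skorohod_dist_def T_def s1_def s2_def)
  also have "\<dots> < e \<longleftrightarrow> (\<exists>l\<in>T. max (s1 l) (s2 l) < e)"
    by (rule cINF_less_iff[OF Tne]) (auto intro!: bdd_belowI2[where m = 0] dest: s2_ge)
  also have "\<dots> \<longleftrightarrow> (\<exists>l\<in>T. \<exists>r<e. s1 l \<le> r \<and> s2 l \<le> r)"
    by (meson max.cobounded1 max.cobounded2 max_less_iff_conj order_le_less_trans)
  also have "\<dots> \<longleftrightarrow> (\<exists>l r. l \<in> T \<and> r < e \<and> (\<forall>x\<in>cbox 0 1. \<bar>f x - g (apply_time_changes l x)\<bar> \<le> r \<and> norm (apply_time_changes l x - x) \<le> r))"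
    using s1_le s2_le by blast
  finally show ?thesis by (simp add: T_def)
qed

lemma skorohod_dist_le_sup:
  fixes f g :: "real^'m::finite \<Rightarrow> real"
  assumes "f \<in> skorohod_space" "g \<in> skorohod_space" and le: "\<And>x. x \<in> cbox 0 1 \<Longrightarrow> \<bar>f x - g x\<bar> \<le> e"
  shows "skorohod_dist f g \<le> e"
proof (rule field_le_epsilon)
  fix d :: real assume "d > 0"
  from le[OF zero_in_cube] have "e \<ge> 0" by linarith
  have id: "apply_time_changes (\<lambda>_ t. t) x = x" for x :: "real^'m" by (simp add: vec_eq_iff)
  have "skorohod_dist f g < e + d"
    unfolding skorohod_dist_less_iff[OF assms(1,2)]
    by (rule exI[of _ "\<lambda>_ t. t"], rule exI[of _ e])
       (use \<open>d > 0\<close> \<open>e \<ge> 0\<close> le id time_change_id in auto)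
  then show "skorohod_dist f g \<le> e + d" by simp
qed

lemma skorohod_dist_nonneg:
  fixes f g :: "real^'m::finite \<Rightarrow> real"
  shows "0 \<le> skorohod_dist f g"
proof (rule ccontr)
  assume neg: "\<not> ?thesis"
  then have fg: "f \<in> skorohod_space" "g \<in> skorohod_space" by (auto simp: skorohod_dist_def split: if_splits)
  have "skorohod_dist f g < 0" using neg by simp
  then obtain l r where "r < 0 \<and> (\<forall>x\<in>cbox 0 1. norm (apply_time_changes l x - (x::real^'m)) \<le> r)"
    unfolding skorohod_dist_less_iff[OF fg] by blast
  then have "r < 0" "norm (apply_time_changes l 0 - (0::real^'m)) \<le> r"
    using zero_in_cube[where 'm = 'm] by blast+
  then show False using norm_ge_zero[of "apply_time_changes l 0 - (0::real^'m)"] by linarith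
qed

text \<open>Substituting the inverse time change for the argument exchanges \<open>f\<close> and
  \<open>g\<close> and keeps both bounds.\<close>

lemma skorohod_dist_less_commute:
  fixes f g :: "real^'m::finite \<Rightarrow> real"
  assumes fg: "f \<in> skorohod_space" "g \<in> skorohod_space" and less: "skorohod_dist f g < e"
  shows "skorohod_dist g f < e"
proof -
  obtain l r where l: "\<forall>j. time_change (l j)" and r: "r < e"
    and le: "\<And>x. x \<in> cbox 0 1 \<Longrightarrow> \<bar>f x - g (apply_time_changes l x)\<bar> \<le> r \<and> norm (apply_time_changes l x - x) \<le> r"
    using less skorohod_dist_less_iff[OF fg] by auto
  have "\<forall>j. \<exists>k. time_change k \<and> (\<forall>t\<in>{0..1}. l j (k t) = t)"
    using time_change_inverse l by metis
  then obtain k where k: "\<forall>j. time_change (k j)" "\<And>j t. t \<in> {0..1} \<Longrightarrow> l j (k j t) = t"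
    by metis
  have lk: "apply_time_changes l (apply_time_changes k x) = x" if "x \<in> cbox 0 1" for x
    using that k(2) by (simp add: vec_eq_iff mem_box_cart)
  show ?thesis
    unfolding skorohod_dist_less_iff[OF fg(2,1)]
  proof (intro exI conjI ballI)
    fix x :: "real^'m" assume x: "x \<in> cbox 0 1"
    note le = le[OF apply_time_changes_cube[OF k(1) x]]
    show "\<bar>g x - f (apply_time_changes k x)\<bar> \<le> r" using le x by (simp add: lk abs_minus_commute)
    show "norm (apply_time_changes k x - x) \<le> r" using le x by (simp add: lk norm_minus_commute)
  qed (use k r in auto)
qed

lemma skorohod_dist_less_triangle:
  fixes f g h :: "real^'m::finite \<Rightarrow> real"
  assumes f: "f \<in> skorohod_space" and g: "g \<in> skorohod_space" and h: "h \<in> skorohod_space"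
    and a: "skorohod_dist f g < a" and b: "skorohod_dist g h < b"
  shows "skorohod_dist f h < a + b"
proof -
  obtain l r where l: "\<forall>j. time_change (l j)" and r: "r < a"
    and le: "\<And>x. x \<in> cbox 0 1 \<Longrightarrow> \<bar>f x - g (apply_time_changes l x)\<bar> \<le> r \<and> norm (apply_time_changes l x - x) \<le> r"
    using a skorohod_dist_less_iff[OF f g] by auto
  obtain k s where k: "\<forall>j. time_change (k j)" and s: "s < b"
    and le': "\<And>x. x \<in> cbox 0 1 \<Longrightarrow> \<bar>g x - h (apply_time_changes k x)\<bar> \<le> s \<and> norm (apply_time_changes k x - x) \<le> s"
    using b skorohod_dist_less_iff[OF g h] by auto
  have kl: "apply_time_changes (\<lambda>j t. k j (l j t)) x = apply_time_changes k (apply_time_changes l x)" for x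
    by (simp add: vec_eq_iff)
  show ?thesis
    unfolding skorohod_dist_less_iff[OF f h]
  proof (intro exI conjI ballI)
    show "\<forall>j. time_change (\<lambda>t. k j (l j t))" using k l time_change_compose by blast
    show "r + s < a + b" using r s by simp
    fix x :: "real^'m" assume x: "x \<in> cbox 0 1"
    note 1 = le[OF x] and 2 = le'[OF apply_time_changes_cube[OF l x]]
    show "\<bar>f x - h (apply_time_changes (\<lambda>j t. k j (l j t)) x)\<bar> \<le> r + s"
      unfolding kl using 1 2 by linarith
    have "apply_time_changes k (apply_time_changes l x) - x =
        (apply_time_changes k (apply_time_changes l x) - apply_time_changes l x) + (apply_time_changes l x - x)"
      by simp
    then show "norm (apply_time_changes (\<lambda>j t. k j (l j t)) x - x) \<le> r + s"
      unfolding kl using 1 2 norm_triangle_le by (metis add.commute add_mono)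
  qed
qed

text \<open>A point \<open>y\<close> close to \<open>x\<close> and strictly larger in all coordinates below 1 is moved by a small
  time change into the upper right quadrant of \<open>x\<close>; hence right continuity decides equality.\<close>

lemma skorohod_dist_zero_imp_eq:
  fixes f g :: "real^'m::finite \<Rightarrow> real"
  assumes f: "f \<in> skorohod_space" and g: "g \<in> skorohod_space" and zero: "skorohod_dist f g = 0"
    and x: "x \<in> cbox 0 1"
  shows "f x = g x"
proof (rule ccontr)
  assume "f x \<noteq> g x"
  define e where "e = \<bar>f x - g x\<bar> / 3"
  have e: "e > 0" using \<open>f x \<noteq> g x\<close> by (simp add: e_def)
  have right: "\<exists>d>0. \<forall>y\<in>quadrant x UNIV. dist y x < d \<longrightarrow> \<bar>u y - u x\<bar> < e" if "u \<in> skorohod_space" for u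
    using that x e unfolding skorohod_space_def continuous_within_eps_delta dist_real_def by blast
  obtain d1 where d1: "d1 > 0" "\<And>y. y \<in> quadrant x UNIV \<Longrightarrow> dist y x < d1 \<Longrightarrow> \<bar>f y - f x\<bar> < e"
    using right[OF f] by blast
  obtain d2 where d2: "d2 > 0" "\<And>y. y \<in> quadrant x UNIV \<Longrightarrow> dist y x < d2 \<Longrightarrow> \<bar>g y - g x\<bar> < e"
    using right[OF g] by blast
  define c where "c = real CARD('m)"
  have c: "c \<ge> 1" unfolding c_def by (simp add: Suc_leI)
  \<comment> \<open>\<open>c * d\<close> bounds the distance from \<open>y\<close> to
    \<open>x\<close>; the 4 leaves room for the further displacement of \<open>y\<close> by the time
    change.\<close>
  define d where "d = min d1 d2 / (4 * c)"
  have d: "d > 0" using d1 d2 c by (simp add: d_def)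
  define y where "y = (\<chi> j. min 1 (x $ j + d))"
  have xj: "0 \<le> x $ j \<and> x $ j \<le> 1" for j using x by (auto simp: mem_box_cart)
  have y: "y \<in> cbox 0 1" using d by (auto simp: mem_box_cart y_def intro!: add_nonneg_nonneg xj[THEN conjunct1])
  have yx: "y \<in> quadrant x UNIV" using y d xj by (auto simp: quadrant_def y_def)
  have bound: "norm (z :: real^'m) \<le> c * s" if "\<And>j. \<bar>z $ j\<bar> \<le> s" for z s
  proof -
    have "norm z \<le> (\<Sum>j\<in>UNIV. \<bar>z $ j\<bar>)" by (rule norm_le_l1_cart)
    also have "\<dots> \<le> (\<Sum>j\<in>(UNIV::'m set). s)" by (intro sum_mono that)
    finally show ?thesis by (simp add: c_def)
  qed
  have dyx: "dist y x \<le> c * d" unfolding dist_norm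
    by (rule bound) (use xj d in \<open>auto simp: y_def min_def\<close>)
  have cd: "c * d \<le> min d1 d2 / 4" using c by (simp add: d_def)
  \<comment> \<open>The least room between \<open>y\<close> and \<open>x\<close> in a coordinate
    below 1: a time change that moves points by less than \<open>gap\<close> cannot push
    \<open>y\<close> below \<open>x\<close>. Coordinates equal to 1 get the dummy value 1, since
    time changes fix 1. Inserting \<open>d\<close> keeps the set nonempty and gives
    \<open>gap \<le> d\<close>.\<close>
  define gap where "gap = Min (insert d (range (\<lambda>j. if x $ j < 1 then y $ j - x $ j else 1)))"
  have gap0: "gap > 0" using d xj unfolding gap_def
    by (subst Min_gr_iff) (auto simp: y_def min_def)
  have gapj: "gap \<le> y $ j - x $ j" if "x $ j < 1" for j
  proof -
    have "gap \<le> (if x $ j < 1 then y $ j - x $ j else 1)" unfolding gap_def by (intro Min_le) auto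
    with that show ?thesis by simp
  qed
  have gapd: "gap \<le> d" unfolding gap_def by (intro Min_le) auto
  obtain l r where l: "\<forall>j. time_change (l j)" and r: "r < min e gap"
    and le: "\<And>x. x \<in> cbox 0 1 \<Longrightarrow> \<bar>f x - g (apply_time_changes l x)\<bar> \<le> r \<and> norm (apply_time_changes l x - x) \<le> r"
    using zero e gap0 skorohod_dist_less_iff[OF f g, of "min e gap"] by auto
  let ?z = "apply_time_changes l y"
  have z: "?z \<in> cbox 0 1" by (rule apply_time_changes_cube[OF l y])
  have zx: "?z \<in> quadrant x UNIV"
    unfolding quadrant_def
  proof (auto simp: z simp del: apply_time_changes_nth)
    fix j
    show "x $ j \<le> ?z $ j"
    proof (cases "x $ j < 1")
      case True
      have "\<bar>(?z - y) $ j\<bar> \<le> r" using le[OF y] component_le_norm_cart order_trans by blast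
      then show ?thesis using gapj[OF True] r by (simp add: abs_le_iff)
    next
      case False
      then have "y $ j = 1" "x $ j = 1" using xj[of j] d by (auto simp: y_def min_def)
      then show ?thesis using time_change_1[of "l j"] l by simp
    qed
  qed
  have "dist ?z x \<le> dist ?z y + dist y x" by (rule dist_triangle)
  also have "\<dots> \<le> r + c * d" using le[OF y] dyx by (simp add: dist_norm)
  also have "\<dots> < min d1 d2"
  proof -
    have "r < d" using r gapd by simp
    also have "d \<le> c * d" using c d by simp
    finally show ?thesis using cd d1 d2 by linarith
  qed
  finally have "\<bar>g ?z - g x\<bar> < e" using d2(2)[OF zx] by simp
  moreover have "\<bar>f y - f x\<bar> < e" using d1(2)[OF yx] dyx cd d1 d2 by linarith
  moreover have "\<bar>f y - g ?z\<bar> < e" using le[OF y] r by simp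
  ultimately have "\<bar>f x - g x\<bar> < 3 * e" by linarith
  then show False by (simp add: e_def)
qed

interpretation skorohod: Metric_space "skorohod_space :: (real^'m::finite \<Rightarrow> real) set" skorohod_dist
proof
  fix f g h :: "real^'m \<Rightarrow> real"
  show "0 \<le> skorohod_dist f g" by (rule skorohod_dist_nonneg)
  show "skorohod_dist f g = skorohod_dist g f"
  proof (cases "f \<in> skorohod_space \<and> g \<in> skorohod_space")
    case True
    then show ?thesis using skorohod_dist_less_commute by (metis linorder_less_linear order_less_irrefl)
  qed (auto simp: skorohod_dist_def)
  show "skorohod_dist f h \<le> skorohod_dist f g + skorohod_dist g h"
    if "f \<in> skorohod_space" "g \<in> skorohod_space" "h \<in> skorohod_space"
  proof (rule field_le_epsilon)
    fix e :: real assume "e > 0"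
    then show "skorohod_dist f h \<le> skorohod_dist f g + skorohod_dist g h + e"
      using skorohod_dist_less_triangle[OF that, of "skorohod_dist f g + e/2" "skorohod_dist g h + e/2"] by simp
  qed
  show "skorohod_dist f g = 0 \<longleftrightarrow> f = g" if fg: "f \<in> skorohod_space" "g \<in> skorohod_space"
  proof
    assume "skorohod_dist f g = 0"
    then have "f x = g x" if "x \<in> cbox 0 1" for x using skorohod_dist_zero_imp_eq[OF fg _ that] by blast
    then show "f = g" using fg by (intro extensionalityI[of f "cbox 0 1"]) (auto simp: skorohod_space_def)
  next
    assume "f = g"
    then show "skorohod_dist f g = 0"
      using skorohod_dist_le_sup[OF fg, of 0] skorohod_dist_nonneg[of f g] by simp
  qed
qed

lemma skorohod_topology_eq: "skorohod_topology = skorohod.mtopology"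
  by (simp add: skorohod_topology_def)

lemma topspace_skorohod [simp]: "topspace skorohod_topology = skorohod_space"
  by (simp add: skorohod_topology_eq)

section \<open>Measurability and weak convergence in the Skorohod space\<close>

definition skorohod_lipschitz :: "((real^'m::finite \<Rightarrow> real) \<Rightarrow> real) \<Rightarrow> real \<Rightarrow> bool" where
  "skorohod_lipschitz h L \<longleftrightarrow> (\<forall>f\<in>skorohod_space. \<forall>g\<in>skorohod_space. \<bar>h f - h g\<bar> \<le> L * skorohod_dist f g)"

lemma skorohod_lipschitz_continuous_map:
  fixes h :: "(real^'m::finite \<Rightarrow> real) \<Rightarrow> real"
  assumes "skorohod_lipschitz h L" "L > 0"
  shows "continuous_map skorohod_topology euclideanreal h"
proof -
  have "\<exists>\<delta>>0. \<forall>g. g \<in> skorohod_space \<and> skorohod_dist f g < \<delta> \<longrightarrow> dist (h f) (h g) < e"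
    if "f \<in> skorohod_space" "e > 0" for f e
  proof (intro exI[of _ "e / L"] conjI allI impI)
    fix g assume g: "g \<in> skorohod_space \<and> skorohod_dist f g < e / L"
    have "\<bar>h f - h g\<bar> \<le> L * skorohod_dist f g" using assms that g by (auto simp: skorohod_lipschitz_def)
    also have "\<dots> < L * (e / L)" using g assms by (intro mult_strict_left_mono) auto
    finally show "dist (h f) (h g) < e" using assms by (simp add: dist_real_def)
  qed (use assms that in auto)
  then show ?thesis
    unfolding skorohod_topology_eq using skorohod.metric_continuous_map[OF Met_TC.Metric_space_axioms, of h]
    by simp
qed

lemma space_borel_sigma [simp]: "space (borel_sigma T) = topspace T"
  unfolding borel_sigma_def by (rule space_measure_of) (auto dest: openin_subset)

lemma openin_sets_borel_sigma: "openin T U \<Longrightarrow> U \<in> sets (borel_sigma T)"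
  unfolding borel_sigma_def by (subst sets_measure_of) (auto dest: openin_subset)

lemma measurable_borel_sigmaI:
  assumes "\<And>\<omega>. \<omega> \<in> space P \<Longrightarrow> Z \<omega> \<in> topspace T"
    and "\<And>U. openin T U \<Longrightarrow> Z -` U \<inter> space P \<in> sets P"
  shows "Z \<in> measurable P (borel_sigma T)"
  unfolding borel_sigma_def using assms
  by (intro measurable_measure_of) (auto dest: openin_subset)

lemma continuous_map_borel_measurable:
  assumes "continuous_map T euclideanreal h"
  shows "h \<in> borel_measurable (borel_sigma T)"
proof (rule borel_measurableI)
  fix S :: "real set" assume "open S"
  then have "openin T {x \<in> topspace T. h x \<in> S}"
    using assms by (auto intro: openin_continuous_map_preimage)
  moreover have "h -` S \<inter> space (borel_sigma T) = {x \<in> topspace T. h x \<in> S}" by auto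
  ultimately show "h -` S \<inter> space (borel_sigma T) \<in> sets (borel_sigma T)"
    using openin_sets_borel_sigma by metis
qed

lemma skorohod_setdist_lipschitz:
  fixes C :: "(real^'m::finite \<Rightarrow> real) set"
  assumes C: "C \<subseteq> skorohod_space" "C \<noteq> {}"
  shows "skorohod_lipschitz (\<lambda>f. INF g\<in>C. skorohod_dist f g) 1"
proof -
  have bdd: "bdd_below (skorohod_dist f ` C)" for f
    by (rule bdd_belowI2[where m = 0]) simp
  have "(INF g\<in>C. skorohod_dist f g) \<le> (INF g\<in>C. skorohod_dist f' g) + skorohod_dist f f'"
    if "f \<in> skorohod_space" "f' \<in> skorohod_space" for f f'
  proof -
    have "(INF g\<in>C. skorohod_dist f g) - skorohod_dist f f' \<le> (INF g\<in>C. skorohod_dist f' g)"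
    proof (rule cINF_greatest[OF C(2)])
      fix g assume g: "g \<in> C"
      have "(INF g\<in>C. skorohod_dist f g) \<le> skorohod_dist f g" by (rule cINF_lower[OF bdd g])
      also have "\<dots> \<le> skorohod_dist f f' + skorohod_dist f' g" using that g C by (intro skorohod.triangle) auto
      finally show "(INF g\<in>C. skorohod_dist f g) - skorohod_dist f f' \<le> skorohod_dist f' g" by simp
    qed
    then show ?thesis by simp
  qed
  then show ?thesis
    unfolding skorohod_lipschitz_def by (smt (verit) skorohod.commute mult_1)
qed

text \<open>An open set is the set where the distance to its complement is positive, and this
  distance is a Lipschitz real function; so the claim reduces to pointwise limits of real measurable
  functions. The whole space is treated apart, because its complement is empty and the infimum says
  nothing.\<close>

lemma measurable_skorohod_limit:
  fixes Z :: "'w \<Rightarrow> real^'m::finite \<Rightarrow> real"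
  assumes meas: "\<And>k. Y k \<in> measurable P (borel_sigma skorohod_topology)"
    and Z: "\<And>\<omega>. \<omega> \<in> space P \<Longrightarrow> Z \<omega> \<in> skorohod_space"
    and lim: "\<And>\<omega>. \<omega> \<in> space P \<Longrightarrow> (\<lambda>k. skorohod_dist (Y k \<omega>) (Z \<omega>)) \<longlonglongrightarrow> 0"
  shows "Z \<in> measurable P (borel_sigma skorohod_topology)"
proof (rule measurable_borel_sigmaI)
  fix U :: "(real^'m \<Rightarrow> real) set" assume U: "openin skorohod_topology U"
  define C where "C = skorohod_space - U"
  have U': "U \<subseteq> skorohod_space" using U openin_subset by fastforce
  show "Z -` U \<inter> space P \<in> sets P"
  proof (cases "C = {}")
    case True
    then have "Z -` U \<inter> space P = space P" using Z by (auto simp: C_def)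
    then show ?thesis by simp
  next
    case False
    define \<rho> where "\<rho> f = (INF g\<in>C. skorohod_dist f g)" for f
    have C: "C \<subseteq> skorohod_space" by (auto simp: C_def)
    have lip: "skorohod_lipschitz \<rho> 1"
      unfolding \<rho>_def by (rule skorohod_setdist_lipschitz[OF C False])
    have U_iff: "f \<in> U \<longleftrightarrow> 0 < \<rho> f" if f: "f \<in> skorohod_space" for f
    proof
      assume "f \<in> U"
      then obtain r where r: "r > 0" "skorohod.mball f r \<subseteq> U"
        using U unfolding skorohod_topology_eq skorohod.openin_mtopology by blast
      have "r \<le> skorohod_dist f g" if "g \<in> C" for g
        using that r f by (auto simp: C_def skorohod.mball_def not_less subset_eq)
      then have "r \<le> \<rho> f" unfolding \<rho>_def by (rule cINF_greatest[OF False])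
      then show "0 < \<rho> f" using r by simp
    next
      assume pos: "0 < \<rho> f"
      show "f \<in> U"
      proof (rule ccontr)
        assume "f \<notin> U"
        then have "f \<in> C" using f by (simp add: C_def)
        then have "\<rho> f \<le> skorohod_dist f f" unfolding \<rho>_def
          by (intro cINF_lower bdd_belowI2[where m = 0]) auto
        then show False using pos f by simp
      qed
    qed
    have Y: "Y k \<omega> \<in> skorohod_space" if "\<omega> \<in> space P" for k \<omega>
      using measurable_space[OF meas that] by simp
    have "(\<lambda>k. \<rho> (Y k \<omega>)) \<longlonglongrightarrow> \<rho> (Z \<omega>)" if w: "\<omega> \<in> space P" for \<omega>
    proof (rule LIM_zero_cancel, rule Lim_null_comparison[OF _ lim[OF w]])
      show "\<forall>\<^sub>F k in sequentially. norm (\<rho> (Y k \<omega>) - \<rho> (Z \<omega>)) \<le> skorohod_dist (Y k \<omega>) (Z \<omega>)"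
        using lip Y[OF w] Z[OF w] by (auto simp: skorohod_lipschitz_def)
    qed
    moreover have "(\<lambda>\<omega>. \<rho> (Y k \<omega>)) \<in> borel_measurable P" for k
      by (rule measurable_compose[OF meas])
         (intro continuous_map_borel_measurable skorohod_lipschitz_continuous_map[OF lip], simp)
    ultimately have [measurable]: "(\<lambda>\<omega>. \<rho> (Z \<omega>)) \<in> borel_measurable P"
      by (rule borel_measurable_LIMSEQ_real)
    have "Z -` U \<inter> space P = {\<omega> \<in> space P. 0 < \<rho> (Z \<omega>)}" using U_iff Z by auto
    then show ?thesis by simp
  qed
qed (simp add: Z)

text \<open>Through a variable with values in a countable discrete space every preimage is
  measurable, so nothing has to be known about the Borel sets of the target.\<close>

lemma measurable_countable_range:
  assumes Z: "\<And>\<omega>. \<omega> \<in> space P \<Longrightarrow> Z (g \<omega>) \<in> topspace T"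
    and g: "g \<in> measurable P (count_space (UNIV :: 'c::countable set))"
  shows "(\<lambda>\<omega>. Z (g \<omega>)) \<in> measurable P (borel_sigma T)"
proof (rule measurable_borel_sigmaI)
  fix U
  have "(\<lambda>\<omega>. Z (g \<omega>)) -` U \<inter> space P = g -` {c. Z c \<in> U} \<inter> space P" by auto
  also have "\<dots> \<in> sets P" by (rule measurable_sets[OF g]) simp
  finally show "(\<lambda>\<omega>. Z (g \<omega>)) -` U \<inter> space P \<in> sets P" .
qed (simp add: Z)


text \<open>The Pasch-Hausdorff envelope: the largest \<open>L\<close>-Lipschitz function below a
  bounded \<open>h\<close>. For continuous \<open>h\<close> it tends to \<open>h\<close> pointwise
  as \<open>L\<close> grows, so that dominated convergence applies.\<close>

definition lipschitz_minorant :: "((real^'m::finite \<Rightarrow> real) \<Rightarrow> real) \<Rightarrow> real \<Rightarrow> (real^'m \<Rightarrow> real) \<Rightarrow> real" where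
  "lipschitz_minorant h L f = (INF g\<in>skorohod_space. h g + L * skorohod_dist f g)"

context
  fixes h :: "(real^'m::finite \<Rightarrow> real) \<Rightarrow> real" and b :: real
  assumes b: "\<And>f. f \<in> skorohod_space \<Longrightarrow> \<bar>h f\<bar> \<le> b"
begin

lemma lipschitz_minorant_bdd: "L \<ge> 0 \<Longrightarrow> bdd_below ((\<lambda>g. h g + L * skorohod_dist f g) ` skorohod_space)"
proof (rule bdd_belowI2[where m = "-b"])
  fix g :: "real^'m \<Rightarrow> real" assume "L \<ge> 0" "g \<in> skorohod_space"
  then show "- b \<le> h g + L * skorohod_dist f g"
    using b[of g] mult_nonneg_nonneg[of L "skorohod_dist f g"] skorohod_dist_nonneg[of f g] by linarith
qed

lemma lipschitz_minorant_le:
  assumes "L \<ge> 0" "f \<in> skorohod_space"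
  shows "lipschitz_minorant h L f \<le> h f"
  using cINF_lower[OF lipschitz_minorant_bdd[OF assms(1)] assms(2), of f] assms
  by (simp add: lipschitz_minorant_def)

lemma lipschitz_minorant_ge:
  assumes "L \<ge> 0" "f \<in> skorohod_space"
  shows "- b \<le> lipschitz_minorant h L f"
  unfolding lipschitz_minorant_def
proof (rule cINF_greatest)
  fix g :: "real^'m \<Rightarrow> real" assume "g \<in> skorohod_space"
  then show "- b \<le> h g + L * skorohod_dist f g"
    using b[of g] mult_nonneg_nonneg[OF assms(1), of "skorohod_dist f g"] skorohod_dist_nonneg[of f g] by linarith
qed (use assms in auto)

lemma lipschitz_minorant_lipschitz:
  assumes "L \<ge> 0"
  shows "skorohod_lipschitz (lipschitz_minorant h L) L"
proof -
  have "lipschitz_minorant h L f \<le> lipschitz_minorant h L f' + L * skorohod_dist f f'"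
    if "f \<in> skorohod_space" "f' \<in> skorohod_space" for f f'
  proof -
    have "lipschitz_minorant h L f - L * skorohod_dist f f' \<le> lipschitz_minorant h L f'"
      unfolding lipschitz_minorant_def[of h L f']
    proof (rule cINF_greatest)
      fix g :: "real^'m \<Rightarrow> real" assume g: "g \<in> skorohod_space"
      have "lipschitz_minorant h L f \<le> h g + L * skorohod_dist f g"
        unfolding lipschitz_minorant_def by (rule cINF_lower[OF lipschitz_minorant_bdd[OF assms] g])
      also have "\<dots> \<le> h g + L * (skorohod_dist f f' + skorohod_dist f' g)"
        using that g assms by (intro add_left_mono mult_left_mono skorohod.triangle) auto
      finally show "lipschitz_minorant h L f - L * skorohod_dist f f' \<le> h g + L * skorohod_dist f' g"
        by (simp add: algebra_simps)
    qed (use that in auto)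
    then show ?thesis by simp
  qed
  then show ?thesis
    unfolding skorohod_lipschitz_def by (smt (verit) skorohod.commute)
qed

lemma lipschitz_minorant_tendsto:
  assumes cont: "continuous_map skorohod_topology euclideanreal h" and f: "f \<in> skorohod_space"
  shows "(\<lambda>n. lipschitz_minorant h (real n) f) \<longlonglongrightarrow> h f"
proof (rule LIMSEQ_I)
  fix e :: real assume e: "e > 0"
  obtain d where d: "d > 0" "\<And>g. g \<in> skorohod_space \<Longrightarrow> skorohod_dist f g < d \<Longrightarrow> \<bar>h f - h g\<bar> < e / 2"
    using cont f half_gt_zero[OF e]
    unfolding skorohod_topology_eq skorohod.metric_continuous_map[OF Met_TC.Metric_space_axioms, of h, unfolded mtopology_is_euclidean] dist_real_def
    by meson
  \<comment> \<open>Beyond distance \<open>d\<close> the penalty \<open>n * d\<close> then exceeds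
    \<open>2 * b\<close>, the largest possible drop of \<open>h\<close>; within distance
    \<open>d\<close> continuity alone suffices.\<close>
  obtain n0 :: nat where n0: "n0 \<ge> 2 * b / d" using real_arch_simple by blast
  show "\<exists>n0. \<forall>n\<ge>n0. norm (lipschitz_minorant h (real n) f - h f) < e"
  proof (intro exI allI impI)
    fix n assume n: "n \<ge> n0"
    have "h f - e / 2 \<le> lipschitz_minorant h (real n) f"
      unfolding lipschitz_minorant_def
    proof (rule cINF_greatest)
      fix g :: "real^'m \<Rightarrow> real" assume g: "g \<in> skorohod_space"
      show "h f - e / 2 \<le> h g + real n * skorohod_dist f g"
      proof (cases "skorohod_dist f g < d")
        case True
        have "0 \<le> real n * skorohod_dist f g" by (simp add: skorohod_dist_nonneg)
        then show ?thesis using d(2)[OF g True] by linarith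
      next
        case False
        have "2 * b / d * d \<le> real n * skorohod_dist f g"
          using n n0 False d by (intro mult_mono) auto
        then have "2 * b \<le> real n * skorohod_dist f g" using d by simp
        then show ?thesis using b[OF f] b[OF g] e by linarith
      qed
    qed (use f in auto)
    then show "norm (lipschitz_minorant h (real n) f - h f) < e"
      using lipschitz_minorant_le[of "real n" f] f e by auto
  qed
qed

end

text \<open>One half of the portmanteau argument. A minorant lies below \<open>h\<close>, so
  convergence of its integrals bounds the integrals of \<open>h\<close> from below asymptotically,
  and a large Lipschitz constant makes the loss under the limit law less than
  \<open>e\<close>.\<close>

lemma integral_liminf_from_lipschitz:
  fixes Z :: "nat \<Rightarrow> 'w \<Rightarrow> real^'m::finite \<Rightarrow> real" and Y :: "'v \<Rightarrow> real^'m \<Rightarrow> real"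
  assumes P: "prob_space P" and N: "prob_space N"
    and Z: "\<And>n. Z n \<in> measurable P (borel_sigma skorohod_topology)"
    and Y: "Y \<in> measurable N (borel_sigma skorohod_topology)"
    and lip: "\<And>h L. L > 0 \<Longrightarrow> skorohod_lipschitz h L \<Longrightarrow> bounded (h ` skorohod_space) \<Longrightarrow>
        (\<lambda>n. \<integral>\<omega>. h (Z n \<omega>) \<partial>P) \<longlonglongrightarrow> (\<integral>\<omega>. h (Y \<omega>) \<partial>N)"
    and cont: "continuous_map skorohod_topology euclideanreal h" and bdd: "bounded (h ` skorohod_space)"
    and e: "e > 0"
  shows "\<forall>\<^sub>F n in sequentially. (\<integral>\<omega>. h (Y \<omega>) \<partial>N) - e < (\<integral>\<omega>. h (Z n \<omega>) \<partial>P)"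
proof -
  interpret P: prob_space P by fact
  interpret N: prob_space N by fact
  obtain b where b: "\<And>f. f \<in> skorohod_space \<Longrightarrow> \<bar>h f\<bar> \<le> b"
    using bdd by (auto simp: bounded_iff)
  let ?g = "\<lambda>k. lipschitz_minorant h (real (Suc k))"
  have gb: "\<bar>?g k f\<bar> \<le> b" if "f \<in> skorohod_space" for k f
    using lipschitz_minorant_le[of h b "real (Suc k)" f] lipschitz_minorant_ge[of h b "real (Suc k)" f] b that
    by (fastforce simp: abs_le_iff)
  have glip: "skorohod_lipschitz (?g k) (real (Suc k))" for k
    by (rule lipschitz_minorant_lipschitz[OF b]) auto
  have meas: "(\<lambda>\<omega>. u (V \<omega>)) \<in> borel_measurable Q"
    if "V \<in> measurable Q (borel_sigma skorohod_topology)" "continuous_map skorohod_topology euclideanreal u" for u V and Q :: "'z measure"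
    by (rule measurable_compose[OF that(1)]) (rule continuous_map_borel_measurable[OF that(2)])
  have gcont: "continuous_map skorohod_topology euclideanreal (?g k)" for k
    by (rule skorohod_lipschitz_continuous_map[OF glip]) simp
  have Ysp: "Y \<omega> \<in> skorohod_space" if "\<omega> \<in> space N" for \<omega> using measurable_space[OF Y that] by simp
  have Zsp: "Z n \<omega> \<in> skorohod_space" if "\<omega> \<in> space P" for n \<omega> using measurable_space[OF Z that] by simp
  have "(\<lambda>k. \<integral>\<omega>. ?g k (Y \<omega>) \<partial>N) \<longlonglongrightarrow> (\<integral>\<omega>. h (Y \<omega>) \<partial>N)"
  proof (rule integral_dominated_convergence[where w = "\<lambda>_. b"])
    show "AE \<omega> in N. (\<lambda>k. ?g k (Y \<omega>)) \<longlonglongrightarrow> h (Y \<omega>)"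
    proof (rule AE_I2)
      fix \<omega> assume w: "\<omega> \<in> space N"
      show "(\<lambda>k. ?g k (Y \<omega>)) \<longlonglongrightarrow> h (Y \<omega>)"
        by (rule LIMSEQ_Suc[OF lipschitz_minorant_tendsto[OF b cont Ysp[OF w]]])
    qed
    show "AE \<omega> in N. norm (?g k (Y \<omega>)) \<le> b" for k using gb Ysp by (auto intro!: AE_I2)
  qed (intro meas[OF Y] gcont cont P.integrable_const N.integrable_const)+
  then have "\<forall>\<^sub>F k in sequentially. (\<integral>\<omega>. h (Y \<omega>) \<partial>N) - e < (\<integral>\<omega>. ?g k (Y \<omega>) \<partial>N)"
    using e by (intro order_tendstoD) auto
  then obtain k where k: "(\<integral>\<omega>. h (Y \<omega>) \<partial>N) - e < (\<integral>\<omega>. ?g k (Y \<omega>) \<partial>N)"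
    by (auto simp: eventually_sequentially)
  have "bounded (?g k ` skorohod_space)"
    using gb by (auto simp: bounded_iff)
  from lip[OF _ glip this] have "(\<lambda>n. \<integral>\<omega>. ?g k (Z n \<omega>) \<partial>P) \<longlonglongrightarrow> (\<integral>\<omega>. ?g k (Y \<omega>) \<partial>N)"
    by simp
  from order_tendstoD(1)[OF this k]
  show ?thesis
  proof eventually_elim
    case (elim n)
    have "(\<integral>\<omega>. ?g k (Z n \<omega>) \<partial>P) \<le> (\<integral>\<omega>. h (Z n \<omega>) \<partial>P)"
    proof (rule integral_mono)
      show "integrable P (\<lambda>\<omega>. ?g k (Z n \<omega>))"
      proof (rule P.integrable_const_bound[where B = b])
        show "AE \<omega> in P. norm (?g k (Z n \<omega>)) \<le> b" using gb Zsp by auto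
      qed (rule meas[OF Z gcont])
      show "integrable P (\<lambda>\<omega>. h (Z n \<omega>))"
      proof (rule P.integrable_const_bound[where B = b])
        show "AE \<omega> in P. norm (h (Z n \<omega>)) \<le> b" using b Zsp by auto
      qed (rule meas[OF Z cont])
      show "?g k (Z n \<omega>) \<le> h (Z n \<omega>)" if "\<omega> \<in> space P" for \<omega>
        by (rule lipschitz_minorant_le[OF b _ Zsp[OF that]]) auto
    qed
    then show ?case using elim by linarith
  qed
qed

lemma converges_in_distribution_skorohodI:
  fixes Z :: "nat \<Rightarrow> 'w \<Rightarrow> real^'m::finite \<Rightarrow> real" and Y :: "'v \<Rightarrow> real^'m \<Rightarrow> real"
  assumes P: "prob_space P" and N: "prob_space N"
    and Z: "\<And>n. Z n \<in> measurable P (borel_sigma skorohod_topology)"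
    and Y: "Y \<in> measurable N (borel_sigma skorohod_topology)"
    and lip: "\<And>h L. L > 0 \<Longrightarrow> skorohod_lipschitz h L \<Longrightarrow> bounded (h ` skorohod_space) \<Longrightarrow>
        (\<lambda>n. \<integral>\<omega>. h (Z n \<omega>) \<partial>P) \<longlonglongrightarrow> (\<integral>\<omega>. h (Y \<omega>) \<partial>N)"
  shows "converges_in_distribution skorohod_topology P Z N Y"
  unfolding converges_in_distribution_def
proof (intro conjI allI impI)
  fix h :: "(real^'m \<Rightarrow> real) \<Rightarrow> real"
  assume h: "continuous_map skorohod_topology euclideanreal h \<and> bounded (h ` topspace skorohod_topology)"
  then have h1: "continuous_map skorohod_topology euclideanreal h" "bounded (h ` skorohod_space)" by auto
  \<comment> \<open>The lower bound for \<open>-h\<close> is the missing upper bound for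
    \<open>h\<close>.\<close>
  have h2: "continuous_map skorohod_topology euclideanreal (\<lambda>f. - h f)" "bounded ((\<lambda>f. - h f) ` skorohod_space)"
    using h1 by (auto intro: continuous_map_minus simp: bounded_iff)
  note lim = integral_liminf_from_lipschitz[OF P N Z Y lip]
  show "(\<lambda>n. \<integral>\<omega>. h (Z n \<omega>) \<partial>P) \<longlonglongrightarrow> (\<integral>\<omega>. h (Y \<omega>) \<partial>N)"
  proof (rule tendstoI)
    fix e :: real assume e: "e > 0"
    have "\<forall>\<^sub>F n in sequentially. (\<integral>\<omega>. h (Y \<omega>) \<partial>N) - e < (\<integral>\<omega>. h (Z n \<omega>) \<partial>P)"
      by (rule lim[OF _ _ _ h1 e])
    moreover have "\<forall>\<^sub>F n in sequentially. (\<integral>\<omega>. - h (Y \<omega>) \<partial>N) - e < (\<integral>\<omega>. - h (Z n \<omega>) \<partial>P)"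
      by (rule lim[OF _ _ _ h2 e])
    ultimately show "\<forall>\<^sub>F n in sequentially. dist (\<integral>\<omega>. h (Z n \<omega>) \<partial>P) (\<integral>\<omega>. h (Y \<omega>) \<partial>N) < e"
      by eventually_elim (auto simp: dist_real_def)
  qed
qed (use Z Y in auto)

section \<open>Measurability of the empirical process\<close>

lemma time_changeI:
  assumes mono: "strict_mono_on {0..1} l" and cont: "continuous_on {0..1} l" and "l 0 = 0" "l 1 = (1::real)"
  shows "time_change l"
proof -
  have "l ` {0..1} = {0..1}"
  proof
    show "l ` {0..1} \<subseteq> {0..1}"
      using strict_mono_on_leD[OF mono, of 0] strict_mono_on_leD[OF mono, of _ 1] assms(3,4) by force
    show "{0..1} \<subseteq> l ` {0..1}"
      using IVT'[of l 0 _ 1] cont assms(3,4) by (fastforce simp: image_iff)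
  qed
  then show ?thesis
    using homeomorphism_compact[OF _ cont _ strict_mono_on_imp_inj_on[OF mono]] mono
    by (auto simp: time_change_def)
qed

definition tent :: "real \<Rightarrow> real \<Rightarrow> real \<Rightarrow> real" where
  "tent \<eta> a t = max 0 (1 - \<bar>t - a\<bar> / \<eta>)"

lemma tent_lipschitz:
  assumes "\<eta> > 0"
  shows "\<bar>tent \<eta> a t - tent \<eta> a s\<bar> \<le> \<bar>t - s\<bar> / \<eta>"
proof -
  have "\<bar>max 0 (1 - u) - max 0 (1 - v)\<bar> \<le> \<bar>u - v\<bar>" for u v :: real
    by (auto simp: max_def abs_if)
  then have "\<bar>tent \<eta> a t - tent \<eta> a s\<bar> \<le> \<bar>\<bar>t - a\<bar> / \<eta> - \<bar>s - a\<bar> / \<eta>\<bar>"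
    unfolding tent_def .
  also have "\<dots> = \<bar>\<bar>t - a\<bar> - \<bar>s - a\<bar>\<bar> / \<eta>"
    using assms by (simp add: diff_divide_distrib[symmetric])
  also have "\<dots> \<le> \<bar>t - s\<bar> / \<eta>" using assms by (intro divide_right_mono) auto
  finally show ?thesis .
qed

lemma tent_bounds: "\<eta> > 0 \<Longrightarrow> \<bar>tent \<eta> a t\<bar> \<le> 1"
  unfolding tent_def by (auto simp: abs_if max_def)

lemma tent_zero: "\<eta> > 0 \<Longrightarrow> \<eta> \<le> \<bar>t - a\<bar> \<Longrightarrow> tent \<eta> a t = 0"
  unfolding tent_def by (auto simp: field_simps)

text \<open>The time change is the identity plus a tent of half width \<open>\<eta>\<close> over
  each point \<open>a\<close>, of height \<open>g a - a\<close>. As \<open>\<eta>\<close> is at most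
  every distance between two points and from a point to 0 or 1, each tent vanishes at the other
  points and at the ends. The perturbation has Lipschitz constant below 1, so the sum is strictly
  increasing.\<close>

lemma time_change_move_points:
  assumes A: "finite A" "A \<subseteq> {0<..<1::real}"
  shows "\<exists>\<delta>0>0. \<forall>\<delta> g. 0 \<le> \<delta> \<and> \<delta> < \<delta>0 \<and> (\<forall>a\<in>A. \<bar>g a - a\<bar> \<le> \<delta>) \<longrightarrow>
    (\<exists>l. time_change l \<and> (\<forall>a\<in>A. l a = g a) \<and> (\<forall>t\<in>{0..1}. \<bar>l t - t\<bar> \<le> real (card A) * \<delta>))"
proof -
  define D where "D = (\<lambda>(a, b). \<bar>a - b\<bar>) ` {(a, b). a \<in> insert 0 (insert 1 A) \<and> b \<in> A \<and> a \<noteq> b}"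
  have "finite {(a, b). a \<in> insert 0 (insert 1 A) \<and> b \<in> A \<and> a \<noteq> b}"
    by (rule finite_subset[of _ "insert 0 (insert 1 A) \<times> A"]) (use A in auto)
  then have finD: "finite D" unfolding D_def by simp
  define \<eta> where "\<eta> = Min (insert 1 D)"
  have \<eta>: "\<eta> > 0" unfolding \<eta>_def using finD by (subst Min_gr_iff) (auto simp: D_def)
  have \<eta>D: "\<eta> \<le> \<bar>a - b\<bar>" if "a \<in> insert 0 (insert 1 A)" "b \<in> A" "a \<noteq> b" for a b
    unfolding \<eta>_def using finD that by (intro Min_le) (auto simp: D_def image_iff)
  \<comment> \<open>For \<open>\<delta> < \<delta>0\<close> the Lipschitz constant
    \<open>card A * \<delta> / \<eta>\<close> is below 1; the added 1 keeps the denominator positive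
    for empty \<open>A\<close>.\<close>
  define \<delta>0 where "\<delta>0 = \<eta> / (real (card A) + 1)"
  have \<delta>0: "\<delta>0 > 0" using \<eta> by (simp add: \<delta>0_def)
  show ?thesis
  proof (intro exI[of _ \<delta>0] conjI allI impI \<delta>0)
    fix \<delta> g assume *: "0 \<le> \<delta> \<and> \<delta> < \<delta>0 \<and> (\<forall>a\<in>A. \<bar>g a - a\<bar> \<le> \<delta>)"
    define u where "u t = (\<Sum>a\<in>A. (g a - a) * tent \<eta> a t)" for t
    define l where "l t = t + u t" for t
    have u_zero: "u t = 0" if "\<And>a. a \<in> A \<Longrightarrow> \<eta> \<le> \<bar>t - a\<bar>" for t
      unfolding u_def using that tent_zero[OF \<eta>] by (intro sum.neutral) auto
    have u0: "u 0 = 0" by (rule u_zero) (use \<eta>D[of 0] A(2) in fastforce)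
    have u1: "u 1 = 0" by (rule u_zero) (use \<eta>D[of 1] A(2) in fastforce)
    have lip: "\<bar>u t - u s\<bar> \<le> real (card A) * \<delta> / \<eta> * \<bar>t - s\<bar>" for t s
    proof -
      have "\<bar>u t - u s\<bar> = \<bar>\<Sum>a\<in>A. (g a - a) * (tent \<eta> a t - tent \<eta> a s)\<bar>"
        by (simp add: u_def sum_subtractf right_diff_distrib)
      also have "\<dots> \<le> (\<Sum>a\<in>A. \<bar>(g a - a) * (tent \<eta> a t - tent \<eta> a s)\<bar>)" by (rule sum_abs)
      also have "\<dots> \<le> (\<Sum>a\<in>A. \<delta> * (\<bar>t - s\<bar> / \<eta>))"
        unfolding abs_mult using * tent_lipschitz[OF \<eta>] by (intro sum_mono mult_mono) auto
      finally show ?thesis by simp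
    qed
    define q where "q = real (card A) * \<delta> / \<eta>"
    have "real (card A) * \<delta> \<le> (real (card A) + 1) * \<delta>" using * by (simp add: algebra_simps)
    also have "\<dots> < (real (card A) + 1) * \<delta>0" using * by (intro mult_strict_left_mono) auto
    also have "\<dots> = \<eta>" by (simp add: \<delta>0_def)
    finally have q1: "q < 1" using \<eta> by (simp add: q_def)
    have "q \<ge> 0" using * \<eta> by (simp add: q_def)
    have "strict_mono_on {0..1} l"
    proof (rule strict_mono_onI)
      fix r s :: real assume "r < s"
      have "\<bar>u s - u r\<bar> \<le> q * \<bar>s - r\<bar>" using lip by (simp add: q_def)
      also have "\<dots> < 1 * \<bar>s - r\<bar>" using q1 \<open>r < s\<close> by (intro mult_strict_right_mono) auto
      finally show "l r < l s" using \<open>r < s\<close> by (simp add: l_def)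
    qed
    moreover have "continuous_on {0..1} l"
      unfolding l_def u_def tent_def using \<eta> by (intro continuous_intros) auto
    ultimately have "time_change l"
      by (rule time_changeI) (simp_all add: l_def u0 u1)
    moreover have "l a = g a" if "a \<in> A" for a
    proof -
      have "u a = (\<Sum>b\<in>{a}. (g b - b) * tent \<eta> b a)"
        unfolding u_def using that A \<eta>D[of a] tent_zero[OF \<eta>] by (intro sum.mono_neutral_right) auto
      then show ?thesis by (simp add: l_def tent_def)
    qed
    moreover have "\<bar>l t - t\<bar> \<le> real (card A) * \<delta>" for t
    proof -
      have "\<bar>u t\<bar> \<le> (\<Sum>a\<in>A. \<bar>(g a - a) * tent \<eta> a t\<bar>)" unfolding u_def by (rule sum_abs)
      also have "\<dots> \<le> (\<Sum>a\<in>A. \<delta> * 1)"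
        unfolding abs_mult using * tent_bounds[OF \<eta>] by (intro sum_mono mult_mono) auto
      finally show ?thesis by (simp add: l_def)
    qed
    ultimately show "\<exists>l. time_change l \<and> (\<forall>a\<in>A. l a = g a) \<and> (\<forall>t\<in>{0..1}. \<bar>l t - t\<bar> \<le> real (card A) * \<delta>)"
      by blast
  qed
qed

lemma emp_process_in_skorohod_space:
  fixes X :: "nat \<Rightarrow> 'w \<Rightarrow> real^'m::finite"
  shows "emp_process X V n \<omega> \<in> skorohod_space"
  unfolding emp_process_def
proof (rule restrict_in_skorohod_space)
  have *: "cadlag (\<lambda>x. emp_cdf X n \<omega> x)" "\<And>j. cadlag (\<lambda>x :: real^'m. marg_emp_cdf X j n \<omega> (x $ j))"
    unfolding emp_cdf_def marg_emp_cdf_def divide_inverse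
    by (intro cadlag_mult cadlag_sum cadlag_prod cadlag_ge_indicator cadlag_const)+
  show "cadlag (\<lambda>x. sqrt (real n) * (emp_cdf X n \<omega> x - (\<Prod>i\<in>V. x $ i) * (\<Prod>j\<in>UNIV - V. marg_emp_cdf X j n \<omega> (x $ j))))"
    by (intro cadlag_mult cadlag_diff cadlag_const cadlag_prod *)
       (auto intro!: cadlag_continuous continuous_intros)
qed

section \<open>Rounding the sample up to a dyadic grid\<close>

definition dyadic_ceil :: "nat \<Rightarrow> real \<Rightarrow> real" where
  "dyadic_ceil k t = of_int \<lceil>2 ^ k * t\<rceil> / 2 ^ k"

lemma dyadic_ceil_bounds: "t \<le> dyadic_ceil k t" "dyadic_ceil k t \<le> t + 1 / 2 ^ k"
  using of_int_ceiling_le_add_one[of "2 ^ k * t"] le_of_int_ceiling[of "2 ^ k * t"]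
  by (auto simp: dyadic_ceil_def field_simps)

lemma dyadic_ceil_dist: "\<bar>dyadic_ceil k t - t\<bar> \<le> 1 / 2 ^ k"
  using dyadic_ceil_bounds(1)[where t = t and k = k] dyadic_ceil_bounds(2)[where t = t and k = k] by linarith

text \<open>An integer lies on every dyadic grid, so rounding up cannot carry a value across it.
  Comparisons with the end points 0 and 1 are therefore preserved.\<close>

lemma dyadic_ceil_le_iff_int:
  assumes "c \<in> \<int>" shows "dyadic_ceil k t \<le> c \<longleftrightarrow> t \<le> c"
proof -
  obtain z :: int where "c = of_int z" using assms by (auto elim: Ints_cases)
  have "dyadic_ceil k t \<le> c \<longleftrightarrow> of_int \<lceil>2 ^ k * t\<rceil> \<le> (of_int (2 ^ k * z) :: real)"
    by (simp add: dyadic_ceil_def \<open>c = _\<close> field_simps)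
  also have "\<dots> \<longleftrightarrow> 2 ^ k * t \<le> of_int (2 ^ k * z)" by (simp only: of_int_le_iff ceiling_le_iff)
  finally show ?thesis by (simp add: \<open>c = _\<close>)
qed

lemma marg_emp_cdf_bounds: "0 \<le> marg_emp_cdf X j n \<omega> t" "marg_emp_cdf X j n \<omega> t \<le> 1"
proof -
  have "(\<Sum>i=1..n. of_bool (X i \<omega> $ j \<le> t)) \<le> (\<Sum>i=1..n. 1::real)" by (intro sum_mono) auto
  then show "marg_emp_cdf X j n \<omega> t \<le> 1" by (simp add: marg_emp_cdf_def divide_simps)
qed (auto simp: marg_emp_cdf_def intro!: divide_nonneg_nonneg sum_nonneg)

text \<open>A time change that carries every interior sample coordinate to its rounded value makes
  all indicators of the two processes agree exactly. Only the deterministic factor over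
  \<open>V\<close> then differs, by the displacement of the argument, and this is multiplied by
  \<open>sqrt n\<close>.\<close>

lemma emp_process_dyadic_ceil_tendsto:
  fixes X :: "nat \<Rightarrow> 'w \<Rightarrow> real^'m::finite"
  shows "(\<lambda>k. skorohod_dist (emp_process (\<lambda>i \<omega>. \<chi> j. dyadic_ceil k (X i \<omega> $ j)) V n \<omega>) (emp_process X V n \<omega>)) \<longlonglongrightarrow> 0"
proof -
  define A where "A j = {0<..<1} \<inter> (\<lambda>i. X i \<omega> $ j) ` {1..n}" for j
  have A: "finite (A j)" "A j \<subseteq> {0<..<1}" for j by (auto simp: A_def)
  have cardA: "card (A j) \<le> n" for j
    using card_mono[of "(\<lambda>i. X i \<omega> $ j) ` {1..n}" "A j"] card_image_le[of "{1..n}" "\<lambda>i. X i \<omega> $ j"]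
    by (auto simp: A_def)
  obtain \<delta>0 where \<delta>0: "\<And>j. \<delta>0 j > 0"
    "\<And>j \<delta> g. 0 \<le> \<delta> \<Longrightarrow> \<delta> < \<delta>0 j \<Longrightarrow> (\<And>a. a \<in> A j \<Longrightarrow> \<bar>g a - a\<bar> \<le> \<delta>) \<Longrightarrow>
       \<exists>l. time_change l \<and> (\<forall>a\<in>A j. l a = g a) \<and> (\<forall>t\<in>{0..1}. \<bar>l t - t\<bar> \<le> real (card (A j)) * \<delta>)"
    using time_change_move_points[OF A] by metis
  \<comment> \<open>Dominates both the bound for the values, with its factor \<open>sqrt n\<close>,
    and the bound for the displacement, without it.\<close>
  define c where "c = (1 + sqrt (real n)) * (real CARD('m) * real n)"
  have c0: "c \<ge> 0" by (simp add: c_def)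
  define Z where "Z k = emp_process (\<lambda>i \<omega>. \<chi> j. dyadic_ceil k (X i \<omega> $ j)) V n \<omega>" for k
  have "\<forall>\<^sub>F k in sequentially. \<forall>j\<in>UNIV. 1 / 2 ^ k < \<delta>0 j"
  proof (intro eventually_ball_finite ballI)
    fix j
    have "(\<lambda>k. (1/2) ^ k :: real) \<longlonglongrightarrow> 0" by (rule LIMSEQ_realpow_zero) auto
    from order_tendstoD(2)[OF this \<delta>0(1)[of j]]
    show "\<forall>\<^sub>F k in sequentially. 1 / 2 ^ k < \<delta>0 j" by (simp add: power_divide)
  qed auto
  then have "\<forall>\<^sub>F k in sequentially. skorohod_dist (emp_process X V n \<omega>) (Z k) \<le> c / 2 ^ k"
  proof eventually_elim
    case (elim k)
    have "\<exists>l. time_change l \<and> (\<forall>a\<in>A j. l a = dyadic_ceil k a) \<and> (\<forall>t\<in>{0..1}. \<bar>l t - t\<bar> \<le> real (card (A j)) * (1 / 2 ^ k))" for j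
      by (rule \<delta>0(2)) (use elim dyadic_ceil_dist in auto)
    then obtain l where l: "\<And>j. time_change (l j)" "\<And>j a. a \<in> A j \<Longrightarrow> l j a = dyadic_ceil k a"
      "\<And>j t. t \<in> {0..1} \<Longrightarrow> \<bar>l j t - t\<bar> \<le> real (card (A j)) * (1 / 2 ^ k)"
      by metis
    have l': "\<bar>l j t - t\<bar> \<le> real n / 2 ^ k" if "t \<in> {0..1}" for j t
    proof -
      have "real (card (A j)) * (1 / 2 ^ k) \<le> real n * (1 / 2 ^ k)" using cardA by (intro mult_right_mono) auto
      then show ?thesis using l(3)[OF that, of j] by simp
    qed
    have iff: "dyadic_ceil k (X i \<omega> $ j) \<le> l j t \<longleftrightarrow> X i \<omega> $ j \<le> t" if t: "t \<in> {0..1}" and i: "i \<in> {1..n}" for i j t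
    proof -
      let ?a = "X i \<omega> $ j"
      have lt: "l j t \<in> {0..1}" by (rule time_change_in[OF l(1) t])
      have "?a \<in> A j" if "0 < ?a" "?a < 1" using i that by (auto simp: A_def)
      \<comment> \<open>A time change fixes 0 and 1 and so cannot move values outside the open
        interval. Such values compare with \<open>t\<close> and with \<open>l j t\<close> alike,
        because rounding up does not carry them across 0 or 1.\<close>
      then consider "?a \<le> 0" | "?a \<in> A j" | "?a \<ge> 1" by linarith
      then show ?thesis
      proof cases
        case 1
        then have "dyadic_ceil k ?a \<le> 0" by (simp add: dyadic_ceil_le_iff_int)
        then show ?thesis using 1 t lt by auto
      next
        case 2
        then have "?a \<in> {0..1}" by (auto simp: A_def)
        from time_change_le_iff[OF l(1)[of j] this t] show ?thesis using l(2)[OF 2] by simp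
      next
        case 3
        show ?thesis
        proof (cases "t = 1")
          case True
          then show ?thesis using time_change_1[OF l(1)] by (simp add: dyadic_ceil_le_iff_int)
        next
          case False
          have "l j 1 \<le> l j t \<longleftrightarrow> 1 \<le> t" by (rule time_change_le_iff[OF l(1) _ t]) simp
          then have "l j t < 1" using False t time_change_1[OF l(1)[of j]] by auto
          then show ?thesis using 3 False t dyadic_ceil_bounds(1)[of ?a k] by auto
        qed
      qed
    qed
    have bound: "\<bar>emp_process X V n \<omega> x - Z k (apply_time_changes l x)\<bar> \<le> sqrt (real n) * (real CARD('m) * real n) / 2 ^ k"
      if x: "x \<in> cbox 0 1" for x
    proof -
      let ?y = "apply_time_changes l x"
      have y: "?y \<in> cbox 0 1" using apply_time_changes_cube[of l x] l(1) x by blast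
      have xj: "x $ j \<in> {0..1}" "?y $ j \<in> {0..1}" for j
        using x y by (auto simp: mem_box_cart simp del: apply_time_changes_nth)
      have 1: "emp_cdf (\<lambda>i \<omega>. \<chi> j. dyadic_ceil k (X i \<omega> $ j)) n \<omega> ?y = emp_cdf X n \<omega> x"
        unfolding emp_cdf_def using iff[OF xj(1)] by (auto intro!: sum.cong prod.cong arg_cong2[where f = "(/)"])
      have 2: "marg_emp_cdf (\<lambda>i \<omega>. \<chi> j. dyadic_ceil k (X i \<omega> $ j)) j n \<omega> (?y $ j) = marg_emp_cdf X j n \<omega> (x $ j)" for j
        unfolding marg_emp_cdf_def using iff[OF xj(1)] by (auto intro!: sum.cong arg_cong2[where f = "(/)"])
      let ?F = "\<Prod>j\<in>UNIV - V. marg_emp_cdf X j n \<omega> (x $ j)"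
      have F: "\<bar>?F\<bar> \<le> 1" unfolding abs_prod
        by (intro prod_le_1) (auto simp: marg_emp_cdf_bounds)
      have "emp_process X V n \<omega> x - Z k ?y = sqrt (real n) * (((\<Prod>i\<in>V. ?y $ i) - (\<Prod>i\<in>V. x $ i)) * ?F)"
        unfolding Z_def emp_process_def using x y 1 2 by (simp add: algebra_simps)
      also have "\<bar>\<dots>\<bar> \<le> sqrt (real n) * ((\<Sum>i\<in>V. \<bar>?y $ i - x $ i\<bar>) * 1)"
        unfolding abs_mult
      proof (intro mult_mono F)
        show "\<bar>(\<Prod>i\<in>V. ?y $ i) - (\<Prod>i\<in>V. x $ i)\<bar> \<le> (\<Sum>i\<in>V. \<bar>?y $ i - x $ i\<bar>)"
          using norm_prod_diff[of V "\<lambda>i. ?y $ i" "\<lambda>i. x $ i"] xj by (auto simp del: apply_time_changes_nth)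
      qed (auto intro: sum_nonneg)
      also have "(\<Sum>i\<in>V. \<bar>?y $ i - x $ i\<bar>) \<le> (\<Sum>i\<in>V. real n / 2 ^ k)"
        using l'[OF xj(1)] by (intro sum_mono) auto
      also have "\<dots> \<le> real CARD('m) * (real n / 2 ^ k)"
        by (auto intro!: mult_right_mono divide_right_mono card_mono)
      finally show ?thesis by (simp add: mult_left_mono)
    qed
    have bound2: "norm (apply_time_changes l x - x) \<le> real CARD('m) * real n / 2 ^ k" if x: "x \<in> cbox 0 1" for x
    proof -
      have xj: "x $ j \<in> {0..1}" for j using x by (auto simp: mem_box_cart)
      have "norm (apply_time_changes l x - x) \<le> (\<Sum>j\<in>UNIV. \<bar>(apply_time_changes l x - x) $ j\<bar>)"
        by (rule norm_le_l1_cart)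
      also have "\<dots> \<le> (\<Sum>j\<in>(UNIV :: 'm set). real n / 2 ^ k)"
        using l'[OF xj] by (intro sum_mono) auto
      finally show ?thesis by simp
    qed
    show "skorohod_dist (emp_process X V n \<omega>) (Z k) \<le> c / 2 ^ k"
    proof (rule field_le_epsilon)
      fix d :: real assume "d > 0"
      have "skorohod_dist (emp_process X V n \<omega>) (Z k) < c / 2 ^ k + d"
        unfolding Z_def skorohod_dist_less_iff[OF emp_process_in_skorohod_space emp_process_in_skorohod_space]
      proof (intro exI conjI ballI allI)
        show "c / 2 ^ k < c / 2 ^ k + d" using \<open>d > 0\<close> by simp
        fix x :: "real^'m" assume x: "x \<in> cbox 0 1"
        have le1: "sqrt (real n) * (real CARD('m) * real n) / 2 ^ k \<le> c / 2 ^ k"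
          and le2: "real CARD('m) * real n / 2 ^ k \<le> c / 2 ^ k"
          by (auto intro!: divide_right_mono simp: c_def algebra_simps)
        show "\<bar>emp_process X V n \<omega> x - emp_process (\<lambda>i \<omega>. \<chi> j. dyadic_ceil k (X i \<omega> $ j)) V n \<omega> (apply_time_changes l x)\<bar> \<le> c / 2 ^ k"
          using bound[OF x] le1 by (simp add: Z_def)
        show "norm (apply_time_changes l x - x) \<le> c / 2 ^ k"
          using bound2[OF x] le2 by simp
      qed (rule l(1))
      then show "skorohod_dist (emp_process X V n \<omega>) (Z k) \<le> c / 2 ^ k + d" by simp
    qed
  qed
  then have ev: "\<forall>\<^sub>F k in sequentially. norm (skorohod_dist (Z k) (emp_process X V n \<omega>)) \<le> c / 2 ^ k"
    by eventually_elim (simp add: skorohod.commute)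
  have "(\<lambda>k. c * (1/2) ^ k) \<longlonglongrightarrow> c * 0"
    by (intro tendsto_mult_left LIMSEQ_realpow_zero) auto
  then have "(\<lambda>k. c / 2 ^ k) \<longlonglongrightarrow> 0" by (simp add: power_divide)
  from Lim_null_comparison[OF ev this] show ?thesis by (simp add: Z_def)
qed

lemma emp_process_cong:
  assumes "\<And>i j. i \<in> {1..n} \<Longrightarrow> X i \<omega> $ j = Y i \<omega>' $ j"
  shows "emp_process X V n \<omega> = emp_process Y V n \<omega>'"
proof -
  have "emp_cdf X n \<omega> = emp_cdf Y n \<omega>'" "marg_emp_cdf X j n \<omega> = marg_emp_cdf Y j n \<omega>'" for j
    unfolding emp_cdf_def marg_emp_cdf_def using assms
    by (auto intro!: ext sum.cong arg_cong2[where f = "(/)"])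
  then show ?thesis by (simp add: emp_process_def)
qed

lemma measurable_map_count_space:
  fixes f :: "'b \<Rightarrow> 'w \<Rightarrow> 'c::countable"
  assumes "\<And>i. i \<in> set is \<Longrightarrow> f i \<in> measurable P (count_space UNIV)"
  shows "(\<lambda>\<omega>. map (\<lambda>i. f i \<omega>) is) \<in> measurable P (count_space UNIV)"
  unfolding measurable_count_space_eq2_countable
proof (intro conjI ballI)
  fix c :: "'c list"
  have meas: "{\<omega> \<in> space P. f (is ! p) \<omega> = c ! p} \<in> sets P" if "p < length is" for p
  proof -
    have "{\<omega> \<in> space P. f (is ! p) \<omega> = c ! p} = f (is ! p) -` {c ! p} \<inter> space P" by auto
    also have "\<dots> \<in> sets P" by (rule measurable_sets[OF assms]) (use that in auto)
    finally show ?thesis .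
  qed
  have "(\<lambda>\<omega>. map (\<lambda>i. f i \<omega>) is) -` {c} \<inter> space P =
      (if length c = length is then {\<omega> \<in> space P. \<forall>p\<in>{..<length is}. f (is ! p) \<omega> = c ! p} else {})"
    by (auto simp: list_eq_iff_nth_eq)
  also have "\<dots> \<in> sets P"
    using meas by (auto intro!: sets.sets_Collect_finite_All)
  finally show "(\<lambda>\<omega>. map (\<lambda>i. f i \<omega>) is) -` {c} \<inter> space P \<in> sets P" .
qed auto

lemma measurable_vec_count_space:
  fixes f :: "'w \<Rightarrow> 'c::countable^'m::finite"
  assumes "\<And>j. (\<lambda>\<omega>. f \<omega> $ j) \<in> measurable P (count_space UNIV)"
  shows "f \<in> measurable P (count_space UNIV)"
  unfolding measurable_count_space_eq2_countable
proof (intro conjI ballI)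
  fix c :: "'c^'m"
  have "{\<omega> \<in> space P. f \<omega> $ j = c $ j} \<in> sets P" for j
  proof -
    have "{\<omega> \<in> space P. f \<omega> $ j = c $ j} = (\<lambda>\<omega>. f \<omega> $ j) -` {c $ j} \<inter> space P" by auto
    also have "\<dots> \<in> sets P" by (rule measurable_sets[OF assms]) simp
    finally show ?thesis .
  qed
  moreover have "f -` {c} \<inter> space P = {\<omega> \<in> space P. \<forall>j\<in>UNIV. f \<omega> $ j = c $ j}"
    by (auto simp: vec_eq_iff)
  ultimately show "f -` {c} \<inter> space P \<in> sets P" by (auto intro!: sets.sets_Collect_finite_All)
qed auto

text \<open>The rounded sample takes countably many values, so the rounded process is measurable for
  any sigma-algebra on paths, and it converges to the process in the Skorohod metric. In the sup
  norm this approximation would fail, since shifting a jump changes the path by the full height of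
  the jump.\<close>

lemma measurable_emp_process:
  fixes X :: "nat \<Rightarrow> 'w \<Rightarrow> real^'m::finite"
  assumes X: "\<And>i. i \<ge> 1 \<Longrightarrow> X i \<in> borel_measurable P"
  shows "emp_process X V n \<in> measurable P (borel_sigma skorohod_topology)"
proof (rule measurable_skorohod_limit[where Y = "\<lambda>k. emp_process (\<lambda>i \<omega>. \<chi> j. dyadic_ceil k (X i \<omega> $ j)) V n"])
  fix k
  define g where "g \<omega> = map (\<lambda>i. (\<chi> j. \<lceil>2 ^ k * X i \<omega> $ j\<rceil>) :: int^'m) [1..<Suc n]" for \<omega>
  \<comment> \<open>The process rebuilt from the list of integer vectors, over a one-point sample
    space. Lists count from 0 and samples from 1, whence \<open>i - 1\<close>.\<close>
  define Z where "Z c = emp_process (\<lambda>i (_::unit). (\<chi> j. of_int (c ! (i - 1) $ j) / 2 ^ k) :: real^'m) V n ()" for c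
  have comp: "(\<lambda>\<omega>. X i \<omega> $ j) \<in> borel_measurable P" if "i \<ge> 1" for i j
    by (rule measurable_compose[OF X[OF that]]) (intro borel_measurable_continuous_onI continuous_intros)
  have "g \<in> measurable P (count_space UNIV)"
    unfolding g_def
  proof (intro measurable_map_count_space measurable_vec_count_space)
    fix i j assume "i \<in> set [1..<Suc n]"
    then have [measurable]: "(\<lambda>\<omega>. X i \<omega> $ j) \<in> borel_measurable P" by (intro comp) auto
    show "(\<lambda>\<omega>. (\<chi> j. \<lceil>2 ^ k * X i \<omega> $ j\<rceil>) $ j) \<in> measurable P (count_space UNIV)" by simp
  qed
  then have "(\<lambda>\<omega>. Z (g \<omega>)) \<in> measurable P (borel_sigma skorohod_topology)"
    by (intro measurable_countable_range) (simp_all add: Z_def emp_process_in_skorohod_space)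
  moreover have "Z (g \<omega>) = emp_process (\<lambda>i \<omega>. \<chi> j. dyadic_ceil k (X i \<omega> $ j)) V n \<omega>" for \<omega>
  proof -
    have "g \<omega> ! (i - 1) $ j = \<lceil>2 ^ k * X i \<omega> $ j\<rceil>" if "i \<in> {1..n}" for i j
    proof -
      have "i - 1 < length [1..<Suc n]" "[1..<Suc n] ! (i - 1) = i"
        using that by (auto simp del: upt_Suc)
      then show ?thesis unfolding g_def by (subst nth_map) auto
    qed
    then show ?thesis unfolding Z_def dyadic_ceil_def by (intro emp_process_cong) simp
  qed
  ultimately show "emp_process (\<lambda>i \<omega>. \<chi> j. dyadic_ceil k (X i \<omega> $ j)) V n \<in> measurable P (borel_sigma skorohod_topology)"
    by simp
qed (simp_all add: emp_process_in_skorohod_space emp_process_dyadic_ceil_tendsto)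

section \<open>A Cramer--Wold device\<close>

text \<open>The phase \<open>b\<close> makes sines and constants special cases and closes the class
  under products. Each wave depends on one linear combination of the coordinates, which is the
  information that one-dimensional convergence provides.\<close>

inductive trig_poly :: "'a set \<Rightarrow> (('a \<Rightarrow> real) \<Rightarrow> real) \<Rightarrow> bool" for F where
  wave: "trig_poly F (\<lambda>v. c * cos ((\<Sum>x\<in>F. t x * v x) + b))"
| add: "trig_poly F f \<Longrightarrow> trig_poly F g \<Longrightarrow> trig_poly F (\<lambda>v. f v + g v)"

lemma trig_poly_const: "trig_poly F (\<lambda>_. c)"
  using trig_poly.wave[of F c "\<lambda>_. 0" 0] by simp

lemma trig_poly_sin:
  assumes "finite F" "x \<in> F"
  shows "trig_poly F (\<lambda>v. sin (v x / c))"
proof -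
  have "(\<Sum>y\<in>F. (if y = x then 1 / c else 0) * v y) = v x / c" for v
    using assms by (subst sum.cong[OF refl, of _ _ "\<lambda>y. if y = x then v x / c else 0"]) auto
  then show ?thesis
    using trig_poly.wave[of F 1 "\<lambda>y. if y = x then 1 / c else 0" "- (pi / 2)"]
    by (simp add: cos_sin_eq flip: sin_minus)
qed

lemma trig_poly_mult:
  assumes "trig_poly F f" "trig_poly F g"
  shows "trig_poly F (\<lambda>v. f v * g v)"
  using assms
proof (induction rule: trig_poly.induct)
  case (wave c t b)
  from wave show ?case
  proof (induction rule: trig_poly.induct)
    case (wave c' t' b')
    have "c * cos ((\<Sum>x\<in>F. t x * v x) + b) * (c' * cos ((\<Sum>x\<in>F. t' x * v x) + b')) =
      c * c' / 2 * cos ((\<Sum>x\<in>F. (t x - t' x) * v x) + (b - b')) +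
      c * c' / 2 * cos ((\<Sum>x\<in>F. (t x + t' x) * v x) + (b + b'))" for v
    proof -
      define A where "A = (\<Sum>x\<in>F. t x * v x) + b"
      define B where "B = (\<Sum>x\<in>F. t' x * v x) + b'"
      have 1: "(\<Sum>x\<in>F. (t x - t' x) * v x) + (b - b') = A - B" "(\<Sum>x\<in>F. (t x + t' x) * v x) + (b + b') = A + B"
        by (simp_all add: A_def B_def sum_subtractf sum.distrib algebra_simps)
      show ?thesis unfolding 1 A_def[symmetric] B_def[symmetric]
        by (simp add: cos_add cos_diff algebra_simps)
    qed
    then show ?case by (simp only:) (intro trig_poly.intros)
  next
    case (add f g)
    then show ?case using trig_poly.add by (simp add: distrib_left)
  qed
next
  case (add f g)
  then show ?case using trig_poly.add by (simp add: distrib_right)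
qed

lemma trig_poly_continuous:
  fixes F :: "'a::countable set"
  shows "trig_poly F f \<Longrightarrow> continuous_on S f"
proof (induction rule: trig_poly.induct)
  case (wave c t b)
  have coord: "continuous_on S (\<lambda>v. v x :: real)" for x :: 'a
    by (rule continuous_on_subset[OF continuous_on_product_coordinates]) simp
  show ?case
    by (intro continuous_on_cos continuous_on_add continuous_on_sum continuous_on_mult continuous_on_const coord)
next
  case (add f g)
  then show ?case by (intro continuous_on_add)
qed

lemma trig_poly_bounded: "trig_poly F f \<Longrightarrow> \<exists>B. \<forall>v. \<bar>f v\<bar> \<le> B"
proof (induction rule: trig_poly.induct)
  case (wave c t b)
  show ?case by (intro exI[of _ "\<bar>c\<bar>"]) (auto simp: abs_mult intro!: mult_left_le)
next
  case (add f g)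
  then show ?case by (metis abs_triangle_ineq add_mono order_trans)
qed

lemma trig_poly_measurable:
  assumes "trig_poly F f" "\<And>x. x \<in> F \<Longrightarrow> (\<lambda>\<omega>. V \<omega> x) \<in> borel_measurable P"
  shows "(\<lambda>\<omega>. f (V \<omega>)) \<in> borel_measurable P"
  using assms by (induction rule: trig_poly.induct) auto

lemma trig_poly_integrable:
  assumes "prob_space P" "trig_poly F f" "\<And>x. x \<in> F \<Longrightarrow> (\<lambda>\<omega>. V \<omega> x) \<in> borel_measurable P"
  shows "integrable P (\<lambda>\<omega>. f (V \<omega>))"
proof -
  interpret prob_space P by fact
  obtain B where "\<And>v. \<bar>f v\<bar> \<le> B" using trig_poly_bounded[OF assms(2)] by auto
  then show ?thesis
    by (intro integrable_const_bound[where B = B] trig_poly_measurable[OF assms(2,3)]) auto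
qed

lemma trig_poly_integral_tendsto:
  assumes P: "prob_space P" and N: "prob_space N"
    and V: "\<And>n x. x \<in> F \<Longrightarrow> (\<lambda>\<omega>. V n \<omega> x) \<in> borel_measurable P"
    and W: "\<And>x. x \<in> F \<Longrightarrow> (\<lambda>\<omega>. W \<omega> x) \<in> borel_measurable N"
    and conv: "\<And>t b. (\<lambda>n. \<integral>\<omega>. cos ((\<Sum>x\<in>F. t x * V n \<omega> x) + b) \<partial>P) \<longlonglongrightarrow> (\<integral>\<omega>. cos ((\<Sum>x\<in>F. t x * W \<omega> x) + b) \<partial>N)"
    and f: "trig_poly F f"
  shows "(\<lambda>n. \<integral>\<omega>. f (V n \<omega>) \<partial>P) \<longlonglongrightarrow> (\<integral>\<omega>. f (W \<omega>) \<partial>N)"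
  using f
proof (induction rule: trig_poly.induct)
  case (wave c t b)
  show ?case using tendsto_mult_left[OF conv[of t b], of c] by simp
next
  case (add f g)
  have "(\<lambda>n. (\<integral>\<omega>. f (V n \<omega>) \<partial>P) + (\<integral>\<omega>. g (V n \<omega>) \<partial>P)) \<longlonglongrightarrow> (\<integral>\<omega>. f (W \<omega>) \<partial>N) + (\<integral>\<omega>. g (W \<omega>) \<partial>N)"
    by (intro tendsto_add add.IH)
  also have "(\<lambda>n. (\<integral>\<omega>. f (V n \<omega>) \<partial>P) + (\<integral>\<omega>. g (V n \<omega>) \<partial>P)) = (\<lambda>n. \<integral>\<omega>. f (V n \<omega>) + g (V n \<omega>) \<partial>P)"
    using trig_poly_integrable[OF P add.hyps(1) V] trig_poly_integrable[OF P add.hyps(2) V] by simp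
  also have "(\<integral>\<omega>. f (W \<omega>) \<partial>N) + (\<integral>\<omega>. g (W \<omega>) \<partial>N) = (\<integral>\<omega>. f (W \<omega>) + g (W \<omega>) \<partial>N)"
    using trig_poly_integrable[OF N add.hyps(1) W] trig_poly_integrable[OF N add.hyps(2) W] by simp
  finally show ?case .
qed

text \<open>Approximation on a box by trigonometric polynomials of period four times the half side that are
  symmetric about the faces of the box: these keep the bound of \<open>H\<close> on the whole space.\<close>

lemma trig_poly_approx:
  fixes H :: "('a::countable \<Rightarrow> real) \<Rightarrow> real"
  assumes F: "finite F" and A: "A > 0" and e: "e > 0"
    and H: "continuous_on {v. (\<forall>x\<in>F. \<bar>v x\<bar> \<le> A) \<and> (\<forall>x. x \<notin> F \<longrightarrow> v x = 0)} H"
    and dep: "\<And>v. H v = H (\<lambda>x. if x \<in> F then v x else 0)"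
    and bd: "\<And>v. \<bar>H v\<bar> \<le> b"
  shows "\<exists>f. trig_poly F f \<and> (\<forall>v. \<bar>f v\<bar> \<le> b + e) \<and> (\<forall>v. (\<forall>x\<in>F. \<bar>v x\<bar> \<le> A) \<longrightarrow> \<bar>f v - H v\<bar> \<le> e)"
proof -
  define S where "S = {v :: 'a \<Rightarrow> real. (\<forall>x\<in>F. \<bar>v x\<bar> \<le> A) \<and> (\<forall>x. x \<notin> F \<longrightarrow> v x = 0)}"
  \<comment> \<open>Scaled so that \<open>[-A, A]\<close> corresponds to
    \<open>[-pi/2, pi/2]\<close>, where \<open>arcsin\<close> inverts \<open>sin\<close>. The map
    \<open>rf\<close> below is then the triangle wave that folds each coordinate in \<open>F\<close>
    onto \<open>[-A, A]\<close> and is the identity there.\<close>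
  define c where "c = 2 * A / pi"
  have c: "c > 0" using A by (simp add: c_def)
  define rf where "rf v = (\<lambda>x. if x \<in> F then c * arcsin (sin (v x / c)) else 0)" for v
  have cpi: "c * (pi / 2) = A" by (simp add: c_def)
  have rfS: "rf v \<in> S" for v
  proof -
    have "\<bar>c * arcsin (sin (v x / c))\<bar> \<le> A" for x
    proof -
      have "\<bar>arcsin (sin (v x / c))\<bar> \<le> pi / 2"
        using arcsin_lbound[of "sin (v x / c)"] arcsin_ubound[of "sin (v x / c)"] by auto
      then have "c * \<bar>arcsin (sin (v x / c))\<bar> \<le> c * (pi / 2)" using c by (intro mult_left_mono) auto
      then show ?thesis unfolding cpi abs_mult using c by simp
    qed
    then show ?thesis by (auto simp: S_def rf_def)
  qed
  have in_range: "- (pi / 2) \<le> v x / c \<and> v x / c \<le> pi / 2" if "v \<in> S" "x \<in> F" for v x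
  proof -
    have "\<bar>v x\<bar> \<le> c * (pi / 2)" using that cpi by (simp add: S_def)
    then have "\<bar>v x / c\<bar> \<le> pi / 2" using c by (simp add: abs_divide pos_divide_le_eq mult.commute)
    then show ?thesis by linarith
  qed
  have rf_id: "rf v = v" if "v \<in> S" for v
  proof
    fix x show "rf v x = v x"
      using in_range[OF that, of x] c that by (cases "x \<in> F") (simp_all add: rf_def S_def arcsin_sin)
  qed
  have rf_sin: "sin (rf v x / c) = sin (v x / c)" if "x \<in> F" for v x
    using that c by (simp add: rf_def)
  \<comment> \<open>Functions invariant under the folding \<open>rf\<close> take on the box all the
    values that they take anywhere, so a bound on the box is a global one. They still separate the
    points of the box, by \<open>sin (v x / c)\<close>.\<close>
  define R where "R = {f. trig_poly F f \<and> (\<forall>v. f (rf v) = f v)}"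
  have S_eq: "S = Pi\<^sub>E UNIV (\<lambda>x. if x \<in> F then {- A..A} else {0})"
  proof (rule set_eqI)
    fix v
    have "v \<in> S \<longleftrightarrow> (\<forall>x. v x \<in> (if x \<in> F then {- A..A} else {0}))"
      unfolding S_def mem_Collect_eq atLeastAtMost_iff
      by (metis abs_le_iff minus_le_iff atLeastAtMost_iff singleton_iff)
    then show "v \<in> S \<longleftrightarrow> v \<in> Pi\<^sub>E UNIV (\<lambda>x. if x \<in> F then {- A..A} else {0})"
      by (simp add: PiE_iff)
  qed
  have "compact S"
  proof -
    have "compactin (product_topology (\<lambda>_. euclidean) UNIV) S"
      unfolding S_eq compactin_PiE by simp
    then show ?thesis by (simp add: euclidean_product_topology)
  qed
  have RI: "f \<in> R" if "trig_poly F f" "\<And>v. f (rf v) = f v" for f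
    using that unfolding R_def by blast
  have RD: "trig_poly F f" "f (rf v) = f v" if "f \<in> R" for f v
    using that unfolding R_def by blast+
  have ring: "function_ring_on R S"
  proof (rule function_ring_on.intro)
    show "compact S" by fact
    show "continuous_on S f" if "f \<in> R" for f by (rule trig_poly_continuous[OF RD(1)[OF that]])
    show "(\<lambda>x. f x + g x) \<in> R" if "f \<in> R" "g \<in> R" for f g
      by (rule RI) (use RD[OF that(1)] RD[OF that(2)] in \<open>simp_all add: trig_poly.add\<close>)
    show "(\<lambda>x. f x * g x) \<in> R" if "f \<in> R" "g \<in> R" for f g
      by (rule RI) (use RD[OF that(1)] RD[OF that(2)] in \<open>simp_all add: trig_poly_mult\<close>)
    show "(\<lambda>_. d) \<in> R" for d by (rule RI) (simp_all add: trig_poly_const)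
    show "\<exists>f\<in>R. f v \<noteq> f w" if "v \<in> S" "w \<in> S" "v \<noteq> w" for v w
    proof -
      obtain x where x: "v x \<noteq> w x" using \<open>v \<noteq> w\<close> by (metis ext)
      have "x \<in> F"
      proof (rule ccontr)
        assume "x \<notin> F"
        then have "v x = 0" "w x = 0" using that(1,2) unfolding S_def by blast+
        then show False using x by simp
      qed
      have "v x / c \<noteq> w x / c" using x c by simp
      then have "sin (v x / c) \<noteq> sin (w x / c)"
        using in_range[OF that(1) \<open>x \<in> F\<close>] in_range[OF that(2) \<open>x \<in> F\<close>]
          sin_inj_pi[of "v x / c" "w x / c"] by blast
      moreover have "(\<lambda>v. sin (v x / c)) \<in> R"
        by (rule RI) (rule trig_poly_sin[OF F \<open>x \<in> F\<close>], rule rf_sin[OF \<open>x \<in> F\<close>])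
      ultimately show ?thesis by (intro bexI[of _ "\<lambda>v. sin (v x / c)"])
    qed
  qed
  obtain f where f: "f \<in> R" "\<And>v. v \<in> S \<Longrightarrow> \<bar>H v - f v\<bar> < e"
    using function_ring_on.Stone_Weierstrass_basic[OF ring H[folded S_def] e] by blast
  have "\<bar>f v\<bar> \<le> b + e" for v
    using f(2)[OF rfS[of v]] bd[of "rf v"] RD(2)[OF f(1), of v] by linarith
  moreover have "\<bar>f v - H v\<bar> \<le> e" if "\<forall>x\<in>F. \<bar>v x\<bar> \<le> A" for v
  proof -
    define w where "w = (\<lambda>x. if x \<in> F then v x else 0)"
    have "w \<in> S" using that by (auto simp: S_def w_def)
    have "rf v = rf w" by (simp add: rf_def w_def fun_eq_iff)
    then have "f v = f w" using RD(2)[OF f(1), of v] RD(2)[OF f(1), of w] by simp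
    moreover have "H v = H w" unfolding w_def by (rule dep)
    ultimately show ?thesis using f(2)[OF \<open>w \<in> S\<close>] by simp
  qed
  ultimately show ?thesis using RD(1)[OF f(1)] by blast
qed

lemma (in prob_space) integral_close_off_small_set:
  fixes f g :: "'a \<Rightarrow> real"
  assumes f: "integrable M f" and g: "integrable M g" and G: "G \<in> events" and e: "0 \<le> e" "0 \<le> b"
    and small: "prob (space M - G) \<le> p"
    and on: "\<And>\<omega>. \<omega> \<in> G \<Longrightarrow> \<bar>f \<omega> - g \<omega>\<bar> \<le> e" and off: "\<And>\<omega>. \<omega> \<in> space M \<Longrightarrow> \<bar>f \<omega> - g \<omega>\<bar> \<le> b"
  shows "\<bar>(\<integral>\<omega>. f \<omega> \<partial>M) - (\<integral>\<omega>. g \<omega> \<partial>M)\<bar> \<le> e + b * p"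
proof -
  have C: "space M - G \<in> events" using G by blast
  have int: "integrable M (\<lambda>\<omega>. b * indicat_real (space M - G) \<omega>)"
    by (intro integrable_mult_right integrable_real_indicator C) (simp add: emeasure_eq_measure)
  have "\<bar>(\<integral>\<omega>. f \<omega> \<partial>M) - (\<integral>\<omega>. g \<omega> \<partial>M)\<bar> = \<bar>\<integral>\<omega>. f \<omega> - g \<omega> \<partial>M\<bar>"
    using f g by simp
  also have "\<dots> \<le> (\<integral>\<omega>. \<bar>f \<omega> - g \<omega>\<bar> \<partial>M)" by (rule integral_abs_bound)
  also have "\<dots> \<le> (\<integral>\<omega>. e + b * indicator (space M - G) \<omega> \<partial>M)"
  proof (rule integral_mono)
    show "integrable M (\<lambda>\<omega>. e + b * indicator (space M - G) \<omega>)" using int by simp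
    show "\<bar>f \<omega> - g \<omega>\<bar> \<le> e + b * indicator (space M - G) \<omega>" if "\<omega> \<in> space M" for \<omega>
      using on[of \<omega>] off[OF that] that e by (cases "\<omega> \<in> G") auto
  qed (use f g in auto)
  also have "\<dots> = e + b * prob (space M - G)"
    using int C by (subst Bochner_Integration.integral_add) (simp_all add: prob_space)
  also have "\<dots> \<le> e + b * p" using small e by (intro add_left_mono mult_left_mono)
  finally show ?thesis .
qed

text \<open>By tightness both laws live, up to probability \<open>e\<close>, on one box, where
  \<open>H\<close> is within \<open>e\<close> of a trigonometric polynomial. Off the box the
  difference is at most \<open>2 * b + e\<close>, since the polynomial is bounded by
  \<open>b + e\<close> everywhere. The integrals of the polynomial converge by linearity from the
  cosine waves.\<close>

lemma cramer_wold:
  fixes H :: "('a::countable \<Rightarrow> real) \<Rightarrow> real"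
  assumes P: "prob_space P" and N: "prob_space N" and F: "finite F"
    and V: "\<And>n x. x \<in> F \<Longrightarrow> (\<lambda>\<omega>. V n \<omega> x) \<in> borel_measurable P"
    and W: "\<And>x. x \<in> F \<Longrightarrow> (\<lambda>\<omega>. W \<omega> x) \<in> borel_measurable N"
    and conv: "\<And>t b. (\<lambda>n. \<integral>\<omega>. cos ((\<Sum>x\<in>F. t x * V n \<omega> x) + b) \<partial>P) \<longlonglongrightarrow> (\<integral>\<omega>. cos ((\<Sum>x\<in>F. t x * W \<omega> x) + b) \<partial>N)"
    and tight: "\<And>e. e > 0 \<Longrightarrow> \<exists>A>0. (\<forall>n. measure P {\<omega>\<in>space P. \<exists>x\<in>F. \<bar>V n \<omega> x\<bar> > A} \<le> e) \<and>
        measure N {\<omega>\<in>space N. \<exists>x\<in>F. \<bar>W \<omega> x\<bar> > A} \<le> e"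
    and H: "\<And>A. continuous_on {v. (\<forall>x\<in>F. \<bar>v x\<bar> \<le> A) \<and> (\<forall>x. x \<notin> F \<longrightarrow> v x = 0)} H"
    and dep: "\<And>v. H v = H (\<lambda>x. if x \<in> F then v x else 0)"
    and bd: "\<And>v. \<bar>H v\<bar> \<le> b"
    and HV: "\<And>n. (\<lambda>\<omega>. H (V n \<omega>)) \<in> borel_measurable P" and HW: "(\<lambda>\<omega>. H (W \<omega>)) \<in> borel_measurable N"
  shows "(\<lambda>n. \<integral>\<omega>. H (V n \<omega>) \<partial>P) \<longlonglongrightarrow> (\<integral>\<omega>. H (W \<omega>) \<partial>N)"
proof (rule tendstoI)
  fix r :: real assume r: "r > 0"
  have b0: "b \<ge> 0" using bd[of "\<lambda>_. 0"] by linarith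
  \<comment> \<open>For \<open>e \<le> 1\<close> the error \<open>e + (2 * b + e) * e\<close> is at
    most \<open>e * K\<close>. The choice of \<open>e\<close> makes it at most \<open>r / 4\<close>
    for each law, leaving \<open>r / 2\<close> for the polynomial.\<close>
  define K where "K = 2 * b + 2"
  define e where "e = min 1 (r / (4 * K))"
  have K: "K > 0" using b0 by (simp add: K_def)
  have e: "e > 0" "e \<le> 1" using r K by (auto simp: e_def)
  have eK: "e * K \<le> r / 4" using K by (simp add: e_def min_def field_simps)
  obtain A where A: "A > 0" "\<And>n. measure P {\<omega>\<in>space P. \<exists>x\<in>F. \<bar>V n \<omega> x\<bar> > A} \<le> e"
    "measure N {\<omega>\<in>space N. \<exists>x\<in>F. \<bar>W \<omega> x\<bar> > A} \<le> e"
    using tight[OF e(1)] by auto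
  obtain f where f: "trig_poly F f" "\<And>v. \<bar>f v\<bar> \<le> b + e" "\<And>v. (\<forall>x\<in>F. \<bar>v x\<bar> \<le> A) \<Longrightarrow> \<bar>f v - H v\<bar> \<le> e"
    using trig_poly_approx[OF F A(1) e(1) H dep bd] by auto
  have close: "\<bar>(\<integral>\<omega>. f (Y \<omega>) \<partial>Q) - (\<integral>\<omega>. H (Y \<omega>) \<partial>Q)\<bar> \<le> r / 4"
    if Q: "prob_space Q" and Y: "\<And>x. x \<in> F \<Longrightarrow> (\<lambda>\<omega>. Y \<omega> x) \<in> borel_measurable Q"
      and HY: "(\<lambda>\<omega>. H (Y \<omega>)) \<in> borel_measurable Q"
      and small: "measure Q {\<omega>\<in>space Q. \<exists>x\<in>F. \<bar>Y \<omega> x\<bar> > A} \<le> e" for Q :: "'z measure" and Y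
  proof -
    interpret Q: prob_space Q by fact
    define G where "G = {\<omega>\<in>space Q. \<forall>x\<in>F. \<bar>Y \<omega> x\<bar> \<le> A}"
    have G: "G \<in> sets Q" unfolding G_def using F Y by measurable
    have compl: "space Q - G = {\<omega>\<in>space Q. \<exists>x\<in>F. \<bar>Y \<omega> x\<bar> > A}" by (auto simp: G_def not_le)
    have "\<bar>(\<integral>\<omega>. f (Y \<omega>) \<partial>Q) - (\<integral>\<omega>. H (Y \<omega>) \<partial>Q)\<bar> \<le> e + (2 * b + e) * e"
    proof (rule Q.integral_close_off_small_set[OF trig_poly_integrable[OF Q f(1) Y] _ G])
      show "integrable Q (\<lambda>\<omega>. H (Y \<omega>))"
        by (rule Q.integrable_const_bound[where B = b]) (use bd HY in auto)
      show "\<bar>f (Y \<omega>) - H (Y \<omega>)\<bar> \<le> 2 * b + e" for \<omega>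
        using f(2)[of "Y \<omega>"] bd[of "Y \<omega>"] by linarith
    qed (use f(3) e b0 small compl in \<open>auto simp: G_def\<close>)
    also have "\<dots> \<le> e * K" using e by (simp add: K_def algebra_simps mult_left_le)
    finally show ?thesis using eK by simp
  qed
  have "(\<lambda>n. \<integral>\<omega>. f (V n \<omega>) \<partial>P) \<longlonglongrightarrow> (\<integral>\<omega>. f (W \<omega>) \<partial>N)"
    by (rule trig_poly_integral_tendsto[OF P N V W conv f(1)])
  from tendstoD[OF this, of "r / 2"] r
  show "\<forall>\<^sub>F n in sequentially. dist (\<integral>\<omega>. H (V n \<omega>) \<partial>P) (\<integral>\<omega>. H (W \<omega>) \<partial>N) < r"
  proof (rule_tac eventually_mono)
    fix n assume "dist (\<integral>\<omega>. f (V n \<omega>) \<partial>P) (\<integral>\<omega>. f (W \<omega>) \<partial>N) < r / 2"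
    then show "dist (\<integral>\<omega>. H (V n \<omega>) \<partial>P) (\<integral>\<omega>. H (W \<omega>) \<partial>N) < r"
      using close[OF P V HV A(2)[of n]] close[OF N W HW A(3)] unfolding dist_real_def by linarith
  qed auto
qed

section \<open>Positive semidefinite kernels\<close>

definition psd_kernel :: "('a \<Rightarrow> 'a \<Rightarrow> real) \<Rightarrow> bool" where
  "psd_kernel K \<longleftrightarrow> (\<forall>x y. K x y = K y x) \<and> (\<forall>F c. finite F \<longrightarrow> 0 \<le> (\<Sum>x\<in>F. \<Sum>y\<in>F. c x * c y * K x y))"

definition schur_complement :: "('a \<Rightarrow> 'a \<Rightarrow> real) \<Rightarrow> 'a \<Rightarrow> 'a \<Rightarrow> 'a \<Rightarrow> real" where
  "schur_complement K p x y = K x y - K x p * K y p / K p p"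

lemma psd_kernel_diag: "psd_kernel K \<Longrightarrow> 0 \<le> K p p"
  using spec[OF spec[OF conjunct2[OF psd_kernel_def[THEN iffD1]], of K "{p}"], of "\<lambda>_. 1"] by simp

text \<open>A degenerate case of the Cauchy-Schwarz inequality; it makes zero pivots harmless in the
  factorisation.\<close>

lemma psd_kernel_zero:
  assumes K: "psd_kernel K" and 0: "K p p = 0"
  shows "K x p = 0"
proof (rule ccontr)
  assume nz: "K x p \<noteq> 0"
  then have "x \<noteq> p" using 0 by auto
  have sym: "K p x = K x p" using K by (auto simp: psd_kernel_def)
  \<comment> \<open>Solves \<open>K x x + 2 * s * K x p = -1\<close>, so that the form is negative
    for the coefficients 1 at \<open>x\<close> and \<open>s\<close> at \<open>p\<close>.\<close>
  define s where "s = - (K x x + 1) / (2 * K x p)"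
  have "0 \<le> (\<Sum>a\<in>{x, p}. \<Sum>b\<in>{x, p}. (if a = x then 1 else s) * (if b = x then 1 else s) * K a b)"
    using K unfolding psd_kernel_def by (simp only: finite.intros)
  also have "\<dots> = K x x + 2 * s * K x p"
    using \<open>x \<noteq> p\<close> 0 sym by (simp add: algebra_simps)
  also have "\<dots> = -1" using nz by (simp add: s_def field_simps)
  finally show False by simp
qed

text \<open>The form of the complement is the minimum of the form of \<open>K\<close> over all
  changes of the coefficient at \<open>p\<close>, hence nonnegative. For a zero pivot, division by
  zero gives zero and the complement is \<open>K\<close> itself.\<close>

lemma psd_kernel_schur_complement:
  assumes K: "psd_kernel K"
  shows "psd_kernel (schur_complement K p)"
  unfolding psd_kernel_def
proof (intro conjI allI impI)
  have sym: "K x y = K y x" for x y using K by (auto simp: psd_kernel_def)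
  then show "schur_complement K p x y = schur_complement K p y x" for x y
    by (simp add: schur_complement_def mult.commute)
  fix F :: "'a set" and c assume F: "finite F"
  show "0 \<le> (\<Sum>x\<in>F. \<Sum>y\<in>F. c x * c y * schur_complement K p x y)"
  proof (cases "K p p = 0")
    case True
    then show ?thesis using K F by (simp add: schur_complement_def psd_kernel_def)
  next
    case False
    define S where "S = (\<Sum>x\<in>F. c x * K x p)"
    define Q where "Q = (\<Sum>x\<in>F. \<Sum>y\<in>F. c x * c y * K x y)"
    define t where "t = S / K p p"
    \<comment> \<open>The coefficients \<open>c\<close> on \<open>F\<close> with the minimising
      multiple \<open>t\<close> of the point \<open>p\<close> subtracted; the two conditionals cover
      \<open>p \<in> F\<close> and \<open>p \<notin> F\<close> at once.\<close>
    define d where "d x = (if x \<in> F then c x else 0) - (if x = p then t else 0)" for x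
    have sum_d: "(\<Sum>x\<in>insert p F. d x * g x) = (\<Sum>x\<in>F. c x * g x) - t * g p" for g
    proof -
      have "(\<Sum>x\<in>insert p F. d x * g x) =
          (\<Sum>x\<in>insert p F. (if x \<in> F then c x * g x else 0)) - (\<Sum>x\<in>insert p F. if x = p then t * g x else 0)"
        unfolding sum_subtractf[symmetric] by (intro sum.cong) (auto simp: d_def algebra_simps)
      also have "(\<Sum>x\<in>insert p F. (if x \<in> F then c x * g x else 0)) = (\<Sum>x\<in>F. c x * g x)"
        using F by (intro sum.mono_neutral_cong_right) auto
      also have "(\<Sum>x\<in>insert p F. if x = p then t * g x else 0) = t * g p"
        using F by simp
      finally show ?thesis .
    qed
    have "0 \<le> (\<Sum>x\<in>insert p F. \<Sum>y\<in>insert p F. d x * d y * K x y)"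
      using K F by (simp add: psd_kernel_def)
    also have "\<dots> = (\<Sum>x\<in>insert p F. d x * (\<Sum>y\<in>insert p F. d y * K x y))"
      by (simp only: sum_distrib_left mult.assoc)
    also have "\<dots> = (\<Sum>x\<in>F. c x * (\<Sum>y\<in>F. c y * K x y)) - (\<Sum>x\<in>F. c x * (t * K x p)) - t * ((\<Sum>y\<in>F. c y * K p y) - t * K p p)"
      unfolding sum_d by (simp add: right_diff_distrib sum_subtractf)
    also have "(\<Sum>x\<in>F. c x * (\<Sum>y\<in>F. c y * K x y)) = Q"
      by (simp add: Q_def sum_distrib_left mult.assoc)
    also have "(\<Sum>x\<in>F. c x * (t * K x p)) = t * S"
      by (simp add: S_def sum_distrib_left mult.left_commute)
    also have "(\<Sum>y\<in>F. c y * K p y) = S" by (simp add: S_def sym[of p])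
    also have "Q - t * S - t * (S - t * K p p) = Q - S * S / K p p"
      using False by (simp add: t_def field_simps)
    also have "S * S / K p p = (\<Sum>x\<in>F. \<Sum>y\<in>F. c x * c y * (K x p * K y p / K p p))"
      unfolding S_def sum_product sum_divide_distrib by (simp add: ac_simps)
    also have "Q - \<dots> = (\<Sum>x\<in>F. \<Sum>y\<in>F. c x * c y * schur_complement K p x y)"
      by (simp add: Q_def schur_complement_def right_diff_distrib sum_subtractf)
    finally show ?thesis .
  qed
qed

text \<open>Elimination: step \<open>n\<close> takes the Schur complement at \<open>n\<close>, which
  clears row and column \<open>n\<close> and leaves the cleared ones zero. A zero pivot gives a zero
  column of \<open>L\<close>, in agreement with \<open>psd_kernel_zero\<close>. Triangularity makes
  one infinite matrix serve all finite sections.\<close>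

lemma psd_kernel_cholesky:
  fixes K :: "nat \<Rightarrow> nat \<Rightarrow> real"
  assumes K: "psd_kernel K"
  shows "\<exists>L. (\<forall>a l. a < l \<longrightarrow> L a l = 0) \<and> (\<forall>a b n. a < n \<longrightarrow> K a b = (\<Sum>l<n. L a l * L b l))"
proof -
  define R where "R = rec_nat K (\<lambda>n R. schur_complement R n)"
  have R: "R 0 = K" "R (Suc n) = schur_complement (R n) n" for n by (simp_all add: R_def)
  have psd: "psd_kernel (R n)" for n
    by (induction n) (simp_all add: R K psd_kernel_schur_complement)
  have sym: "R n a b = R n b a" for n a b using psd by (auto simp: psd_kernel_def)
  define L where "L a l = R l a l / sqrt (R l l l)" for a l
  have LL: "L a l * L b l = R l a l * R l b l / R l l l" for a b l
    using psd_kernel_diag[OF psd, of l l] by (simp add: L_def)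
  have step: "K a b = (\<Sum>l<n. L a l * L b l) + R n a b" for n a b
    by (induction n) (simp_all add: R LL schur_complement_def)
  have zero: "R n a l = 0" if "l < n" for n a l
    using that
  proof (induction n arbitrary: a)
    case (Suc n)
    show ?case
    proof (cases "l = n")
      case True
      then show ?thesis using psd_kernel_zero[OF psd, of n n a] by (simp add: R schur_complement_def)
    next
      case False
      then have "R n a' l = 0" for a' using Suc by simp
      then show ?thesis using sym[of n l n] by (simp add: R schur_complement_def)
    qed
  qed simp
  show ?thesis
  proof (intro exI[of _ L] conjI allI impI)
    fix a l :: nat assume "a < l"
    then show "L a l = 0" using zero[of a l l] sym[of l a l] by (simp add: L_def)
  next
    fix a b n :: nat assume "a < n"
    then show "K a b = (\<Sum>l<n. L a l * L b l)"
      using step[of a b n] zero[of a n b] sym[of n a b] by simp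
  qed
qed

section \<open>Centered normal laws\<close>

text \<open>Through the characteristic function the degenerate law \<open>v = 0\<close> is included,
  and sums of independent variables and almost sure limits need no densities.\<close>

definition normal_law :: "'w measure \<Rightarrow> ('w \<Rightarrow> real) \<Rightarrow> real \<Rightarrow> bool" where
  "normal_law N Y v \<longleftrightarrow> Y \<in> borel_measurable N \<and> 0 \<le> v \<and>
     char (distr N borel Y) = (\<lambda>t. complex_of_real (exp (- (v * t\<^sup>2) / 2)))"

lemma char_distr:
  assumes "Y \<in> borel_measurable N"
  shows "char (distr N borel Y) t = (\<integral>\<omega>. iexp (t * Y \<omega>) \<partial>N)"
  unfolding char_def using assms by (subst integral_distr) auto

lemma char_distr_scale:
  assumes "Y \<in> borel_measurable N"
  shows "char (distr N borel (\<lambda>\<omega>. d * Y \<omega>)) t = char (distr N borel Y) (d * t)"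
  using assms by (simp add: char_distr ac_simps)

lemma distr_std_normal_id: "distr std_normal_distribution borel (\<lambda>z. z) = std_normal_distribution"
  by (rule distr_id2) simp

lemma normal_law_distr:
  assumes N: "prob_space N" and Y: "normal_law N Y v"
  shows "distr N borel Y = distr std_normal_distribution borel (\<lambda>z. sqrt v * z)"
proof (rule Levy_uniqueness)
  have [measurable]: "Y \<in> borel_measurable N" using Y by (simp add: normal_law_def)
  show "real_distribution (distr N borel Y)"
    by (rule prob_space.real_distribution_distr[OF N]) measurable
  show "real_distribution (distr std_normal_distribution borel (\<lambda>z. sqrt v * z))"
    by (rule prob_space.real_distribution_distr) (auto intro: prob_space_normal_density)
  have "char (distr std_normal_distribution borel (\<lambda>z. sqrt v * z)) t = char std_normal_distribution (sqrt v * t)" for t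
    using char_distr_scale[of "\<lambda>z. z" std_normal_distribution "sqrt v" t] by (simp add: distr_std_normal_id)
  then show "char (distr N borel Y) = char (distr std_normal_distribution borel (\<lambda>z. sqrt v * z))"
    using Y by (auto simp: normal_law_def char_std_normal_distribution power_mult_distrib)
qed

lemma normal_law_integral:
  fixes f :: "real \<Rightarrow> real"
  assumes N: "prob_space N" and Y: "normal_law N Y v" and [measurable]: "f \<in> borel_measurable borel"
  shows "(\<integral>\<omega>. f (Y \<omega>) \<partial>N) = (\<integral>z. f (sqrt v * z) \<partial>std_normal_distribution)"
    and "integrable N (\<lambda>\<omega>. f (Y \<omega>)) \<longleftrightarrow> integrable std_normal_distribution (\<lambda>z. f (sqrt v * z))"
proof -
  have [measurable]: "Y \<in> borel_measurable N" using Y by (simp add: normal_law_def)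
  have "(\<integral>\<omega>. f (Y \<omega>) \<partial>N) = (\<integral>y. f y \<partial>distr N borel Y)" by (simp add: integral_distr)
  also have "\<dots> = (\<integral>z. f (sqrt v * z) \<partial>std_normal_distribution)"
    unfolding normal_law_distr[OF N Y] by (simp add: integral_distr)
  finally show "(\<integral>\<omega>. f (Y \<omega>) \<partial>N) = (\<integral>z. f (sqrt v * z) \<partial>std_normal_distribution)" .
  have "integrable N (\<lambda>\<omega>. f (Y \<omega>)) \<longleftrightarrow> integrable (distr N borel Y) f" by (simp add: integrable_distr_eq)
  also have "\<dots> \<longleftrightarrow> integrable std_normal_distribution (\<lambda>z. f (sqrt v * z))"
    unfolding normal_law_distr[OF N Y] by (simp add: integrable_distr_eq)
  finally show "integrable N (\<lambda>\<omega>. f (Y \<omega>)) \<longleftrightarrow> integrable std_normal_distribution (\<lambda>z. f (sqrt v * z))" .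
qed

lemma normal_law_moments:
  assumes N: "prob_space N" and Y: "normal_law N Y v"
  shows "(\<integral>\<omega>. Y \<omega> \<partial>N) = 0" "integrable N (\<lambda>\<omega>. (Y \<omega>)\<^sup>2)" "(\<integral>\<omega>. (Y \<omega>)\<^sup>2 \<partial>N) = v"
proof -
  have v: "v \<ge> 0" using Y by (simp add: normal_law_def)
  show "(\<integral>\<omega>. Y \<omega> \<partial>N) = 0"
    using normal_law_integral(1)[OF N Y, of "\<lambda>x. x"] integral_std_normal_distribution_moment_odd[of 1] by simp
  show "integrable N (\<lambda>\<omega>. (Y \<omega>)\<^sup>2)"
    using normal_law_integral(2)[OF N Y, of "\<lambda>x. x\<^sup>2"] integrable_std_normal_distribution_moment[of 2]
    by (simp add: power_mult_distrib)
  show "(\<integral>\<omega>. (Y \<omega>)\<^sup>2 \<partial>N) = v"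
    using normal_law_integral(1)[OF N Y, of "\<lambda>x. x\<^sup>2"] std_normal_distribution_even_moments(1)[of 1] v
    by (simp add: power_mult_distrib)
qed

lemma std_normal_mgf:
  "integrable std_normal_distribution (\<lambda>z. exp (c * z))"
  "(\<integral>z. exp (c * z) \<partial>std_normal_distribution) = exp (c\<^sup>2 / 2)"
proof -
  have eq: "std_normal_density z * exp (c * z) = exp (c\<^sup>2 / 2) * normal_density c 1 z" for z
    by (simp add: normal_density_def exp_add[symmetric] field_simps power2_eq_square)
  have "has_bochner_integral lborel (normal_density c 1) 1"
    using integrable_normal_density[of 1 c] integral_normal_density[of 1 c]
    by (simp add: has_bochner_integral_iff)
  then have "has_bochner_integral lborel (\<lambda>z. exp (c\<^sup>2 / 2) * normal_density c 1 z) (exp (c\<^sup>2 / 2) * 1)"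
    by (intro has_bochner_integral_mult_right) auto
  then have "has_bochner_integral lborel (\<lambda>z. std_normal_density z * exp (c * z)) (exp (c\<^sup>2 / 2))"
    by (simp add: eq)
  then show "integrable std_normal_distribution (\<lambda>z. exp (c * z))"
    "(\<integral>z. exp (c * z) \<partial>std_normal_distribution) = exp (c\<^sup>2 / 2)"
    by (simp_all add: has_bochner_integral_iff integrable_density integral_density)
qed

lemma normal_law_mgf:
  assumes N: "prob_space N" and Y: "normal_law N Y v"
  shows "integrable N (\<lambda>\<omega>. exp (c * Y \<omega>))" "(\<integral>\<omega>. exp (c * Y \<omega>) \<partial>N) = exp (c\<^sup>2 * v / 2)"
proof -
  have v: "v \<ge> 0" using Y by (simp add: normal_law_def)
  show "integrable N (\<lambda>\<omega>. exp (c * Y \<omega>))"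
    using normal_law_integral(2)[OF N Y, of "\<lambda>x. exp (c * x)"] std_normal_mgf(1)[of "c * sqrt v"]
    by (simp add: mult.assoc)
  show "(\<integral>\<omega>. exp (c * Y \<omega>) \<partial>N) = exp (c\<^sup>2 * v / 2)"
    using normal_law_integral(1)[OF N Y, of "\<lambda>x. exp (c * x)"] std_normal_mgf(2)[of "c * sqrt v"] v
    by (simp add: mult.assoc power_mult_distrib)
qed

lemma normal_law_normal_rv:
  assumes N: "prob_space N" and Y: "normal_law N Y v"
  shows "normal_rv N Y"
proof -
  have [measurable]: "Y \<in> borel_measurable N" and v: "v \<ge> 0" using Y by (simp_all add: normal_law_def)
  interpret N: prob_space N by fact
  interpret S: prob_space std_normal_distribution by (rule prob_space_normal_density) simp
  show ?thesis
  proof (cases "v = 0")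
    case True
    have "measure N {\<omega> \<in> space N. Y \<omega> \<noteq> 0} = measure (distr N borel Y) (- {0})"
      by (subst measure_distr) (auto intro!: arg_cong[where f = "measure N"])
    also have "\<dots> = 0"
      unfolding normal_law_distr[OF N Y] by (subst measure_distr) (auto simp: True vimage_def)
    finally have "AE \<omega> in N. Y \<omega> = 0"
      by (subst AE_iff_measurable[OF _ refl]) (auto simp: N.emeasure_eq_measure)
    then show ?thesis by (auto simp: normal_rv_def)
  next
    case False
    have "distributed std_normal_distribution lborel (\<lambda>z. z) (normal_density 0 1)"
      unfolding distributed_def by (auto intro!: measure_eqI simp: distr_id2)
    from S.normal_density_affine[OF this, of "sqrt v" 0] False v
    have "distributed std_normal_distribution lborel (\<lambda>z. sqrt v * z) (normal_density 0 (sqrt v))" by simp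
    then have "distr std_normal_distribution lborel (\<lambda>z. sqrt v * z) = density lborel (normal_density 0 (sqrt v))"
      by (simp add: distributed_def)
    moreover have "distr N lborel Y = distr N borel Y" "distr std_normal_distribution lborel (\<lambda>z. sqrt v * z) = distr std_normal_distribution borel (\<lambda>z. sqrt v * z)"
      by (auto intro!: distr_cong)
    ultimately have "distributed N lborel Y (normal_density 0 (sqrt v))"
      using normal_law_distr[OF N Y] by (simp add: distributed_def)
    then have "\<exists>\<mu> \<sigma>. \<sigma> > 0 \<and> distributed N lborel Y (normal_density \<mu> \<sigma>)"
      using False v by (intro exI[of _ 0] exI[of _ "sqrt v"] conjI) auto
    then show ?thesis by (simp add: normal_rv_def)
  qed
qed

text \<open>Characteristic functions converge by dominated convergence, the integrands having
  modulus 1.\<close>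

lemma normal_law_limit:
  assumes N: "prob_space N" and Yk: "\<And>k. normal_law N (Y k) (v k)" and [measurable]: "Z \<in> borel_measurable N"
    and lim: "AE \<omega> in N. (\<lambda>k. Y k \<omega>) \<longlonglongrightarrow> Z \<omega>" and v: "v \<longlonglongrightarrow> w"
  shows "normal_law N Z w"
  unfolding normal_law_def
proof (intro conjI ext)
  interpret N: prob_space N by fact
  have [measurable]: "Y k \<in> borel_measurable N" for k using Yk by (simp add: normal_law_def)
  show "0 \<le> w" using v Yk by (intro LIMSEQ_le_const) (auto simp: normal_law_def)
  fix t
  have "(\<lambda>k. \<integral>\<omega>. iexp (t * Y k \<omega>) \<partial>N) \<longlonglongrightarrow> (\<integral>\<omega>. iexp (t * Z \<omega>) \<partial>N)"
  proof (rule integral_dominated_convergence[where w = "\<lambda>_. 1"])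
    show "AE \<omega> in N. (\<lambda>k. iexp (t * Y k \<omega>)) \<longlonglongrightarrow> iexp (t * Z \<omega>)"
      using lim by eventually_elim (intro tendsto_intros)
  qed auto
  moreover have "(\<integral>\<omega>. iexp (t * Y k \<omega>) \<partial>N) = complex_of_real (exp (- (v k * t\<^sup>2) / 2))" for k
    using Yk[of k] char_distr[of "Y k" N t] by (simp add: normal_law_def)
  moreover have "(\<lambda>k. complex_of_real (exp (- (v k * t\<^sup>2) / 2))) \<longlonglongrightarrow> complex_of_real (exp (- (w * t\<^sup>2) / 2))"
    by (intro tendsto_intros v) auto
  ultimately have "(\<integral>\<omega>. iexp (t * Z \<omega>) \<partial>N) = complex_of_real (exp (- (w * t\<^sup>2) / 2))"
    using LIMSEQ_unique by simp
  then show "char (distr N borel Z) t = complex_of_real (exp (- (w * t\<^sup>2) / 2))"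
    by (simp add: char_distr)
qed measurable

text \<open>Injectivity of \<open>\<nu>\<close> selects distinct coordinates of the product measure;
  these are independent, so the characteristic function of the sum factorises.\<close>

lemma normal_law_iid_sum:
  fixes \<nu> :: "nat \<Rightarrow> 'i" and d :: "nat \<Rightarrow> real"
  assumes \<nu>: "inj \<nu>"
  shows "normal_law (PiM UNIV (\<lambda>_::'i. std_normal_distribution)) (\<lambda>\<omega>. \<Sum>l<n. d l * \<omega> (\<nu> l)) (\<Sum>l<n. (d l)\<^sup>2)"
proof -
  let ?S = "\<lambda>_::'i. std_normal_distribution"
  let ?N = "PiM UNIV ?S"
  have pS: "prob_space (density lborel (normal_density 0 1))" by (rule prob_space_normal_density) simp
  interpret S: product_prob_space ?S UNIV
    by (simp add: product_prob_space_def product_sigma_finite_def product_prob_space_axioms_def pS prob_space_imp_sigma_finite)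
  have sets: "measurable M std_normal_distribution = measurable M borel" for M :: "'z measure"
    by (rule measurable_cong_sets) auto
  have comp: "(\<lambda>\<omega>. \<omega> i) \<in> borel_measurable ?N" for i
    using measurable_component_singleton[of i UNIV ?S] by (simp add: sets)
  have comp_distr: "distr ?N borel (\<lambda>\<omega>. \<omega> i) = std_normal_distribution" for i
  proof -
    have "distr ?N borel (\<lambda>\<omega>. \<omega> i) = distr ?N std_normal_distribution (\<lambda>\<omega>. \<omega> i)" by (rule distr_cong) auto
    also have "\<dots> = std_normal_distribution" using distr_PiM_component[of UNIV ?S i] pS by simp
    finally show ?thesis .
  qed
  have indep: "S.indep_vars (\<lambda>_. borel) (\<lambda>l \<omega>. d l * \<omega> (\<nu> l)) {..<n}"
  proof (cases "n = 0")
    case True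
    then show ?thesis unfolding S.indep_vars_def2 by (simp add: S.indep_sets_def)
  next
    case False
    have "S.indep_vars (\<lambda>_. borel) (\<lambda>l \<omega>. \<omega> (\<nu> l)) {..<n}"
    proof (subst S.indep_vars_iff_distr_eq_PiM')
      have "distr ?N (PiM {..<n} (\<lambda>_. borel)) (\<lambda>\<omega>. \<lambda>l\<in>{..<n}. \<omega> (\<nu> l)) =
          distr ?N (PiM {..<n} (\<lambda>l. ?S (\<nu> l))) (\<lambda>\<omega>. \<lambda>l\<in>{..<n}. \<omega> (\<nu> l))"
        by (rule distr_cong) (auto intro!: sets_PiM_cong)
      also have "\<dots> = PiM {..<n} (\<lambda>l. ?S (\<nu> l))"
        by (rule distr_PiM_reindex) (use \<nu> pS in \<open>auto simp: inj_on_def\<close>)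
      finally show "distr ?N (PiM {..<n} (\<lambda>_. borel)) (\<lambda>\<omega>. \<lambda>l\<in>{..<n}. \<omega> (\<nu> l)) = PiM {..<n} (\<lambda>l. distr ?N borel (\<lambda>\<omega>. \<omega> (\<nu> l)))"
        by (simp add: comp_distr)
    qed (use False comp in auto)
    then show ?thesis by (rule S.indep_vars_compose2) auto
  qed
  have "char (distr ?N borel (\<lambda>\<omega>. \<Sum>l<n. d l * \<omega> (\<nu> l))) t = complex_of_real (exp (- ((\<Sum>l<n. (d l)\<^sup>2) * t\<^sup>2) / 2))" for t
  proof -
    have "char (distr ?N borel (\<lambda>\<omega>. \<Sum>l<n. d l * \<omega> (\<nu> l))) t = (\<Prod>l<n. char (distr ?N borel (\<lambda>\<omega>. d l * \<omega> (\<nu> l))) t)"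
      by (rule S.char_distr_sum[OF indep])
    also have "\<dots> = (\<Prod>l<n. complex_of_real (exp (- ((d l)\<^sup>2 * t\<^sup>2) / 2)))"
      by (simp add: char_distr_scale[OF comp] comp_distr char_std_normal_distribution power_mult_distrib)
    also have "\<dots> = complex_of_real (exp (\<Sum>l<n. - ((d l)\<^sup>2 * t\<^sup>2) / 2))"
      by (simp add: exp_sum)
    also have "(\<Sum>l<n. - ((d l)\<^sup>2 * t\<^sup>2) / 2) = - ((\<Sum>l<n. (d l)\<^sup>2) * t\<^sup>2) / 2"
      by (simp add: sum_distrib_right sum_negf sum_divide_distrib)
    finally show ?thesis .
  qed
  then show ?thesis using comp by (auto simp: normal_law_def intro!: sum_nonneg)
qed

section \<open>Dyadic grids and chaining\<close>

definition dyadic_point :: "nat \<Rightarrow> int^'m \<Rightarrow> real^'m" where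
  "dyadic_point k c = (\<chi> j. of_int (c $ j) / 2 ^ k)"

definition dyadic_index :: "nat \<Rightarrow> (int^'m::finite) set" where
  "dyadic_index k = {c. \<forall>j. c $ j \<in> {0..2 ^ k}}"

definition dyadic_grid :: "nat \<Rightarrow> (real^'m::finite) set" where
  "dyadic_grid k = dyadic_point k ` dyadic_index k"

definition dyadic_floor :: "nat \<Rightarrow> real^'m \<Rightarrow> real^'m" where
  "dyadic_floor k x = dyadic_point k (\<chi> j. \<lfloor>2 ^ k * x $ j\<rfloor>)"

text \<open>Neighbours are also ordered. For ordered points the difference of the two lower-box
  indicators takes only the values 0 and 1, and the kernel simplifies because the minimum is
  \<open>y\<close>.\<close>

definition dyadic_near :: "nat \<Rightarrow> real^'m \<Rightarrow> real^'m \<Rightarrow> bool" where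
  "dyadic_near r y z \<longleftrightarrow> (\<forall>j. y $ j \<le> z $ j \<and> z $ j \<le> y $ j + 1 / 2 ^ r)"

definition small_increments :: "nat \<Rightarrow> real \<Rightarrow> (real^'m::finite \<Rightarrow> real) \<Rightarrow> bool" where
  "small_increments r t f \<longleftrightarrow>
     (\<forall>y\<in>dyadic_grid r. \<forall>z\<in>dyadic_grid r. dyadic_near r y z \<longrightarrow> \<bar>f z - f y\<bar> \<le> t)"

text \<open>The fourth root of one half: its square has the order of the standard deviation of an
  increment at one scale, so the threshold \<open>chain_ratio ^ r\<close> exceeds the deviation at
  scale \<open>r\<close> by the factor \<open>2^(r/4)\<close>.\<close>

definition chain_ratio :: real where "chain_ratio = (1 / 2) powr (1 / 4)"

lemma chain_ratio: "0 < chain_ratio" "chain_ratio < 1" "chain_ratio ^ 4 = 1 / 2"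
proof -
  show "0 < chain_ratio" by (simp add: chain_ratio_def)
  show "chain_ratio < 1" using powr_less_mono2[of "1/4" "1/2" 1] by (simp add: chain_ratio_def)
  show "chain_ratio ^ 4 = 1 / 2"
    unfolding chain_ratio_def by (subst powr_realpow[symmetric]) (simp_all add: powr_powr)
qed

text \<open>\<open>(1 / chain_ratio) ^ (2 * r)\<close> is the parameter of the exponential moment.
  Its square cancels the variance of order \<open>2^-r\<close>, and its product with the threshold
  is the exponent \<open>2^(r/4)\<close> of the tail.\<close>

lemma chain_rate:
  "((1 / chain_ratio) ^ (2 * r))\<^sup>2 = 2 ^ r"
  "(1 / chain_ratio) ^ (2 * r) * chain_ratio ^ r = (1 / chain_ratio) ^ r"
proof -
  have "((1 / chain_ratio) ^ (2 * r))\<^sup>2 = ((1 / chain_ratio) ^ 4) ^ r"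
    by (simp add: power_mult[symmetric] mult.commute)
  then show "((1 / chain_ratio) ^ (2 * r))\<^sup>2 = 2 ^ r" by (simp add: power_divide chain_ratio)
  have "(1 / chain_ratio) ^ r * chain_ratio ^ r = 1" using chain_ratio by (simp add: power_divide)
  then show "(1 / chain_ratio) ^ (2 * r) * chain_ratio ^ r = (1 / chain_ratio) ^ r"
    by (simp only: mult_2 power_add mult.assoc mult_1_right)
qed

lemma dyadic_floor_nth: "dyadic_floor k x $ j = of_int \<lfloor>2 ^ k * x $ j\<rfloor> / 2 ^ k"
  by (simp add: dyadic_floor_def dyadic_point_def)

lemma dyadic_floor_bounds:
  "dyadic_floor k x $ j \<le> x $ j" "x $ j < dyadic_floor k x $ j + 1 / 2 ^ k"
proof -
  have "of_int \<lfloor>2 ^ k * x $ j\<rfloor> \<le> 2 ^ k * x $ j" "2 ^ k * x $ j < of_int \<lfloor>2 ^ k * x $ j\<rfloor> + 1" by linarith+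
  then show "dyadic_floor k x $ j \<le> x $ j" "x $ j < dyadic_floor k x $ j + 1 / 2 ^ k"
    unfolding dyadic_floor_nth by (auto simp: field_simps)
qed

lemma dyadic_grid_iff:
  "y \<in> dyadic_grid k \<longleftrightarrow> (\<forall>j. \<exists>c::int. 0 \<le> c \<and> c \<le> 2 ^ k \<and> y $ j = of_int c / 2 ^ k)"
proof
  assume "\<forall>j. \<exists>c::int. 0 \<le> c \<and> c \<le> 2 ^ k \<and> y $ j = of_int c / 2 ^ k"
  then obtain c where c: "\<And>j. 0 \<le> c j \<and> c j \<le> (2 ^ k :: int) \<and> y $ j = of_int (c j) / 2 ^ k" by metis
  then have "y = dyadic_point k (\<chi> j. c j)" "(\<chi> j. c j) \<in> dyadic_index k"
    by (simp_all add: dyadic_point_def dyadic_index_def vec_eq_iff)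
  then show "y \<in> dyadic_grid k" by (auto simp: dyadic_grid_def)
qed (auto simp: dyadic_grid_def dyadic_point_def dyadic_index_def)

lemma finite_dyadic_index: "finite (dyadic_index k :: (int^'m::finite) set)"
  and card_dyadic_index: "card (dyadic_index k :: (int^'m) set) \<le> (2 ^ k + 1) ^ CARD('m)"
proof -
  have eq: "(dyadic_index k :: (int^'m) set) = (\<lambda>f. \<chi> j. f j) ` (PiE UNIV (\<lambda>_. {0..2 ^ k}))"
  proof (intro set_eqI iffI)
    fix c :: "int^'m" assume "c \<in> dyadic_index k"
    then have "c = (\<chi> j. (\<lambda>j. c $ j) j)" "(\<lambda>j. c $ j) \<in> PiE UNIV (\<lambda>_. {0..2 ^ k})"
      by (auto simp: dyadic_index_def)
    then show "c \<in> (\<lambda>f. \<chi> j. f j) ` (PiE UNIV (\<lambda>_. {0..2 ^ k}))" by blast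
  qed (auto simp: dyadic_index_def)
  have fin: "finite (PiE (UNIV :: 'm set) (\<lambda>_. {0..2 ^ k :: int}))" by (intro finite_PiE) auto
  show "finite (dyadic_index k :: (int^'m) set)" unfolding eq by (rule finite_imageI[OF fin])
  have "card (dyadic_index k :: (int^'m) set) \<le> card (PiE (UNIV :: 'm set) (\<lambda>_. {0..2 ^ k :: int}))"
    unfolding eq by (rule card_image_le[OF fin])
  also have "\<dots> = (2 ^ k + 1) ^ CARD('m)" by (simp add: card_PiE nat_add_distrib nat_power_eq)
  finally show "card (dyadic_index k :: (int^'m) set) \<le> (2 ^ k + 1) ^ CARD('m)" .
qed

lemma finite_dyadic_grid: "finite (dyadic_grid k)"
  by (simp add: dyadic_grid_def finite_dyadic_index)

lemma card_dyadic_grid: "card (dyadic_grid k :: (real^'m::finite) set) \<le> (2 ^ k + 1) ^ CARD('m)"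
  unfolding dyadic_grid_def using card_image_le[OF finite_dyadic_index] card_dyadic_index order_trans by blast

lemma dyadic_grid_subset_cube: "dyadic_grid k \<subseteq> cbox 0 1"
proof
  fix y :: "real^'m" assume y: "y \<in> dyadic_grid k"
  have "0 \<le> y $ j \<and> y $ j \<le> 1" for j
  proof -
    obtain c :: int where c: "0 \<le> c" "c \<le> 2 ^ k" "y $ j = of_int c / 2 ^ k"
      using y unfolding dyadic_grid_iff by blast
    have "of_int c \<le> (of_int (2 ^ k) :: real)" using c by (simp only: of_int_le_iff)
    then show ?thesis using c by simp
  qed
  then show "y \<in> cbox 0 1" by (simp add: mem_box_cart)
qed

lemma dyadic_grid_Suc: "dyadic_grid k \<subseteq> dyadic_grid (Suc k)"
proof
  fix y :: "real^'m" assume y: "y \<in> dyadic_grid k"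
  show "y \<in> dyadic_grid (Suc k)"
    unfolding dyadic_grid_iff
  proof
    fix j
    obtain c :: int where "0 \<le> c" "c \<le> 2 ^ k" "y $ j = of_int c / 2 ^ k"
      using y unfolding dyadic_grid_iff by blast
    then show "\<exists>c::int. 0 \<le> c \<and> c \<le> 2 ^ Suc k \<and> y $ j = of_int c / 2 ^ Suc k"
      by (intro exI[of _ "2 * c"]) simp
  qed
qed

lemma dyadic_floor_in_grid:
  assumes "x \<in> cbox 0 1"
  shows "dyadic_floor k x \<in> dyadic_grid k"
  unfolding dyadic_grid_iff
proof
  fix j
  have x: "0 \<le> x $ j" "x $ j \<le> 1" using assms by (auto simp: mem_box_cart)
  have "\<lfloor>2 ^ k * x $ j\<rfloor> \<le> \<lfloor>2 ^ k :: real\<rfloor>" using x by (intro floor_mono) (simp add: mult_left_le)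
  also have "\<lfloor>2 ^ k :: real\<rfloor> = 2 ^ k" using floor_of_int[of "2 ^ k"] by (simp del: floor_of_int)
  finally show "\<exists>c::int. 0 \<le> c \<and> c \<le> 2 ^ k \<and> dyadic_floor k x $ j = of_int c / 2 ^ k"
    using x by (intro exI[of _ "\<lfloor>2 ^ k * x $ j\<rfloor>"]) (auto simp: dyadic_floor_nth)
qed

lemma dyadic_floor_grid:
  assumes "y \<in> dyadic_grid k"
  shows "dyadic_floor k y = y"
proof -
  have "dyadic_floor k y $ j = y $ j" for j
  proof -
    obtain c :: int where "y $ j = of_int c / 2 ^ k" using assms unfolding dyadic_grid_iff by blast
    then show ?thesis by (simp add: dyadic_floor_nth)
  qed
  then show ?thesis by (simp add: vec_eq_iff)
qed

lemma dyadic_near_floor_Suc: "dyadic_near (Suc r) (dyadic_floor r x) (dyadic_floor (Suc r) x)"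
  unfolding dyadic_near_def
proof (intro allI)
  fix j
  define a where "a = 2 ^ r * x $ j"
  have "2 * \<lfloor>a\<rfloor> \<le> \<lfloor>2 * a\<rfloor>" "\<lfloor>2 * a\<rfloor> \<le> 2 * \<lfloor>a\<rfloor> + 1" by linarith+
  then have "of_int (2 * \<lfloor>a\<rfloor>) \<le> (of_int \<lfloor>2 * a\<rfloor> :: real)" "of_int \<lfloor>2 * a\<rfloor> \<le> (of_int (2 * \<lfloor>a\<rfloor> + 1) :: real)"
    by (simp_all only: of_int_le_iff)
  then show "dyadic_floor r x $ j \<le> dyadic_floor (Suc r) x $ j \<and> dyadic_floor (Suc r) x $ j \<le> dyadic_floor r x $ j + 1 / 2 ^ Suc r"
    unfolding dyadic_floor_nth by (auto simp: a_def field_simps)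
qed

text \<open>Successive dyadic floors of \<open>x\<close> are neighbours on the finer grid, so the
  increments telescope into a geometric sum. The exact form with a difference of powers is the one
  that the induction reproduces.\<close>

lemma chaining:
  fixes f :: "real^'m::finite \<Rightarrow> real"
  assumes x: "x \<in> cbox 0 1" and "k \<le> R"
    and small: "\<And>r. k < r \<Longrightarrow> r \<le> R \<Longrightarrow> small_increments r (chain_ratio ^ r) f"
  shows "\<bar>f (dyadic_floor R x) - f (dyadic_floor k x)\<bar> \<le> (chain_ratio ^ Suc k - chain_ratio ^ Suc R) / (1 - chain_ratio)"
  using \<open>k \<le> R\<close> small
proof (induction R rule: dec_induct)
  case (step R)
  let ?q = chain_ratio
  have "small_increments (Suc R) (?q ^ Suc R) f" by (rule step.prems) (use step.hyps in auto)
  then have 1: "\<bar>f (dyadic_floor (Suc R) x) - f (dyadic_floor R x)\<bar> \<le> ?q ^ Suc R"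
    unfolding small_increments_def
    using dyadic_floor_in_grid[OF x, of "Suc R"] dyadic_floor_in_grid[OF x, of R] dyadic_grid_Suc[of R] dyadic_near_floor_Suc[of R x]
    by blast
  have 2: "\<bar>f (dyadic_floor R x) - f (dyadic_floor k x)\<bar> \<le> (?q ^ Suc k - ?q ^ Suc R) / (1 - ?q)"
    by (rule step.IH) (use step.prems in auto)
  have "(?q ^ Suc k - ?q ^ Suc R) / (1 - ?q) + ?q ^ Suc R = (?q ^ Suc k - ?q ^ Suc (Suc R)) / (1 - ?q)"
    using chain_ratio by (simp add: field_simps)
  then show ?case using 1 2 by linarith
qed simp

lemma chaining_le:
  fixes f :: "real^'m::finite \<Rightarrow> real"
  assumes x: "x \<in> cbox 0 1" and "k \<le> R"
    and small: "\<And>r. k < r \<Longrightarrow> r \<le> R \<Longrightarrow> small_increments r (chain_ratio ^ r) f"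
  shows "\<bar>f (dyadic_floor R x) - f (dyadic_floor k x)\<bar> \<le> chain_ratio ^ k / (1 - chain_ratio)"
proof -
  let ?q = chain_ratio
  have "?q ^ Suc k \<le> ?q ^ k" using chain_ratio by (simp add: mult_left_le_one_le)
  moreover have "0 \<le> ?q ^ Suc R" using chain_ratio by simp
  ultimately have "?q ^ Suc k - ?q ^ Suc R \<le> ?q ^ k" by linarith
  then have "(?q ^ Suc k - ?q ^ Suc R) / (1 - ?q) \<le> ?q ^ k / (1 - ?q)"
    using chain_ratio by (intro divide_right_mono) auto
  then show ?thesis using chaining[OF assms] by linarith
qed

section \<open>Exponential tails and the union bound over a grid\<close>

definition chain_const :: "nat \<Rightarrow> real" where
  "chain_const m = 2 * exp (real m) * 4 ^ m * fact (8 * m + 4)"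

lemma exp_ge_power_div_fact:
  fixes u :: real
  assumes "u \<ge> 0"
  shows "u ^ N / fact N \<le> exp u"
proof -
  have "(\<Sum>n\<in>{N}. u ^ n /\<^sub>R fact n) \<le> (\<Sum>n. u ^ n /\<^sub>R fact n)"
    by (rule sum_le_suminf[OF summable_exp_generic]) (use assms in auto)
  then show ?thesis by (simp add: exp_def field_simps)
qed

text \<open>With \<open>u = (1 / chain_ratio) ^ r\<close> one has \<open>u ^ 4 = 2 ^ r\<close>. In
  \<open>exp (- u) \<le> fact N / u ^ N\<close> the choice
  \<open>N = 8 * m + 4 = 4 * (2 * m + 1)\<close> makes the denominator
  \<open>(2 ^ r) ^ (2 * m + 1)\<close>, which absorbs the number of pairs and leaves one factor
  \<open>2 ^ r\<close>. The factor \<open>4 ^ m\<close> in \<open>chain_const\<close> comes from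
  \<open>2 ^ r + 1 \<le> 2 * 2 ^ r\<close>.\<close>

lemma chain_union_bound:
  "((2 ^ r + 1) ^ m)\<^sup>2 * (2 * exp (real m - (1 / chain_ratio) ^ r)) \<le> chain_const m / 2 ^ r"
proof -
  let ?q = chain_ratio
  define u where "u = (1 / ?q) ^ r"
  have u: "u > 0" using chain_ratio by (simp add: u_def)
  have "u ^ 4 = 1 / (?q ^ 4) ^ r" by (simp add: u_def power_divide power_mult[symmetric] mult.commute)
  also have "\<dots> = 2 ^ r" by (simp add: chain_ratio power_divide)
  finally have u4: "u ^ 4 = 2 ^ r" .
  have uN: "u ^ (8 * m + 4) = (2 ^ r) ^ (2 * m + 1)"
  proof -
    have "8 * m + 4 = 4 * (2 * m + 1)" by simp
    then have "u ^ (8 * m + 4) = (u ^ 4) ^ (2 * m + 1)" by (simp only: power_mult)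
    then show ?thesis unfolding u4 .
  qed
  have "exp (- u) \<le> fact (8 * m + 4) / u ^ (8 * m + 4)"
  proof -
    have "u ^ (8 * m + 4) / fact (8 * m + 4) \<le> exp u" by (rule exp_ge_power_div_fact) (use u in simp)
    then have "1 / exp u \<le> 1 / (u ^ (8 * m + 4) / fact (8 * m + 4))"
      using u by (intro divide_left_mono) auto
    then show ?thesis by (simp add: exp_minus inverse_eq_divide)
  qed
  also have "\<dots> = fact (8 * m + 4) / ((2 ^ r) ^ (2 * m) * 2 ^ r)" unfolding uN by simp
  finally have e: "exp (- u) \<le> fact (8 * m + 4) / ((2 ^ r) ^ (2 * m) * 2 ^ r)" .
  have "(2 ^ r + 1 :: real) \<le> 2 * 2 ^ r" by simp
  then have "((2 ^ r + 1) ^ m)\<^sup>2 \<le> ((2 * 2 ^ r) ^ m :: real)\<^sup>2" by (intro power_mono) auto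
  also have "\<dots> = 4 ^ m * (2 ^ r) ^ (2 * m)"
  proof -
    have "((2 * a) ^ m)\<^sup>2 = (2\<^sup>2) ^ m * a ^ (2 * m)" for a :: real
      unfolding power_mult_distrib power_mult[symmetric] by (simp only: mult.commute)
    then show ?thesis by simp
  qed
  finally have "((2 ^ r + 1) ^ m)\<^sup>2 * (2 * (exp (real m) * exp (- u))) \<le>
      (4 ^ m * (2 ^ r) ^ (2 * m)) * (2 * (exp (real m) * (fact (8 * m + 4) / ((2 ^ r) ^ (2 * m) * 2 ^ r))))"
    using e by (intro mult_mono mult_left_mono) auto
  also have "\<dots> = chain_const m / 2 ^ r" by (simp add: chain_const_def field_simps)
  finally show ?thesis by (simp add: exp_diff exp_minus u_def divide_inverse)
qed

text \<open>Chernoff's bound on both sides, \<open>b\<close> bounding the logarithms of the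
  exponential moments at \<open>l\<close> and \<open>- l\<close>.\<close>

lemma (in prob_space) mgf_tail:
  assumes [measurable]: "Y \<in> borel_measurable M" and l: "l > 0"
    and int: "integrable M (\<lambda>\<omega>. exp (l * Y \<omega>))" "integrable M (\<lambda>\<omega>. exp (- l * Y \<omega>))"
    and le: "expectation (\<lambda>\<omega>. exp (l * Y \<omega>)) \<le> exp b" "expectation (\<lambda>\<omega>. exp (- l * Y \<omega>)) \<le> exp b"
  shows "prob {\<omega> \<in> space M. \<bar>Y \<omega>\<bar> > t} \<le> 2 * exp (b - l * t)"
proof -
  have half: "prob {\<omega> \<in> space M. Z \<omega> \<ge> t} \<le> exp (b - l * t)"
    if "Z \<in> borel_measurable M" "integrable M (\<lambda>\<omega>. exp (l * Z \<omega>))" "expectation (\<lambda>\<omega>. exp (l * Z \<omega>)) \<le> exp b" for Z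
  proof -
    have "{\<omega> \<in> space M. Z \<omega> \<ge> t} = {\<omega> \<in> space M. exp (l * Z \<omega>) \<ge> exp (l * t)}" using l by auto
    then have "prob {\<omega> \<in> space M. Z \<omega> \<ge> t} \<le> expectation (\<lambda>\<omega>. exp (l * Z \<omega>)) / exp (l * t)"
      using integral_Markov_inequality_measure[of M "\<lambda>\<omega>. exp (l * Z \<omega>)" "space M" "exp (l * t)"] that by auto
    also have "\<dots> \<le> exp b / exp (l * t)" using that by (intro divide_right_mono) auto
    finally show ?thesis by (simp add: exp_diff)
  qed
  have "prob {\<omega> \<in> space M. \<bar>Y \<omega>\<bar> > t} \<le> prob ({\<omega> \<in> space M. Y \<omega> \<ge> t} \<union> {\<omega> \<in> space M. - Y \<omega> \<ge> t})"
    by (intro finite_measure_mono) auto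
  also have "\<dots> \<le> prob {\<omega> \<in> space M. Y \<omega> \<ge> t} + prob {\<omega> \<in> space M. - Y \<omega> \<ge> t}"
    by (intro measure_Un_le) auto
  also have "\<dots> \<le> exp (b - l * t) + exp (b - l * t)"
    using half[of Y] half[of "\<lambda>\<omega>. - Y \<omega>"] int le by (intro add_mono) auto
  finally show ?thesis by simp
qed

lemma (in prob_space) small_increments_prob:
  fixes G :: "'a \<Rightarrow> real^'m::finite \<Rightarrow> real"
  assumes meas: "\<And>y. y \<in> dyadic_grid r \<Longrightarrow> (\<lambda>\<omega>. G \<omega> y) \<in> borel_measurable M"
    and tail: "\<And>y z. y \<in> dyadic_grid r \<Longrightarrow> z \<in> dyadic_grid r \<Longrightarrow> dyadic_near r y z \<Longrightarrow>
      prob {\<omega> \<in> space M. \<bar>G \<omega> z - G \<omega> y\<bar> > chain_ratio ^ r} \<le> 2 * exp (real CARD('m) - (1 / chain_ratio) ^ r)"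
  shows "{\<omega> \<in> space M. \<not> small_increments r (chain_ratio ^ r) (G \<omega>)} \<in> events"
    and "prob {\<omega> \<in> space M. \<not> small_increments r (chain_ratio ^ r) (G \<omega>)} \<le> chain_const CARD('m) / 2 ^ r"
proof -
  let ?g = "dyadic_grid r :: (real^'m) set"
  let ?D = "{(y, z) \<in> ?g \<times> ?g. dyadic_near r y z}"
  let ?B = "\<lambda>(y, z). {\<omega> \<in> space M. \<bar>G \<omega> z - G \<omega> y\<bar> > chain_ratio ^ r}"
  have fin: "finite ?D" by (rule finite_subset[of _ "?g \<times> ?g"]) (auto simp: finite_dyadic_grid)
  have B: "?B p \<in> events" if "p \<in> ?D" for p
    using that meas by (auto simp: case_prod_beta)
  have eq: "{\<omega> \<in> space M. \<not> small_increments r (chain_ratio ^ r) (G \<omega>)} = (\<Union>p\<in>?D. ?B p)"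
    by (auto simp: small_increments_def not_le)
  show "{\<omega> \<in> space M. \<not> small_increments r (chain_ratio ^ r) (G \<omega>)} \<in> events"
    unfolding eq using fin B by (intro sets.finite_UN) auto
  have "prob (\<Union>p\<in>?D. ?B p) \<le> (\<Sum>p\<in>?D. prob (?B p))"
    using fin B by (intro finite_measure_subadditive_finite) auto
  also have "\<dots> \<le> (\<Sum>p\<in>?D. 2 * exp (real CARD('m) - (1 / chain_ratio) ^ r))"
    using tail by (intro sum_mono) auto
  also have "\<dots> = real (card ?D) * (2 * exp (real CARD('m) - (1 / chain_ratio) ^ r))" by simp
  also have "\<dots> \<le> ((2 ^ r + 1) ^ CARD('m))\<^sup>2 * (2 * exp (real CARD('m) - (1 / chain_ratio) ^ r))"
  proof (intro mult_right_mono)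
    have "card ?D \<le> card (?g \<times> ?g)" by (intro card_mono) (auto simp: finite_dyadic_grid)
    also have "\<dots> \<le> ((2 ^ r + 1) ^ CARD('m))\<^sup>2"
      unfolding card_cartesian_product power2_eq_square by (intro mult_mono card_dyadic_grid) auto
    finally have "real (card ?D) \<le> real (((2 ^ r + 1) ^ CARD('m))\<^sup>2)" by (simp only: of_nat_le_iff)
    then show "real (card ?D) \<le> ((2 ^ r + 1) ^ CARD('m))\<^sup>2" by (simp add: add.commute)
  qed auto
  also have "\<dots> \<le> chain_const CARD('m) / 2 ^ r" by (rule chain_union_bound)
  finally show "prob {\<omega> \<in> space M. \<not> small_increments r (chain_ratio ^ r) (G \<omega>)} \<le> chain_const CARD('m) / 2 ^ r"
    unfolding eq .
qed

lemma geometric_half_sum_le: "(\<Sum>r\<in>{k<..R}. c / 2 ^ r) \<le> c / 2 ^ k" if "c \<ge> (0::real)"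
proof (cases "k \<le> R")
  case True
  then have "(\<Sum>r\<in>{k<..R}. c / 2 ^ r) = c / 2 ^ k - c / 2 ^ R"
  proof (induction R rule: dec_induct)
    case (step R)
    have "{k<..Suc R} = insert (Suc R) {k<..R}" using step by auto
    then show ?case using step by simp
  qed simp
  then show ?thesis using that by simp
qed (use that in simp)

section \<open>The uniform empirical process\<close>

definition volume_below :: "real^'m::finite \<Rightarrow> real" where
  "volume_below x = (\<Prod>j\<in>UNIV. x $ j)"

definition below_indicator :: "real^'m::finite \<Rightarrow> real^'m \<Rightarrow> real" where
  "below_indicator x z = (\<Prod>j\<in>UNIV. of_bool (z $ j \<le> x $ j))"

definition bridge_kernel :: "real^'m::finite \<Rightarrow> real^'m \<Rightarrow> real" where
  "bridge_kernel x y = (\<Prod>j\<in>UNIV. min (x $ j) (y $ j)) - volume_below x * volume_below y"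

lemma below_indicator_eq: "below_indicator x z = of_bool (\<forall>j. z $ j \<le> x $ j)"
proof (cases "\<forall>j. z $ j \<le> x $ j")
  case False
  then show ?thesis by (auto simp: below_indicator_def intro!: prod_zero)
qed (simp add: below_indicator_def)

lemma volume_below_bounds:
  assumes "x \<in> cbox 0 1" shows "0 \<le> volume_below x" "volume_below x \<le> 1"
  using assms unfolding volume_below_def by (auto simp: mem_box_cart intro!: prod_nonneg prod_le_1)

lemma volume_below_diff_le:
  fixes x y :: "real^'m::finite"
  assumes "x \<in> cbox 0 1" "y \<in> cbox 0 1" and d: "\<And>j. \<bar>x $ j - y $ j\<bar> \<le> d"
  shows "\<bar>volume_below x - volume_below y\<bar> \<le> real CARD('m) * d"
proof -
  have "\<bar>volume_below x - volume_below y\<bar> \<le> (\<Sum>j\<in>UNIV. \<bar>x $ j - y $ j\<bar>)"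
    using norm_prod_diff[of UNIV "\<lambda>i. x $ i" "\<lambda>i. y $ i"] assms(1,2) by (auto simp: volume_below_def mem_box_cart)
  also have "\<dots> \<le> (\<Sum>j\<in>(UNIV::'m set). d)" by (intro sum_mono d)
  finally show ?thesis by simp
qed

lemma below_indicator_measurable [measurable]: "below_indicator x \<in> borel_measurable borel"
proof -
  have [measurable]: "(\<lambda>z :: real^'m. z $ j) \<in> borel_measurable borel" for j
    by (intro borel_measurable_continuous_onI continuous_intros)
  show ?thesis unfolding below_indicator_def by measurable
qed

lemma exp_le_quadratic: "\<bar>s\<bar> \<le> 1 \<Longrightarrow> exp s \<le> 1 + s + s\<^sup>2" for s :: real
proof (cases "s \<ge> 0")
  case False
  define u where "u = - s"
  have u: "u > 0" using False by (simp add: u_def)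
  have "exp s = 1 / exp u" by (simp add: u_def exp_minus inverse_eq_divide)
  also have "\<dots> \<le> 1 / (1 + u)" using exp_ge_add_one_self[of u] u by (intro divide_left_mono) auto
  also have "\<dots> \<le> 1 - u + u\<^sup>2"
  proof -
    have "(1 - u + u\<^sup>2) * (1 + u) = 1 + u ^ 3" by (simp add: algebra_simps power2_eq_square power3_eq_cube)
    then have "1 \<le> (1 - u + u\<^sup>2) * (1 + u)" using u by simp
    then show ?thesis using u by (simp add: pos_divide_le_eq)
  qed
  finally show ?thesis by (simp add: u_def)
qed (use exp_bound[of s] in auto)

text \<open>The sample is numbered from 1, the sequence in the central limit theorem from 0.\<close>

lemma (in prob_space) indep_vars_Suc:
  assumes "indep_vars M' X {1..}"
  shows "indep_vars (\<lambda>i. M' (Suc i)) (\<lambda>i. X (Suc i)) UNIV"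
  unfolding indep_vars_def2 indep_sets_def
proof (intro conjI ballI allI impI)
  have X: "\<And>i. i \<ge> 1 \<Longrightarrow> random_variable (M' i) (X i)"
    "\<And>J A. J \<subseteq> {1..} \<Longrightarrow> J \<noteq> {} \<Longrightarrow> finite J \<Longrightarrow> A \<in> Pi J (\<lambda>i. {X i -` A \<inter> space M |A. A \<in> sets (M' i)}) \<Longrightarrow>
        prob (\<Inter>j\<in>J. A j) = (\<Prod>j\<in>J. prob (A j))"
    using assms unfolding indep_vars_def2 indep_sets_def by auto
  show "random_variable (M' (Suc i)) (X (Suc i))" for i using X(1) by simp
  then show "{X (Suc i) -` A \<inter> space M |A. A \<in> sets (M' (Suc i))} \<subseteq> events" for i
    by (auto intro: measurable_sets)
  fix J A assume J: "J \<noteq> {}" "finite J" "A \<in> Pi J (\<lambda>i. {X (Suc i) -` A \<inter> space M |A. A \<in> sets (M' (Suc i))})"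
  have "prob (\<Inter>j\<in>Suc ` J. A (j - 1)) = (\<Prod>j\<in>Suc ` J. prob (A (j - 1)))"
    by (rule X(2)) (use J in \<open>auto simp: Pi_iff\<close>)
  then show "prob (\<Inter>j\<in>J. A j) = (\<Prod>j\<in>J. prob (A j))" by (simp add: prod.reindex)
qed

locale uniform_sample = prob_space P for P :: "'w measure" +
  fixes X :: "nat \<Rightarrow> 'w \<Rightarrow> real^'m::finite"
  assumes indep: "indep_vars (\<lambda>_. borel) X {1..}"
    and unif: "\<And>i. i \<ge> 1 \<Longrightarrow> distr P borel (X i) = uniform_measure lborel (cbox 0 1)"
begin

definition bridge :: "nat \<Rightarrow> 'w \<Rightarrow> real^'m \<Rightarrow> real" where
  "bridge n \<omega> x = sqrt (real n) * (emp_cdf X n \<omega> x - volume_below x)"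

lemma X_measurable: "i \<ge> 1 \<Longrightarrow> X i \<in> borel_measurable P"
  using indep by (auto simp: indep_vars_def)

lemma expectation_below_indicator:
  assumes i: "i \<ge> 1" and x: "x \<in> cbox 0 1"
  shows "expectation (\<lambda>\<omega>. below_indicator x (X i \<omega>)) = volume_below x"
proof -
  have eq: "below_indicator x = indicator {z. \<forall>j. z $ j \<le> x $ j}"
    by (auto simp: below_indicator_eq fun_eq_iff indicator_def)
  have S: "{z. \<forall>j. z $ j \<le> x $ j} \<in> sets borel"
    using borel_measurable_indicator_iff[of "{z. \<forall>j. z $ j \<le> x $ j}" borel] below_indicator_measurable[of x]
    by (simp add: eq)
  have "cbox 0 (1::real^'m) \<noteq> {}" using x by blast
  then have cube': "measure lborel (cbox 0 (1::real^'m)) = 1" by (simp add: content_cbox_cart)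
  then have cube: "emeasure lborel (cbox 0 (1::real^'m)) = 1"
    using emeasure_eq_ennreal_measure[of lborel "cbox 0 (1::real^'m)"] emeasure_lborel_cbox_finite[of 0 "1::real^'m"] by simp
  have box: "cbox 0 1 \<inter> {z. \<forall>j. z $ j \<le> x $ j} = cbox 0 x"
    using x unfolding set_eq_iff Int_iff mem_box_cart mem_Collect_eq by (meson order_trans)
  have "cbox 0 x \<noteq> {}" using x by (auto simp: interval_ne_empty_cart mem_box_cart)
  then have content: "measure lborel (cbox 0 x) = volume_below x"
    by (simp add: content_cbox_cart volume_below_def)
  have "expectation (\<lambda>\<omega>. below_indicator x (X i \<omega>)) = (\<integral>z. below_indicator x z \<partial>distr P borel (X i))"
    using X_measurable[OF i] by (simp add: integral_distr)
  also have "\<dots> = measure (uniform_measure lborel (cbox 0 1)) {z. \<forall>j. z $ j \<le> x $ j}"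
    unfolding unif[OF i] eq by simp
  also have "\<dots> = measure lborel (cbox 0 x)"
    using S by (simp add: measure_uniform_measure cube cube' box)
  finally show ?thesis by (simp add: content)
qed

lemma below_indicator_integrable: "i \<ge> 1 \<Longrightarrow> integrable P (\<lambda>\<omega>. below_indicator x (X i \<omega>))"
  using X_measurable by (intro integrable_const_bound[where B = 1]) (auto simp: below_indicator_eq intro: measurable_compose)

lemma below_indicator_mult:
  "below_indicator x z * below_indicator y z = below_indicator (\<chi> j. min (x $ j) (y $ j)) z"
  by (auto simp: below_indicator_eq)

lemma expectation_below_indicator_mult:
  assumes i: "i \<ge> 1" and x: "x \<in> cbox 0 1" and y: "y \<in> cbox 0 1"
  shows "expectation (\<lambda>\<omega>. below_indicator x (X i \<omega>) * below_indicator y (X i \<omega>)) = (\<Prod>j\<in>UNIV. min (x $ j) (y $ j))"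
proof -
  have "(\<chi> j. min (x $ j) (y $ j)) \<in> cbox 0 1" using x y by (auto simp: mem_box_cart min_le_iff_disj)
  from expectation_below_indicator[OF i this] show ?thesis
    by (simp add: below_indicator_mult volume_below_def)
qed

lemma bridge_eq_sum: "bridge n \<omega> x = (\<Sum>i=1..n. below_indicator x (X i \<omega>) - volume_below x) / sqrt (real n)"
proof (cases "n = 0")
  case False
  then have n: "sqrt (real n) > 0" by simp
  have emp: "emp_cdf X n \<omega> x = (\<Sum>i=1..n. below_indicator x (X i \<omega>)) / real n"
    by (simp add: emp_cdf_def below_indicator_def)
  have "sqrt (real n) * (s / real n - v) = (s - real n * v) / sqrt (real n)" for s v
  proof -
    have "real n = sqrt (real n) * sqrt (real n)" by simp
    then show ?thesis using n False by (simp add: field_simps)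
  qed
  then show ?thesis by (simp add: bridge_def emp sum_subtractf)
qed (simp add: bridge_def)

lemma bridge_measurable: "(\<lambda>\<omega>. bridge n \<omega> x) \<in> borel_measurable P"
proof -
  have [measurable]: "(\<lambda>\<omega>. below_indicator x (X i \<omega>)) \<in> borel_measurable P" if "i \<in> {1..n}" for i
    using measurable_compose[OF X_measurable below_indicator_measurable] that by simp
  show ?thesis unfolding bridge_eq_sum by measurable
qed

text \<open>A variable with values 0 and 1 satisfies
  \<open>exp (s * g) = 1 + g * (exp s - 1)\<close>, and \<open>exp s \<le> 1 + s + s\<^sup>2\<close>
  is applied at \<open>s = l / sqrt n\<close>. This forces \<open>\<bar>l\<bar> \<le> sqrt n\<close>
  and thereby limits how fine a scale the chaining can reach.\<close>

lemma bernoulli_sum_mgf: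
  assumes [measurable]: "g \<in> borel_measurable borel" and g: "\<And>z. g z \<in> {0, 1 :: real}"
    and p: "\<And>i. i \<ge> 1 \<Longrightarrow> expectation (\<lambda>\<omega>. g (X i \<omega>)) = p"
    and n: "n \<ge> 1" and l: "\<bar>l\<bar> \<le> sqrt (real n)"
  shows "integrable P (\<lambda>\<omega>. exp (l * ((\<Sum>i=1..n. g (X i \<omega>) - p) / sqrt (real n))))"
    and "expectation (\<lambda>\<omega>. exp (l * ((\<Sum>i=1..n. g (X i \<omega>) - p) / sqrt (real n)))) \<le> exp (l\<^sup>2 * p)"
proof -
  define s where "s = l / sqrt (real n)"
  have s: "\<bar>s\<bar> \<le> 1" using l n by (simp add: s_def)
  have [measurable]: "X i \<in> borel_measurable P" if "i \<in> {1..n}" for i using X_measurable that by simp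
  have eq: "exp (l * ((\<Sum>i=1..n. g (X i \<omega>) - p) / sqrt (real n))) = (\<Prod>i\<in>{1..n}. exp (s * (g (X i \<omega>) - p)))" for \<omega>
    by (simp add: exp_sum[symmetric] s_def sum_distrib_left sum_divide_distrib)
  have g0: "0 \<le> g z" and g1: "g z \<le> 1" for z using g[of z] by auto
  have "indep_vars (\<lambda>_. borel) X {1..n}" by (rule indep_vars_subset[OF indep]) auto
  then have ind: "indep_vars (\<lambda>_. borel) (\<lambda>i \<omega>. exp (s * (g (X i \<omega>) - p))) {1..n}"
    by (rule indep_vars_compose2) measurable
  have gint: "integrable P (\<lambda>\<omega>. g (X i \<omega>))" if "i \<in> {1..n}" for i
    by (rule integrable_const_bound[where B = 1]) (use g0 g1 that in auto)
  have fac: "exp (s * (g z - p)) = exp (- s * p) * (1 + g z * (exp s - 1))" for z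
    using g[of z] by (auto simp: exp_diff exp_minus field_simps exp_add[symmetric])
  have int: "integrable P (\<lambda>\<omega>. exp (s * (g (X i \<omega>) - p)))" if "i \<in> {1..n}" for i
    unfolding fac using gint[OF that] by simp
  show "integrable P (\<lambda>\<omega>. exp (l * ((\<Sum>i=1..n. g (X i \<omega>) - p) / sqrt (real n))))"
    unfolding eq by (rule indep_vars_integrable[OF _ ind int]) auto
  have p0: "p \<ge> 0"
  proof -
    have "0 \<le> expectation (\<lambda>\<omega>. g (X 1 \<omega>))" using g0 by (intro Bochner_Integration.integral_nonneg)
    then show ?thesis using p[of 1] by simp
  qed
  have "expectation (\<lambda>\<omega>. exp (l * ((\<Sum>i=1..n. g (X i \<omega>) - p) / sqrt (real n)))) =
      (\<Prod>i\<in>{1..n}. expectation (\<lambda>\<omega>. exp (s * (g (X i \<omega>) - p))))"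
    unfolding eq by (rule indep_vars_lebesgue_integral[OF _ ind int]) auto
  also have "\<dots> \<le> (\<Prod>i\<in>{1..n}. exp (s\<^sup>2 * p))"
  proof (intro prod_mono conjI)
    fix i assume i: "i \<in> {1..n}"
    show "0 \<le> expectation (\<lambda>\<omega>. exp (s * (g (X i \<omega>) - p)))" by (intro Bochner_Integration.integral_nonneg) auto
    have "expectation (\<lambda>\<omega>. exp (s * (g (X i \<omega>) - p))) = exp (- s * p) * (1 + p * (exp s - 1))"
      unfolding fac using gint[OF i] p[of i] i by (simp add: prob_space)
    also have "\<dots> \<le> exp (- s * p) * exp (p * (exp s - 1))"
      by (intro mult_left_mono exp_ge_add_one_self) auto
    also have "\<dots> = exp (p * (exp s - 1 - s))" by (simp add: exp_add[symmetric] algebra_simps)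
    also have "\<dots> \<le> exp (p * s\<^sup>2)" using exp_le_quadratic[OF s] p0 by (simp add: mult_left_mono)
    finally show "expectation (\<lambda>\<omega>. exp (s * (g (X i \<omega>) - p))) \<le> exp (s\<^sup>2 * p)" by (simp add: mult.commute)
  qed
  also have "\<dots> = exp (real n * (s\<^sup>2 * p))" by (simp add: exp_of_nat_mult)
  also have "real n * (s\<^sup>2 * p) = l\<^sup>2 * p" using n by (simp add: s_def power_divide)
  finally show "expectation (\<lambda>\<omega>. exp (l * ((\<Sum>i=1..n. g (X i \<omega>) - p) / sqrt (real n)))) \<le> exp (l\<^sup>2 * p)" .
qed

lemma bridge_tail:
  assumes x: "x \<in> cbox 0 1" and t: "t \<ge> 0"
  shows "prob {\<omega> \<in> space P. \<bar>bridge n \<omega> x\<bar> > t} \<le> 2 * exp (1 - t)"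
proof (cases "n = 0")
  case True
  then show ?thesis using t by (simp add: bridge_def)
next
  case False
  then have n: "n \<ge> 1" by simp
  have g: "below_indicator x z \<in> {0, 1}" for z by (auto simp: below_indicator_eq of_bool_def)
  note mgf = bernoulli_sum_mgf[of "below_indicator x", OF below_indicator_measurable g expectation_below_indicator[OF _ x] n, folded bridge_eq_sum]
  have le: "exp (l\<^sup>2 * volume_below x) \<le> exp 1" if "\<bar>l\<bar> \<le> 1" for l
    using volume_below_bounds[OF x] that mult_mono[of "l\<^sup>2" 1 "volume_below x" 1] by (simp add: power_le_one_iff abs_square_le_1)
  have "prob {\<omega> \<in> space P. \<bar>bridge n \<omega> x\<bar> > t} \<le> 2 * exp (1 - 1 * t)"
  proof (rule mgf_tail[OF bridge_measurable])
    show "expectation (\<lambda>\<omega>. exp (1 * bridge n \<omega> x)) \<le> exp 1"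
      by (rule order_trans[OF mgf(2) le]) (use n in auto)
    show "expectation (\<lambda>\<omega>. exp (- 1 * bridge n \<omega> x)) \<le> exp 1"
      by (rule order_trans[OF mgf(2) le]) (use n in auto)
  qed (use mgf(1)[of 1] mgf(1)[of "-1"] n in auto)
  then show ?thesis by simp
qed

text \<open>The increment is a normalised sum of centred indicators of the difference of two nested
  boxes, with success probability at most \<open>CARD('m) / 2 ^ r\<close>. The parameter
  \<open>l\<close> of size \<open>2^(r/2)\<close> is admissible exactly because
  \<open>2 ^ r \<le> n\<close>.\<close>

lemma bridge_increment_tail:
  assumes y: "y \<in> cbox 0 1" and z: "z \<in> cbox 0 1" and near: "dyadic_near r y z" and n: "2 ^ r \<le> n"
  shows "prob {\<omega> \<in> space P. \<bar>bridge n \<omega> z - bridge n \<omega> y\<bar> > chain_ratio ^ r}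
    \<le> 2 * exp (real CARD('m) - (1 / chain_ratio) ^ r)"
proof -
  have n1: "n \<ge> 1" using n by (meson one_le_numeral one_le_power order_trans)
  define g where "g u = below_indicator z u - below_indicator y u" for u
  define p where "p = volume_below z - volume_below y"
  define l where "l = (1 / chain_ratio) ^ (2 * r)"
  have [measurable]: "g \<in> borel_measurable borel" unfolding g_def by measurable
  have g: "g u \<in> {0, 1}" for u
  proof -
    have "\<forall>j. y $ j \<le> z $ j" using near by (simp add: dyadic_near_def)
    then have "(\<forall>j. u $ j \<le> y $ j) \<Longrightarrow> (\<forall>j. u $ j \<le> z $ j)" by (meson order_trans)
    then show ?thesis unfolding g_def below_indicator_eq by (auto simp: of_bool_def)
  qed
  have Eg: "expectation (\<lambda>\<omega>. g (X i \<omega>)) = p" if "i \<ge> 1" for i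
    using that below_indicator_integrable expectation_below_indicator y z by (simp add: g_def p_def)
  have diff: "bridge n \<omega> z - bridge n \<omega> y = (\<Sum>i=1..n. g (X i \<omega>) - p) / sqrt (real n)" for \<omega>
    unfolding bridge_eq_sum diff_divide_distrib[symmetric] sum_subtractf[symmetric] by (simp add: g_def p_def algebra_simps)
  have "\<bar>p\<bar> \<le> real CARD('m) * (1 / 2 ^ r)"
    unfolding p_def by (rule volume_below_diff_le[OF z y]) (use near in \<open>auto simp: dyadic_near_def abs_le_iff algebra_simps\<close>)
  then have p: "p \<le> real CARD('m) / 2 ^ r" by simp
  have l0: "l > 0" using chain_ratio by (simp add: l_def)
  have l2: "l\<^sup>2 = 2 ^ r" unfolding l_def by (rule chain_rate(1))
  have "l\<^sup>2 \<le> real n" using n l2 by (metis of_nat_le_iff of_nat_numeral of_nat_power)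
  then have ln: "\<bar>l\<bar> \<le> sqrt (real n)" using l0 by (simp add: real_le_rsqrt)
  have "l\<^sup>2 * p \<le> l\<^sup>2 * (real CARD('m) / 2 ^ r)" using p by (intro mult_left_mono) auto
  then have b: "l\<^sup>2 * p \<le> real CARD('m)" by (simp add: l2)
  note mgf = bernoulli_sum_mgf[of g, OF _ g Eg n1, folded diff]
  have "prob {\<omega> \<in> space P. \<bar>bridge n \<omega> z - bridge n \<omega> y\<bar> > chain_ratio ^ r} \<le> 2 * exp (real CARD('m) - l * chain_ratio ^ r)"
  proof (rule mgf_tail)
    show "expectation (\<lambda>\<omega>. exp (l * (bridge n \<omega> z - bridge n \<omega> y))) \<le> exp (real CARD('m))"
    proof -
      have "expectation (\<lambda>\<omega>. exp (l * (bridge n \<omega> z - bridge n \<omega> y))) \<le> exp (l\<^sup>2 * p)"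
        by (rule mgf(2)) (use ln in auto)
      also have "\<dots> \<le> exp (real CARD('m))" using b by simp
      finally show ?thesis .
    qed
    show "expectation (\<lambda>\<omega>. exp (- l * (bridge n \<omega> z - bridge n \<omega> y))) \<le> exp (real CARD('m))"
    proof -
      have "expectation (\<lambda>\<omega>. exp (- l * (bridge n \<omega> z - bridge n \<omega> y))) \<le> exp ((- l)\<^sup>2 * p)"
        by (rule mgf(2)) (use ln in auto)
      also have "\<dots> \<le> exp (real CARD('m))" using b by simp
      finally show ?thesis .
    qed
    show "integrable P (\<lambda>\<omega>. exp (l * (bridge n \<omega> z - bridge n \<omega> y)))"
      "integrable P (\<lambda>\<omega>. exp (- l * (bridge n \<omega> z - bridge n \<omega> y)))"
      by (rule mgf(1); use ln in auto)+
  qed (use l0 bridge_measurable in auto)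
  also have "l * chain_ratio ^ r = (1 / chain_ratio) ^ r" unfolding l_def by (rule chain_rate(2))
  finally show ?thesis .
qed

end

text \<open>The first summand is the geometric series of the chain; \<open>1 + 2 * m\<close> is the
  cost of passing from the finest usable grid to an arbitrary point.\<close>

definition chain_error :: "nat \<Rightarrow> real" where
  "chain_error m = 1 / (1 - chain_ratio) + 1 + 2 * real m"

lemma chain_error_pos: "chain_error m > 0"
  using chain_ratio by (simp add: chain_error_def add_pos_pos add_pos_nonneg)

text \<open>Below the finest scale \<open>R\<close> monotonicity leaves a volume error of order
  \<open>sqrt n / 2 ^ R\<close>. As \<open>chain_ratio\<^sup>2 \<ge> 1 / 2\<close> and
  \<open>n\<close> is below \<open>2 ^ Suc R\<close>, this is at most
  \<open>2 * chain_ratio ^ R\<close>, of the same order as the chain.\<close>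

lemma sqrt_le_chain_ratio:
  assumes "n < 2 ^ Suc R"
  shows "sqrt (real n) \<le> 2 * 2 ^ R * chain_ratio ^ R"
proof (rule real_le_lsqrt)
  let ?q = chain_ratio
  have "(?q\<^sup>2)\<^sup>2 = 1 / 2" using chain_ratio(3) by (simp add: power_mult[symmetric])
  moreover have "?q\<^sup>2 \<le> 1" using chain_ratio by (simp add: power_le_one)
  ultimately have q2: "1 / 2 \<le> ?q\<^sup>2" by (metis mult_left_le power2_eq_square zero_le_power2)
  have "real n \<le> real (2 ^ Suc R)" using assms by (simp only: of_nat_le_iff)
  also have "\<dots> \<le> 4 * (4 * (1 / 2)) ^ R" by simp
  also have "\<dots> \<le> 4 * (4 * ?q\<^sup>2) ^ R" using q2 by (intro mult_left_mono power_mono) auto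
  also have "\<dots> = (2 * 2 ^ R * ?q ^ R)\<^sup>2"
  proof -
    have "(2 * 2 ^ R * a ^ R)\<^sup>2 = 4 * (4 * a\<^sup>2) ^ R" for a :: real
    proof -
      have "(2 ^ R :: real)\<^sup>2 = (2\<^sup>2) ^ R" by (simp only: power_mult[symmetric] mult.commute)
      then have "(2 ^ R :: real)\<^sup>2 = 4 ^ R" by simp
      moreover have "(a ^ R)\<^sup>2 = (a\<^sup>2) ^ R" by (simp add: power_mult[symmetric] mult.commute)
      ultimately show ?thesis by (simp add: power_mult_distrib)
    qed
    then show ?thesis by simp
  qed
  finally show "real n \<le> (2 * 2 ^ R * ?q ^ R)\<^sup>2" .
qed (use chain_ratio in auto)

context uniform_sample
begin

section \<open>Uniform closeness of the empirical bridge to its dyadic grid\<close>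

lemma emp_cdf_mono:
  assumes "\<And>j. x $ j \<le> y $ j"
  shows "emp_cdf X n \<omega> x \<le> emp_cdf X n \<omega> y"
  unfolding emp_cdf_def
proof (intro divide_right_mono sum_mono prod_mono conjI)
  fix i j show "of_bool (X i \<omega> $ j \<le> x $ j) \<le> (of_bool (X i \<omega> $ j \<le> y $ j) :: real)"
    using assms[of j] by (auto intro: order_trans)
qed auto

text \<open>The empirical part can only grow from \<open>x\<close> to \<open>y\<close>; a decrease
  of the bridge comes from the volume term alone.\<close>

lemma bridge_mono_error:
  assumes "\<And>j. x $ j \<le> y $ j" and d: "\<bar>volume_below y - volume_below x\<bar> \<le> d"
  shows "bridge n \<omega> x - bridge n \<omega> y \<le> sqrt (real n) * d"
proof -
  have "bridge n \<omega> x - bridge n \<omega> y =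
      sqrt (real n) * ((emp_cdf X n \<omega> x - emp_cdf X n \<omega> y) + (volume_below y - volume_below x))"
    by (simp add: bridge_def algebra_simps)
  also have "\<dots> \<le> sqrt (real n) * d"
    using emp_cdf_mono[of x y n \<omega>] assms by (intro mult_left_mono) auto
  finally show ?thesis .
qed

lemma bridge_near_floor:
  assumes x: "x \<in> cbox 0 1" and n: "n < 2 ^ Suc R"
    and small: "small_increments R (chain_ratio ^ R) (bridge n \<omega>)"
  shows "\<bar>bridge n \<omega> x - bridge n \<omega> (dyadic_floor R x)\<bar> \<le> (1 + 2 * real CARD('m)) * chain_ratio ^ R"
proof -
  define y where "y = dyadic_floor R x"
  \<comment> \<open>The upper corner of the cell of \<open>x\<close>, cut off at the faces of the
    cube. Thus \<open>x\<close> lies between the grid points \<open>y\<close> and \<open>z\<close>,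
    which bound the bridge at \<open>x\<close> from below and above up to volume errors.\<close>
  define z where "z = (\<chi> j. min 1 (y $ j + 1 / 2 ^ R))"
  have y: "y \<in> dyadic_grid R" unfolding y_def by (rule dyadic_floor_in_grid[OF x])
  have z: "z \<in> dyadic_grid R"
    unfolding dyadic_grid_iff
  proof
    fix j
    obtain c :: int where c: "0 \<le> c" "c \<le> 2 ^ R" "y $ j = of_int c / 2 ^ R"
      using y unfolding dyadic_grid_iff by blast
    show "\<exists>c::int. 0 \<le> c \<and> c \<le> 2 ^ R \<and> z $ j = of_int c / 2 ^ R"
    proof (cases "c = 2 ^ R")
      case True
      then show ?thesis using c by (intro exI[of _ c]) (simp add: z_def)
    next
      case False
      then have "c + 1 \<le> 2 ^ R" using c by simp
      then have "of_int (c + 1) \<le> (of_int (2 ^ R) :: real)" by (simp only: of_int_le_iff)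
      then have "z $ j = of_int (c + 1) / 2 ^ R" by (simp add: z_def c min_def field_simps)
      then show ?thesis using c \<open>c + 1 \<le> 2 ^ R\<close> by (intro exI[of _ "c + 1"]) auto
    qed
  qed
  have yc: "y \<in> cbox 0 1" and zc: "z \<in> cbox 0 1" using y z dyadic_grid_subset_cube by auto
  have xj: "x $ j \<le> 1" "y $ j \<le> 1" for j using x yc by (auto simp: mem_box_cart)
  have yx: "y $ j \<le> x $ j" "x $ j \<le> y $ j + 1 / 2 ^ R" for j
    using dyadic_floor_bounds(1)[where k = R and x = x and j = j] dyadic_floor_bounds(2)[where k = R and x = x and j = j]
    by (auto simp: y_def)
  have xz: "x $ j \<le> z $ j" "z $ j \<le> x $ j + 1 / 2 ^ R" for j
    using yx[of j] xj[of j] by (auto simp: z_def min_def)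
  have near: "dyadic_near R y z" using xj by (auto simp: dyadic_near_def z_def min_def)
  have "bridge n \<omega> y - bridge n \<omega> x \<le> sqrt (real n) * (real CARD('m) * (1 / 2 ^ R))"
    using yx by (intro bridge_mono_error volume_below_diff_le x yc) (auto simp: abs_le_iff algebra_simps)
  moreover have "bridge n \<omega> x - bridge n \<omega> z \<le> sqrt (real n) * (real CARD('m) * (1 / 2 ^ R))"
    using xz by (intro bridge_mono_error volume_below_diff_le x zc) (auto simp: abs_le_iff algebra_simps)
  moreover have "\<bar>bridge n \<omega> z - bridge n \<omega> y\<bar> \<le> chain_ratio ^ R"
    using small y z near by (simp add: small_increments_def)
  moreover have "sqrt (real n) * (real CARD('m) * (1 / 2 ^ R)) \<le> 2 * real CARD('m) * chain_ratio ^ R"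
  proof -
    have "sqrt (real n) * (real CARD('m) * (1 / 2 ^ R)) \<le> (2 * 2 ^ R * chain_ratio ^ R) * (real CARD('m) * (1 / 2 ^ R))"
      by (intro mult_right_mono sqrt_le_chain_ratio n) auto
    also have "\<dots> = 2 * real CARD('m) * chain_ratio ^ R" by simp
    finally show ?thesis .
  qed
  moreover have "0 \<le> chain_ratio ^ R" using chain_ratio by simp
  ultimately have "\<bar>bridge n \<omega> x - bridge n \<omega> y\<bar> \<le> chain_ratio ^ R + 2 * real CARD('m) * chain_ratio ^ R" by linarith
  then show ?thesis by (simp add: y_def algebra_simps)
qed

text \<open>The supremum over all points of the cube is controlled on an event defined by finitely
  many grid values, so the measurability of that supremum never comes up. \<open>R\<close> is the
  finest scale with \<open>2 ^ R \<le> n\<close>.\<close>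

lemma bridge_sup_event:
  assumes n: "2 ^ k \<le> n"
  obtains G where "G \<in> events" "prob (space P - G) \<le> 2 * chain_const CARD('m) / 2 ^ k"
    "\<And>\<omega> x. \<omega> \<in> G \<Longrightarrow> x \<in> cbox 0 1 \<Longrightarrow>
       \<bar>bridge n \<omega> x - bridge n \<omega> (dyadic_floor k x)\<bar> \<le> chain_error CARD('m) * chain_ratio ^ k"
proof -
  let ?q = chain_ratio
  have "1 \<le> n" using n by (meson one_le_numeral one_le_power order_trans)
  then obtain R where R: "2 ^ R \<le> n" "n < 2 ^ Suc R"
    using ex_power_ivl1[of 2 n] by auto
  have "(2::nat) ^ k < 2 ^ Suc R" using n R by linarith
  then have "k < Suc R" by (simp add: power_strict_increasing_iff del: power_Suc)
  then have kR: "k \<le> R" by simp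
  define bad where "bad r = {\<omega> \<in> space P. \<not> small_increments r (?q ^ r) (bridge n \<omega>)}" for r
  have tail: "prob {\<omega> \<in> space P. \<bar>bridge n \<omega> z - bridge n \<omega> y\<bar> > ?q ^ r} \<le> 2 * exp (real CARD('m) - (1 / ?q) ^ r)"
    if "r \<le> R" "y \<in> dyadic_grid r" "z \<in> dyadic_grid r" "dyadic_near r y z" for r y z
  proof (rule bridge_increment_tail)
    have "(2::nat) ^ r \<le> 2 ^ R" using that by (intro power_increasing) auto
    then show "2 ^ r \<le> n" using R by linarith
  qed (use that dyadic_grid_subset_cube in auto)
  have bad: "bad r \<in> events" "prob (bad r) \<le> chain_const CARD('m) / 2 ^ r" if "r \<le> R" for r
    unfolding bad_def using small_increments_prob[OF bridge_measurable tail[OF that]] by auto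
  \<comment> \<open>Level \<open>k\<close> is included, although the chain uses only levels above
    it: for \<open>R = k\<close> the passage from the grid to \<open>x\<close> requires small
    increments at level \<open>k\<close>. This accounts for the factor 2 in the bound.\<close>
  define G where "G = space P - (\<Union>r\<in>{k..R}. bad r)"
  have UN: "(\<Union>r\<in>{k..R}. bad r) \<in> events" using bad by (intro sets.finite_UN) auto
  show thesis
  proof (rule that)
    show "G \<in> events" unfolding G_def using UN by (rule sets.compl_sets)
    have "space P - G = (\<Union>r\<in>{k..R}. bad r)" using sets.sets_into_space[OF UN] by (auto simp: G_def)
    then have "prob (space P - G) = prob (\<Union>r\<in>{k..R}. bad r)" by simp
    also have "\<dots> \<le> (\<Sum>r\<in>{k..R}. prob (bad r))"
      using bad by (intro finite_measure_subadditive_finite) auto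
    also have "\<dots> \<le> (\<Sum>r\<in>{k..R}. chain_const CARD('m) / 2 ^ r)" using bad by (intro sum_mono) auto
    also have "{k..R} = insert k {k<..R}" using kR by auto
    also have "(\<Sum>r\<in>insert k {k<..R}. chain_const CARD('m) / 2 ^ r) = chain_const CARD('m) / 2 ^ k + (\<Sum>r\<in>{k<..R}. chain_const CARD('m) / 2 ^ r)"
      by simp
    also have "\<dots> \<le> chain_const CARD('m) / 2 ^ k + chain_const CARD('m) / 2 ^ k"
      by (intro add_left_mono geometric_half_sum_le) (simp add: chain_const_def)
    finally show "prob (space P - G) \<le> 2 * chain_const CARD('m) / 2 ^ k" by simp
    fix \<omega> and x :: "real^'m" assume w: "\<omega> \<in> G" and x: "x \<in> cbox 0 1"
    have small: "small_increments r (?q ^ r) (bridge n \<omega>)" if "k \<le> r" "r \<le> R" for r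
      using w that by (auto simp: G_def bad_def)
    have 1: "\<bar>bridge n \<omega> (dyadic_floor R x) - bridge n \<omega> (dyadic_floor k x)\<bar> \<le> ?q ^ k / (1 - ?q)"
      by (rule chaining_le[OF x kR]) (use small in auto)
    have 2: "\<bar>bridge n \<omega> x - bridge n \<omega> (dyadic_floor R x)\<bar> \<le> (1 + 2 * real CARD('m)) * ?q ^ R"
      by (rule bridge_near_floor[OF x R(2) small]) (use kR in auto)
    have "?q ^ R \<le> ?q ^ k" using chain_ratio kR by (intro power_decreasing) auto
    then have "(1 + 2 * real CARD('m)) * ?q ^ R \<le> (1 + 2 * real CARD('m)) * ?q ^ k" by (intro mult_left_mono) auto
    then show "\<bar>bridge n \<omega> x - bridge n \<omega> (dyadic_floor k x)\<bar> \<le> chain_error CARD('m) * ?q ^ k"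
      using 1 2 by (simp add: chain_error_def algebra_simps)
  qed
qed

text \<open>The contribution of one observation to a linear combination of bridge values, which is
  therefore a normalised sum of independent identically distributed scores.\<close>

definition score :: "'a set \<Rightarrow> ('a \<Rightarrow> real) \<Rightarrow> ('a \<Rightarrow> real^'m) \<Rightarrow> real^'m \<Rightarrow> real" where
  "score A c p z = (\<Sum>a\<in>A. c a * (below_indicator (p a) z - volume_below (p a)))"

lemma score_measurable [measurable]: "score A c p \<in> borel_measurable borel"
  unfolding score_def by measurable

lemma score_bounded: "\<exists>B. \<forall>z. \<bar>score A c p z\<bar> \<le> B"
proof (intro exI allI)
  fix z
  have "\<bar>score A c p z\<bar> \<le> (\<Sum>a\<in>A. \<bar>c a * (below_indicator (p a) z - volume_below (p a))\<bar>)"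
    unfolding score_def by (rule sum_abs)
  also have "\<dots> \<le> (\<Sum>a\<in>A. \<bar>c a\<bar> * (1 + \<bar>volume_below (p a)\<bar>))"
  proof (rule sum_mono)
    fix a
    have "\<bar>below_indicator (p a) z - volume_below (p a)\<bar> \<le> 1 + \<bar>volume_below (p a)\<bar>"
      by (auto simp: below_indicator_eq of_bool_def)
    then show "\<bar>c a * (below_indicator (p a) z - volume_below (p a))\<bar> \<le> \<bar>c a\<bar> * (1 + \<bar>volume_below (p a)\<bar>)"
      unfolding abs_mult by (intro mult_left_mono) auto
  qed
  finally show "\<bar>score A c p z\<bar> \<le> (\<Sum>a\<in>A. \<bar>c a\<bar> * (1 + \<bar>volume_below (p a)\<bar>))" .
qed

lemma score_integrable:
  assumes i: "i \<ge> 1"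
  shows "integrable P (\<lambda>\<omega>. score A c p (X i \<omega>))" "integrable P (\<lambda>\<omega>. (score A c p (X i \<omega>))\<^sup>2)"
proof -
  have [measurable]: "X i \<in> borel_measurable P" by (rule X_measurable[OF i])
  obtain B where B: "\<And>z. \<bar>score A c p z\<bar> \<le> B" using score_bounded by blast
  show "integrable P (\<lambda>\<omega>. score A c p (X i \<omega>))"
    by (rule integrable_const_bound[where B = B]) (use B in auto)
  have "(score A c p z)\<^sup>2 \<le> B\<^sup>2" for z using B[of z] by (simp add: abs_le_square_iff[symmetric])
  then show "integrable P (\<lambda>\<omega>. (score A c p (X i \<omega>))\<^sup>2)"
    by (intro integrable_const_bound[where B = "B\<^sup>2"]) auto
qed

lemma score_moments:
  assumes i: "i \<ge> 1" and p: "\<And>a. a \<in> A \<Longrightarrow> p a \<in> cbox 0 1"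
  shows "expectation (\<lambda>\<omega>. score A c p (X i \<omega>)) = 0"
    and "expectation (\<lambda>\<omega>. (score A c p (X i \<omega>))\<^sup>2) = (\<Sum>a\<in>A. \<Sum>b\<in>A. c a * c b * bridge_kernel (p a) (p b))"
proof -
  note int = below_indicator_integrable[OF i]
  have int2: "integrable P (\<lambda>\<omega>. below_indicator x (X i \<omega>) * below_indicator y (X i \<omega>))" for x y
    unfolding below_indicator_mult by (rule int)
  show "expectation (\<lambda>\<omega>. score A c p (X i \<omega>)) = 0"
    unfolding score_def using int p expectation_below_indicator[OF i]
    by (subst Bochner_Integration.integral_sum) (auto simp: prob_space)
  have prod: "(below_indicator x (X i \<omega>) - volume_below x) * (below_indicator y (X i \<omega>) - volume_below y) =
      below_indicator x (X i \<omega>) * below_indicator y (X i \<omega>) - volume_below y * below_indicator x (X i \<omega>)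
      - volume_below x * below_indicator y (X i \<omega>) + volume_below x * volume_below y" for x y \<omega>
    by (simp add: algebra_simps)
  have cov: "expectation (\<lambda>\<omega>. (below_indicator x (X i \<omega>) - volume_below x) * (below_indicator y (X i \<omega>) - volume_below y)) = bridge_kernel x y"
    and cint: "integrable P (\<lambda>\<omega>. (below_indicator x (X i \<omega>) - volume_below x) * (below_indicator y (X i \<omega>) - volume_below y))"
    if "x \<in> cbox 0 1" "y \<in> cbox 0 1" for x y
    unfolding prod using int int2 expectation_below_indicator[OF i] expectation_below_indicator_mult[OF i] that
    by (simp_all add: prob_space bridge_kernel_def)
  have sq: "(score A c p (X i \<omega>))\<^sup>2 = (\<Sum>a\<in>A. \<Sum>b\<in>A. c a * c b *
      ((below_indicator (p a) (X i \<omega>) - volume_below (p a)) * (below_indicator (p b) (X i \<omega>) - volume_below (p b))))" for \<omega>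
    unfolding score_def power2_eq_square sum_product by (intro sum.cong refl) (simp add: ac_simps)
  show "expectation (\<lambda>\<omega>. (score A c p (X i \<omega>))\<^sup>2) = (\<Sum>a\<in>A. \<Sum>b\<in>A. c a * c b * bridge_kernel (p a) (p b))"
    unfolding sq using cint cov p
    by (subst Bochner_Integration.integral_sum)
       (auto intro!: sum.cong Bochner_Integration.integrable_sum integrable_mult_right simp: Bochner_Integration.integral_sum)
qed

text \<open>The quadratic form is the second moment of a score.\<close>

lemma bridge_kernel_sum_nonneg:
  assumes "\<And>a. a \<in> A \<Longrightarrow> p a \<in> cbox 0 (1::real^'m)"
  shows "0 \<le> (\<Sum>a\<in>A. \<Sum>b\<in>A. c a * c b * bridge_kernel (p a) (p b))"
proof -
  have "0 \<le> expectation (\<lambda>\<omega>. (score A c p (X 1 \<omega>))\<^sup>2)" by simp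
  then show ?thesis using score_moments(2)[of 1 A p c, OF order_refl assms] by linarith
qed

lemma bridge_combination_eq: "(\<Sum>a\<in>A. c a * bridge n \<omega> (p a)) = (\<Sum>i=1..n. score A c p (X i \<omega>)) / sqrt (real n)"
proof -
  have "(\<Sum>a\<in>A. c a * bridge n \<omega> (p a)) =
      (\<Sum>a\<in>A. \<Sum>i=1..n. c a * (below_indicator (p a) (X i \<omega>) - volume_below (p a)) / sqrt (real n))"
    unfolding bridge_eq_sum by (simp add: sum_distrib_left sum_divide_distrib)
  also have "\<dots> = (\<Sum>i=1..n. score A c p (X i \<omega>)) / sqrt (real n)"
    unfolding score_def by (subst sum.swap) (simp add: sum_divide_distrib)
  finally show ?thesis .
qed

text \<open>The central limit theorem asks for positive variance. For \<open>v = 0\<close> the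
  scores vanish almost surely, so every expectation already equals the limit
  \<open>cos b\<close>.\<close>

lemma bridge_clt:
  fixes p :: "'a \<Rightarrow> real^'m" and c :: "'a \<Rightarrow> real"
  assumes p: "\<And>a. a \<in> A \<Longrightarrow> p a \<in> cbox 0 1"
  defines "v \<equiv> \<Sum>a\<in>A. \<Sum>b\<in>A. c a * c b * bridge_kernel (p a) (p b)"
  shows "(\<lambda>n. expectation (\<lambda>\<omega>. cos ((\<Sum>a\<in>A. c a * bridge n \<omega> (p a)) + b)))
    \<longlonglongrightarrow> (\<integral>z. cos (sqrt v * z + b) \<partial>std_normal_distribution)"
proof (cases "v = 0")
  case True
  have zero: "AE \<omega> in P. score A c p (X i \<omega>) = 0" if i: "i \<ge> 1" for i
  proof -
    have "expectation (\<lambda>\<omega>. (score A c p (X i \<omega>))\<^sup>2) = 0"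
      using score_moments(2)[OF i p, where c = c] True by (simp add: v_def)
    moreover have "expectation (\<lambda>\<omega>. (score A c p (X i \<omega>))\<^sup>2) = 0 \<longleftrightarrow> (AE \<omega> in P. (score A c p (X i \<omega>))\<^sup>2 = 0)"
      by (rule integral_nonneg_eq_0_iff_AE[OF score_integrable(2)[OF i]]) simp
    ultimately show ?thesis by simp
  qed
  have "expectation (\<lambda>\<omega>. cos ((\<Sum>a\<in>A. c a * bridge n \<omega> (p a)) + b)) = cos b" for n
  proof -
    have "AE \<omega> in P. \<forall>i\<in>{1..n}. score A c p (X i \<omega>) = 0"
      by (rule AE_finite_allI) (use zero in auto)
    then have ae: "AE \<omega> in P. cos ((\<Sum>a\<in>A. c a * bridge n \<omega> (p a)) + b) = cos b"
      by eventually_elim (simp add: bridge_combination_eq)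
    have "expectation (\<lambda>\<omega>. cos ((\<Sum>a\<in>A. c a * bridge n \<omega> (p a)) + b)) = expectation (\<lambda>\<omega>. cos b)"
      using bridge_measurable by (intro integral_cong_AE ae) auto
    then show ?thesis by (simp add: prob_space)
  qed
  moreover have "(\<integral>z. cos (sqrt v * z + b) \<partial>std_normal_distribution) = cos b"
  proof -
    interpret S: prob_space std_normal_distribution by (rule prob_space_normal_density) simp
    have "measure std_normal_distribution UNIV = 1" using S.prob_space by simp
    then show ?thesis by (simp add: True)
  qed
  ultimately show ?thesis by simp
next
  case False
  define Y where "Y i \<omega> = score A c p (X (Suc i) \<omega>)" for i \<omega>
  have v: "v > 0" using False bridge_kernel_sum_nonneg[of A p c] p by (simp add: v_def)
  have Xm [measurable]: "X (Suc i) \<in> borel_measurable P" for i by (rule X_measurable) simp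
  have "indep_vars (\<lambda>_. borel) Y UNIV"
    unfolding Y_def by (rule indep_vars_compose2[OF indep_vars_Suc[OF indep]]) measurable
  moreover have mean: "expectation (Y i) = 0" for i
    using score_moments(1)[of "Suc i" A p c] p by (simp add: Y_def[abs_def])
  moreover have "integrable P (\<lambda>\<omega>. (Y i \<omega>)\<^sup>2)" for i unfolding Y_def by (rule score_integrable(2)) simp
  moreover have "variance (Y i) = (sqrt v)\<^sup>2" for i
    using score_moments(2)[of "Suc i" A p c] p v by (simp add: mean) (simp add: Y_def v_def)
  moreover have "distr P borel (Y i) = distr (uniform_measure lborel (cbox 0 1)) borel (score A c p)" for i
  proof -
    have "distr P borel (Y i) = distr (distr P borel (X (Suc i))) borel (score A c p)"
      by (subst distr_distr) (auto simp: comp_def Y_def[abs_def])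
    then show ?thesis using unif[of "Suc i"] by simp
  qed
  ultimately have wc: "weak_conv_m (\<lambda>n. distr P borel (\<lambda>\<omega>. (\<Sum>i<n. Y i \<omega>) / sqrt (real n * (sqrt v)\<^sup>2))) std_normal_distribution"
    using v by (intro central_limit_theorem_zero_mean) auto
  have Ym [measurable]: "Y i \<in> borel_measurable P" for i unfolding Y_def by measurable
  let ?\<mu> = "\<lambda>n. distr P borel (\<lambda>\<omega>. (\<Sum>i<n. Y i \<omega>) / sqrt (real n * (sqrt v)\<^sup>2))"
  have "(\<lambda>n. \<integral>z. cos (sqrt v * z + b) \<partial>?\<mu> n) \<longlonglongrightarrow> (\<integral>z. cos (sqrt v * z + b) \<partial>std_normal_distribution)"
  proof (rule weak_conv_imp_integral_bdd_continuous_conv[OF _ _ wc, where B = 1])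
    show "real_distribution (?\<mu> n)" for n by (rule real_distribution_distr) measurable
    show "real_distribution std_normal_distribution" by (rule real_dist_normal_dist)
  qed (auto intro!: continuous_intros)
  moreover have "(\<integral>z. cos (sqrt v * z + b) \<partial>?\<mu> n) = expectation (\<lambda>\<omega>. cos ((\<Sum>a\<in>A. c a * bridge n \<omega> (p a)) + b))" for n
  proof -
    have "(\<Sum>i=1..n. score A c p (X i \<omega>)) = (\<Sum>i<n. Y i \<omega>)" for \<omega>
      unfolding Y_def by (rule sum.reindex_bij_witness[of _ Suc "\<lambda>i. i - 1"]) auto
    then have "sqrt v * ((\<Sum>i<n. Y i \<omega>) / sqrt (real n * (sqrt v)\<^sup>2)) = (\<Sum>a\<in>A. c a * bridge n \<omega> (p a))" for \<omega>
      unfolding bridge_combination_eq using v by (simp add: real_sqrt_mult)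
    then show ?thesis by (subst integral_distr) auto
  qed
  ultimately show ?thesis by simp
qed

end

section \<open>The limiting bridge\<close>

definition dyadics :: "(real^'m::finite) set" where
  "dyadics = (\<Union>k. dyadic_grid k)"

text \<open>A Cholesky factor of the kernel with rows indexed by dyadic points, each row of finite
  support. It is selected without reference to a sample; existence is proved where a sample is at
  hand.\<close>

definition bridge_factor :: "real^'m::finite \<Rightarrow> nat \<Rightarrow> real" where
  "bridge_factor = (SOME L. \<forall>x\<in>dyadics. \<exists>n0. (\<forall>l\<ge>n0. L x l = 0) \<and>
     (\<forall>y\<in>dyadics. \<forall>n\<ge>n0. bridge_kernel x y = (\<Sum>l<n. L x l * L y l)))"

text \<open>The coordinates used as Gaussian noise are indexed by the constant vectors with natural entries,
  so that the noise lives on the function space in which the limit has to be realised.\<close>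

definition noise_measure :: "(real^'m::finite \<Rightarrow> real) measure" where
  "noise_measure = PiM UNIV (\<lambda>_. std_normal_distribution)"

text \<open>Meaningful at dyadic points, where the support of the row is finite and the sum is a
  finite combination of independent normal variables.\<close>

definition dyadic_bridge :: "(real^'m::finite \<Rightarrow> real) \<Rightarrow> real^'m \<Rightarrow> real" where
  "dyadic_bridge \<omega> x = (\<Sum>l\<in>{l. bridge_factor x l \<noteq> 0}. bridge_factor x l * \<omega> (\<chi> j. real l))"

definition regular_noise :: "(real^'m::finite \<Rightarrow> real) \<Rightarrow> bool" where
  "regular_noise \<omega> \<longleftrightarrow> (\<exists>k0. \<forall>r\<ge>k0. small_increments r (chain_ratio ^ r) (dyadic_bridge \<omega>))"

text \<open>The default 0 off regular noise makes every path continuous on the cube, so that the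
  limit process takes values in the Skorohod space for all \<open>\<omega>\<close>.\<close>

definition limit_bridge :: "(real^'m::finite \<Rightarrow> real) \<Rightarrow> real^'m \<Rightarrow> real" where
  "limit_bridge \<omega> x = (if regular_noise \<omega> then lim (\<lambda>k. dyadic_bridge \<omega> (dyadic_floor k x)) else 0)"

lemma dyadic_grid_mono: "i \<le> k \<Longrightarrow> dyadic_grid i \<subseteq> dyadic_grid k"
  by (rule lift_Suc_mono_le[of dyadic_grid]) (use dyadic_grid_Suc in auto)

lemma dyadics_subset_cube: "dyadics \<subseteq> cbox 0 1"
  using dyadic_grid_subset_cube by (auto simp: dyadics_def)

lemma dyadic_floor_in_dyadics: "x \<in> cbox 0 1 \<Longrightarrow> dyadic_floor k x \<in> dyadics"
  using dyadic_floor_in_grid by (auto simp: dyadics_def)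

lemma dyadic_floor_tendsto: "(\<lambda>k. dyadic_floor k x) \<longlonglongrightarrow> x"
proof (rule vec_tendstoI)
  fix j
  have "(\<lambda>k. (1/2) ^ k :: real) \<longlonglongrightarrow> 0" by (rule LIMSEQ_realpow_zero) auto
  then have "(\<lambda>k. 1 / 2 ^ k :: real) \<longlonglongrightarrow> 0" by (simp add: power_divide)
  moreover have "\<forall>\<^sub>F k in sequentially. norm (dyadic_floor k x $ j - x $ j) \<le> 1 / 2 ^ k"
  proof (intro always_eventually allI)
    fix k
    show "norm (dyadic_floor k x $ j - x $ j) \<le> 1 / 2 ^ k"
      using dyadic_floor_bounds(1)[where k = k and x = x and j = j] dyadic_floor_bounds(2)[where k = k and x = x and j = j]
      by (simp add: abs_le_iff)
  qed
  ultimately have "(\<lambda>k. dyadic_floor k x $ j - x $ j) \<longlonglongrightarrow> 0" by (rule Lim_null_comparison[rotated])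
  then show "(\<lambda>k. dyadic_floor k x $ j) \<longlonglongrightarrow> x $ j" by (rule LIM_zero_cancel)
qed

lemma bridge_kernel_tendsto:
  assumes "f \<longlonglongrightarrow> x" "g \<longlonglongrightarrow> y"
  shows "(\<lambda>k. bridge_kernel (f k) (g k)) \<longlonglongrightarrow> bridge_kernel x y"
  unfolding bridge_kernel_def volume_below_def using assms by (intro tendsto_intros)

lemma bridge_kernel_commute: "bridge_kernel x y = bridge_kernel y x"
  by (simp add: bridge_kernel_def min.commute mult.commute)


section \<open>Continuous extension of a function with small dyadic increments\<close>

context
  fixes g :: "real^'m::finite \<Rightarrow> real" and k0 :: nat
  assumes small: "\<And>r. k0 \<le> r \<Longrightarrow> small_increments r (chain_ratio ^ r) g"
begin

lemma dyadic_extension_convergent: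
  assumes x: "x \<in> cbox 0 1"
  shows "convergent (\<lambda>k. g (dyadic_floor k x))"
proof (rule real_Cauchy_convergent, rule CauchyI)
  fix e :: real assume e: "e > 0"
  have "(\<lambda>k. chain_ratio ^ k / (1 - chain_ratio)) \<longlonglongrightarrow> 0 / (1 - chain_ratio)"
    using chain_ratio by (intro tendsto_divide LIMSEQ_realpow_zero) auto
  then have "\<forall>\<^sub>F k in sequentially. chain_ratio ^ k / (1 - chain_ratio) < e / 2"
    using e by (intro order_tendstoD) auto
  then obtain k1 where k1: "\<And>k. k \<ge> k1 \<Longrightarrow> chain_ratio ^ k / (1 - chain_ratio) < e / 2"
    by (auto simp: eventually_sequentially)
  define k where "k = max k0 k1"
  have *: "\<bar>g (dyadic_floor R x) - g (dyadic_floor k x)\<bar> < e / 2" if "R \<ge> k" for R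
  proof -
    have "\<bar>g (dyadic_floor R x) - g (dyadic_floor k x)\<bar> \<le> chain_ratio ^ k / (1 - chain_ratio)"
      by (rule chaining_le[OF x that]) (use small in \<open>auto simp: k_def\<close>)
    also have "\<dots> < e / 2" by (rule k1) (simp add: k_def)
    finally show ?thesis .
  qed
  show "\<exists>M. \<forall>i\<ge>M. \<forall>j\<ge>M. norm (g (dyadic_floor i x) - g (dyadic_floor j x)) < e"
  proof (intro exI[of _ k] allI impI)
    fix i j assume "i \<ge> k" "j \<ge> k"
    then show "norm (g (dyadic_floor i x) - g (dyadic_floor j x)) < e"
      using *[of i] *[of j] unfolding real_norm_def by linarith
  qed
qed

lemma dyadic_extension_close:
  assumes x: "x \<in> cbox 0 1" and k: "k0 \<le> k"
  shows "\<bar>lim (\<lambda>k. g (dyadic_floor k x)) - g (dyadic_floor k x)\<bar> \<le> chain_ratio ^ k / (1 - chain_ratio)"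
proof (rule tendsto_upperbound)
  show "((\<lambda>R. \<bar>g (dyadic_floor R x) - g (dyadic_floor k x)\<bar>) \<longlongrightarrow> \<bar>lim (\<lambda>k. g (dyadic_floor k x)) - g (dyadic_floor k x)\<bar>) sequentially"
    using dyadic_extension_convergent[OF x] by (intro tendsto_intros) (simp add: convergent_LIMSEQ_iff)
  show "\<forall>\<^sub>F R in sequentially. \<bar>g (dyadic_floor R x) - g (dyadic_floor k x)\<bar> \<le> chain_ratio ^ k / (1 - chain_ratio)"
    using eventually_ge_at_top[of k]
  proof eventually_elim
    case (elim R)
    show ?case by (rule chaining_le[OF x elim]) (use small k in auto)
  qed
qed simp

lemma dyadic_extension_continuous: "continuous_on (cbox 0 1) (\<lambda>x. lim (\<lambda>k. g (dyadic_floor k x)))"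
proof (rule uniformly_continuous_imp_continuous, unfold uniformly_continuous_on_def, intro allI impI)
  fix e :: real assume e: "e > 0"
  let ?q = chain_ratio
  let ?f = "\<lambda>x. lim (\<lambda>k. g (dyadic_floor k x))"
  have "(\<lambda>k. 2 * (?q ^ k / (1 - ?q)) + 2 * ?q ^ k) \<longlonglongrightarrow> 2 * (0 / (1 - ?q)) + 2 * 0"
    using chain_ratio by (intro tendsto_intros LIMSEQ_realpow_zero) auto
  then have "\<forall>\<^sub>F k in sequentially. 2 * (?q ^ k / (1 - ?q)) + 2 * ?q ^ k < e"
    using e by (intro order_tendstoD) auto
  then obtain k1 where k1: "\<And>k. k \<ge> k1 \<Longrightarrow> 2 * (?q ^ k / (1 - ?q)) + 2 * ?q ^ k < e"
    by (auto simp: eventually_sequentially)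
  define k where "k = max k0 k1"
  show "\<exists>d>0. \<forall>x\<in>cbox 0 1. \<forall>y\<in>cbox 0 1. dist y x < d \<longrightarrow> dist (?f y) (?f x) < e"
  proof (intro exI[of _ "1 / 2 ^ k"] conjI ballI impI)
    fix x y :: "real^'m" assume x: "x \<in> cbox 0 1" and y: "y \<in> cbox 0 1" and d: "dist y x < 1 / 2 ^ k"
    \<comment> \<open>The coordinatewise minimum of the two floors. For close \<open>x\<close> and
      \<open>y\<close> the floors differ by at most one step in each coordinate, so \<open>u\<close>
      is an ordered neighbour of both.\<close>
    define u where "u = dyadic_point k (\<chi> j. min \<lfloor>2 ^ k * x $ j\<rfloor> \<lfloor>2 ^ k * y $ j\<rfloor>)"
    have floors: "\<bar>\<lfloor>2 ^ k * x $ j\<rfloor> - \<lfloor>2 ^ k * y $ j\<rfloor>\<bar> \<le> 1" for j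
    proof -
      have "\<bar>(y - x) $ j\<bar> < 1 / 2 ^ k" using component_le_norm_cart[of "y - x" j] d by (simp add: dist_norm)
      then have "\<bar>x $ j - y $ j\<bar> < 1 / 2 ^ k" by (simp add: abs_minus_commute)
      then have "2 ^ k * \<bar>x $ j - y $ j\<bar> < 1" by (simp add: pos_less_divide_eq mult.commute)
      moreover have "\<bar>2 ^ k * x $ j - 2 ^ k * y $ j\<bar> = 2 ^ k * \<bar>x $ j - y $ j\<bar>"
        by (simp add: right_diff_distrib[symmetric] abs_mult)
      ultimately have "\<bar>2 ^ k * x $ j - 2 ^ k * y $ j\<bar> < 1" by simp
      then show ?thesis by linarith
    qed
    have bounds: "0 \<le> \<lfloor>2 ^ k * z $ j\<rfloor> \<and> \<lfloor>2 ^ k * z $ j\<rfloor> \<le> 2 ^ k" if z: "z \<in> cbox 0 1" for z :: "real^'m" and j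
    proof -
      have zj: "0 \<le> z $ j" "z $ j \<le> 1" using z by (auto simp: mem_box_cart)
      have "2 ^ k * z $ j \<le> of_int (2 ^ k)" using zj by (simp add: mult_left_le)
      then have "\<lfloor>2 ^ k * z $ j\<rfloor> \<le> 2 ^ k" by linarith
      then show ?thesis using zj by simp
    qed
    have u: "u \<in> dyadic_grid k"
      using bounds[OF x] bounds[OF y] by (auto simp: u_def dyadic_grid_def dyadic_index_def min_le_iff_disj)
    have near_z: "dyadic_near k u (dyadic_floor k z)" if "z = x \<or> z = y" for z
      unfolding dyadic_near_def
    proof
      fix j
      have "min \<lfloor>2 ^ k * x $ j\<rfloor> \<lfloor>2 ^ k * y $ j\<rfloor> \<le> \<lfloor>2 ^ k * z $ j\<rfloor>" "\<lfloor>2 ^ k * z $ j\<rfloor> \<le> min \<lfloor>2 ^ k * x $ j\<rfloor> \<lfloor>2 ^ k * y $ j\<rfloor> + 1"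
        using floors[of j] that by (auto simp: min_def)
      then have "of_int (min \<lfloor>2 ^ k * x $ j\<rfloor> \<lfloor>2 ^ k * y $ j\<rfloor>) \<le> (of_int \<lfloor>2 ^ k * z $ j\<rfloor> :: real)"
        "of_int \<lfloor>2 ^ k * z $ j\<rfloor> \<le> (of_int (min \<lfloor>2 ^ k * x $ j\<rfloor> \<lfloor>2 ^ k * y $ j\<rfloor> + 1) :: real)"
        by (simp_all only: of_int_le_iff)
      then show "u $ j \<le> dyadic_floor k z $ j \<and> dyadic_floor k z $ j \<le> u $ j + 1 / 2 ^ k"
        by (simp add: u_def dyadic_point_def dyadic_floor_nth add_divide_distrib[symmetric] divide_right_mono)
    qed
    have 1: "\<bar>g (dyadic_floor k z) - g u\<bar> \<le> ?q ^ k" if "z = x \<or> z = y" for z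
      using small[of k] near_z[OF that] u dyadic_floor_in_grid[OF x, of k] dyadic_floor_in_grid[OF y, of k] that
      by (auto simp: small_increments_def k_def)
    have 2: "\<bar>?f z - g (dyadic_floor k z)\<bar> \<le> ?q ^ k / (1 - ?q)" if "z = x \<or> z = y" for z
      by (rule dyadic_extension_close) (use that x y in \<open>auto simp: k_def\<close>)
    have "\<bar>?f y - ?f x\<bar> \<le> 2 * (?q ^ k / (1 - ?q)) + 2 * ?q ^ k"
      using 1[of x, OF disjI1[OF refl]] 1[of y, OF disjI2[OF refl]] 2[of x, OF disjI1[OF refl]] 2[of y, OF disjI2[OF refl]]
      by linarith
    also have "\<dots> < e" by (rule k1) (simp add: k_def)
    finally show "dist (?f y) (?f x) < e" by (simp add: dist_real_def)
  qed simp
qed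

end

lemma limit_bridge_grid:
  assumes "regular_noise \<omega>" and y: "y \<in> dyadic_grid k"
  shows "limit_bridge \<omega> y = dyadic_bridge \<omega> y"
proof -
  have "(\<lambda>i. dyadic_bridge \<omega> (dyadic_floor i y)) \<longlonglongrightarrow> dyadic_bridge \<omega> y"
  proof (rule tendsto_eventually)
    show "\<forall>\<^sub>F i in sequentially. dyadic_bridge \<omega> (dyadic_floor i y) = dyadic_bridge \<omega> y"
      using eventually_ge_at_top[of k]
    proof eventually_elim
      case (elim i)
      then have "y \<in> dyadic_grid i" using y dyadic_grid_mono by blast
      then show ?case by (simp add: dyadic_floor_grid)
    qed
  qed
  then show ?thesis using assms by (simp add: limit_bridge_def limI)
qed

lemma limit_bridge_continuous: "continuous_on (cbox 0 1) (limit_bridge \<omega>)"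
proof (cases "regular_noise \<omega>")
  case True
  then obtain k0 where "\<And>r. k0 \<le> r \<Longrightarrow> small_increments r (chain_ratio ^ r) (dyadic_bridge \<omega>)"
    by (auto simp: regular_noise_def)
  from dyadic_extension_continuous[OF this] True show ?thesis by (simp add: limit_bridge_def[abs_def])
qed (simp add: limit_bridge_def[abs_def])

lemma limit_bridge_floor_close:
  fixes \<omega> :: "real^'m::finite \<Rightarrow> real"
  shows "\<exists>k0. \<forall>k\<ge>k0. \<forall>x\<in>cbox 0 1. \<bar>limit_bridge \<omega> x - limit_bridge \<omega> (dyadic_floor k x)\<bar> \<le> chain_ratio ^ k / (1 - chain_ratio)"
proof (cases "regular_noise \<omega>")
  case True
  then obtain k0 where k0: "\<And>r. k0 \<le> r \<Longrightarrow> small_increments r (chain_ratio ^ r) (dyadic_bridge \<omega>)"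
    by (auto simp: regular_noise_def)
  show ?thesis
  proof (intro exI[of _ k0] allI impI ballI)
    fix k and x :: "real^'m" assume k: "k \<ge> k0" and x: "x \<in> cbox 0 1"
    show "\<bar>limit_bridge \<omega> x - limit_bridge \<omega> (dyadic_floor k x)\<bar> \<le> chain_ratio ^ k / (1 - chain_ratio)"
      using dyadic_extension_close[OF k0 x k] limit_bridge_grid[OF True dyadic_floor_in_grid[OF x, of k]] True
      by (simp add: limit_bridge_def)
  qed
qed (use chain_ratio in \<open>auto simp: limit_bridge_def\<close>)

section \<open>Measurability of the dyadic family and of the limit bridge\<close>

lemma prob_space_noise_measure: "prob_space noise_measure"
  unfolding noise_measure_def by (intro prob_space_PiM prob_space_normal_density) simp

lemma dyadic_bridge_measurable: "(\<lambda>\<omega>. dyadic_bridge \<omega> x) \<in> borel_measurable noise_measure"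
proof -
  have "(\<lambda>\<omega>. \<omega> i) \<in> borel_measurable noise_measure" for i :: "real^'m"
    using measurable_component_singleton[of i UNIV "\<lambda>_. std_normal_distribution"]
    by (simp add: noise_measure_def measurable_cong_sets[OF refl, of std_normal_distribution borel])
  then show ?thesis unfolding dyadic_bridge_def
    by (intro borel_measurable_sum borel_measurable_times borel_measurable_const)
qed

lemma regular_noise_sets:
  "{\<omega> \<in> space noise_measure. regular_noise \<omega>} \<in> sets noise_measure"
proof -
  have [measurable]: "(\<lambda>\<omega>. dyadic_bridge \<omega> x) \<in> borel_measurable noise_measure" for x :: "real^'m"
    by (rule dyadic_bridge_measurable)
  have "{\<omega> \<in> space noise_measure. \<forall>y\<in>dyadic_grid r. \<forall>z\<in>dyadic_grid r. dyadic_near r y z \<longrightarrow> \<bar>dyadic_bridge \<omega> z - dyadic_bridge \<omega> (y :: real^'m)\<bar> \<le> t} \<in> sets noise_measure" for r t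
    by (intro sets.sets_Collect_finite_All finite_dyadic_grid sets.sets_Collect_imp) measurable
  then show ?thesis unfolding regular_noise_def small_increments_def
    by (intro sets.sets_Collect_countable_Ex sets.sets_Collect_countable_All sets.sets_Collect_imp) auto
qed

lemma limit_bridge_measurable: "(\<lambda>\<omega>. limit_bridge \<omega> x) \<in> borel_measurable noise_measure"
  unfolding limit_bridge_def using regular_noise_sets
  by (intro measurable_If borel_measurable_lim_metric dyadic_bridge_measurable) auto

section \<open>Gaussian laws of the dyadic family and of the limit bridge\<close>

context uniform_sample
begin

text \<open>An enumeration of the dyadic points turns the kernel into one on the naturals, which has
  a triangular factor. Row \<open>i\<close> may reach column \<open>i\<close>, hence the threshold
  \<open>Suc\<close> of the index of \<open>x\<close>.\<close>

lemma bridge_factor: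
  assumes x: "x \<in> (dyadics :: (real^'m) set)"
  shows "\<exists>n0. (\<forall>l\<ge>n0. bridge_factor x l = 0) \<and>
     (\<forall>y\<in>dyadics. \<forall>n\<ge>n0. bridge_kernel x y = (\<Sum>l<n. bridge_factor x l * bridge_factor y l))"
proof -
  let ?D = "dyadics :: (real^'m) set"
  have cD: "countable ?D" unfolding dyadics_def
    by (intro countable_UN) (auto intro: countable_finite finite_dyadic_grid)
  have ne: "?D \<noteq> {}" using x by auto
  define p where "p = from_nat_into ?D"
  have p: "p i \<in> ?D" for i unfolding p_def by (rule from_nat_into[OF ne])
  have pc: "p i \<in> cbox 0 1" for i using p dyadics_subset_cube by (rule subsetD[rotated])
  have psd: "psd_kernel (\<lambda>i j. bridge_kernel (p i) (p j))"
    unfolding psd_kernel_def by (intro conjI allI impI bridge_kernel_commute bridge_kernel_sum_nonneg pc)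
  obtain L where "(\<forall>a l. a < l \<longrightarrow> L a l = 0) \<and> (\<forall>a b n. a < n \<longrightarrow> bridge_kernel (p a) (p b) = (\<Sum>l<n. L a l * L b l))"
    using psd_kernel_cholesky[OF psd] by (elim exE)
  then have L: "\<And>a l. a < l \<Longrightarrow> L a l = 0"
    "\<And>a b n. a < n \<Longrightarrow> bridge_kernel (p a) (p b) = (\<Sum>l<n. L a l * L b l)"
    by simp_all
  have inv: "p (to_nat_on ?D y) = y" if "y \<in> ?D" for y unfolding p_def using cD that by simp
  define Q where "Q L \<longleftrightarrow> (\<forall>x\<in>?D. \<exists>n0. (\<forall>l\<ge>n0. L x l = 0) \<and>
     (\<forall>y\<in>?D. \<forall>n\<ge>n0. bridge_kernel x y = (\<Sum>l<n. L x l * L y l)))" for L :: "real^'m \<Rightarrow> nat \<Rightarrow> real"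
  have "Q (\<lambda>x. L (to_nat_on ?D x))"
    unfolding Q_def
  proof
    fix x assume x: "x \<in> ?D"
    show "\<exists>n0. (\<forall>l\<ge>n0. L (to_nat_on ?D x) l = 0) \<and>
     (\<forall>y\<in>?D. \<forall>n\<ge>n0. bridge_kernel x y = (\<Sum>l<n. L (to_nat_on ?D x) l * L (to_nat_on ?D y) l))"
    proof (intro exI[of _ "Suc (to_nat_on ?D x)"] conjI ballI allI impI)
      fix y n assume "y \<in> ?D" "Suc (to_nat_on ?D x) \<le> n"
      then show "bridge_kernel x y = (\<Sum>l<n. L (to_nat_on ?D x) l * L (to_nat_on ?D y) l)"
        using L(2)[of "to_nat_on ?D x" n "to_nat_on ?D y"] inv x by simp
    qed (simp add: L(1))
  qed
  then have "Q (SOME L. Q L)" by (rule someI[of Q])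
  moreover have "bridge_factor = (SOME L. Q L)" unfolding bridge_factor_def Q_def ..
  ultimately have "Q bridge_factor" by simp
  then show ?thesis using x unfolding Q_def by (rule bspec)
qed

text \<open>The points form a family \<open>p\<close>, not a set, because the floors of distinct
  points may coincide. A common truncation \<open>n\<close> of the finitely many rows turns the
  combination into a sum over independent coordinates, and the product of the truncated rows
  reproduces the kernel.\<close>

lemma normal_law_dyadic_bridge:
  fixes p :: "'a \<Rightarrow> real^'m"
  assumes A: "finite A" and p: "\<And>a. a \<in> A \<Longrightarrow> p a \<in> dyadics"
  shows "normal_law noise_measure (\<lambda>\<omega>. \<Sum>a\<in>A. c a * dyadic_bridge \<omega> (p a))
    (\<Sum>a\<in>A. \<Sum>b\<in>A. c a * c b * bridge_kernel (p a) (p b))"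
proof -
  have "\<forall>a\<in>A. \<exists>n0. (\<forall>l\<ge>n0. bridge_factor (p a) l = 0) \<and>
     (\<forall>y\<in>dyadics. \<forall>n\<ge>n0. bridge_kernel (p a) y = (\<Sum>l<n. bridge_factor (p a) l * bridge_factor y l))"
    using bridge_factor[OF p] by (rule ballI)
  from bchoice[OF this] obtain n0 where "\<forall>a\<in>A. (\<forall>l\<ge>n0 a. bridge_factor (p a) l = 0) \<and>
     (\<forall>y\<in>dyadics. \<forall>n\<ge>n0 a. bridge_kernel (p a) y = (\<Sum>l<n. bridge_factor (p a) l * bridge_factor y l))"
    by (elim exE)
  then have n0: "\<And>a l. a \<in> A \<Longrightarrow> l \<ge> n0 a \<Longrightarrow> bridge_factor (p a) l = 0"
    "\<And>a b n. a \<in> A \<Longrightarrow> b \<in> A \<Longrightarrow> n \<ge> n0 a \<Longrightarrow> bridge_kernel (p a) (p b) = (\<Sum>l<n. bridge_factor (p a) l * bridge_factor (p b) l)"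
    using p by simp_all
  define n where "n = Max (insert 0 (n0 ` A))"
  have n: "n0 a \<le> n" if "a \<in> A" for a unfolding n_def using that A by (intro Max_ge) auto
  define d where "d l = (\<Sum>a\<in>A. c a * bridge_factor (p a) l)" for l
  have G: "dyadic_bridge \<omega> (p a) = (\<Sum>l<n. bridge_factor (p a) l * \<omega> (\<chi> j. real l))" if "a \<in> A" for a \<omega>
    unfolding dyadic_bridge_def
  proof (rule sum.mono_neutral_left)
    show "{l. bridge_factor (p a) l \<noteq> 0} \<subseteq> {..<n}"
    proof
      fix l assume "l \<in> {l. bridge_factor (p a) l \<noteq> 0}"
      then have "\<not> n0 a \<le> l" using n0(1)[OF that, of l] by auto
      then show "l \<in> {..<n}" using n[OF that] by simp
    qed
  qed auto
  have comb: "(\<Sum>a\<in>A. c a * dyadic_bridge \<omega> (p a)) = (\<Sum>l<n. d l * \<omega> (\<chi> j. real l))" for \<omega>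
  proof -
    have "(\<Sum>a\<in>A. c a * dyadic_bridge \<omega> (p a)) = (\<Sum>a\<in>A. \<Sum>l<n. c a * bridge_factor (p a) l * \<omega> (\<chi> j. real l))"
      by (simp add: G sum_distrib_left mult.assoc)
    also have "\<dots> = (\<Sum>l<n. d l * \<omega> (\<chi> j. real l))"
      unfolding d_def by (subst sum.swap) (simp add: sum_distrib_right)
    finally show ?thesis .
  qed
  have var: "(\<Sum>l<n. (d l)\<^sup>2) = (\<Sum>a\<in>A. \<Sum>b\<in>A. c a * c b * bridge_kernel (p a) (p b))"
  proof -
    have "(\<Sum>a\<in>A. \<Sum>b\<in>A. c a * c b * bridge_kernel (p a) (p b)) =
        (\<Sum>a\<in>A. \<Sum>b\<in>A. \<Sum>l<n. (c a * bridge_factor (p a) l) * (c b * bridge_factor (p b) l))"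
    proof (intro sum.cong refl)
      fix a b assume ab: "a \<in> A" "b \<in> A"
      show "c a * c b * bridge_kernel (p a) (p b) = (\<Sum>l<n. (c a * bridge_factor (p a) l) * (c b * bridge_factor (p b) l))"
        unfolding n0(2)[OF ab n[OF ab(1)]] sum_distrib_left by (simp add: ac_simps)
    qed
    also have "\<dots> = (\<Sum>a\<in>A. \<Sum>l<n. \<Sum>b\<in>A. (c a * bridge_factor (p a) l) * (c b * bridge_factor (p b) l))"
      by (intro sum.cong refl sum.swap)
    also have "\<dots> = (\<Sum>l<n. \<Sum>a\<in>A. \<Sum>b\<in>A. (c a * bridge_factor (p a) l) * (c b * bridge_factor (p b) l))"
      by (rule sum.swap)
    also have "\<dots> = (\<Sum>l<n. (d l)\<^sup>2)"
      by (simp add: d_def power2_eq_square sum_product)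
    finally show ?thesis by simp
  qed
  have "inj (\<lambda>l. \<chi> j. real l :: real^'m)" by (auto intro!: injI simp: vec_eq_iff)
  from normal_law_iid_sum[OF this, of d n] show ?thesis
    by (simp add: comb var noise_measure_def)
qed

text \<open>For ordered neighbours the increment has variance \<open>u - u\<^sup>2\<close> with
  \<open>u\<close> the difference of the volumes, hence at most \<open>CARD('m) / 2 ^ r\<close>. The
  exponential moment of a normal law exists for every parameter, so the tail bound holds at all
  scales, and Borel-Cantelli applies.\<close>

lemma AE_regular_noise: "AE \<omega> in (noise_measure :: (real^'m \<Rightarrow> real) measure). regular_noise \<omega>"
proof -
  let ?N = "noise_measure :: (real^'m \<Rightarrow> real) measure"
  interpret N: prob_space ?N by (rule prob_space_noise_measure)
  define bad where "bad r = {\<omega> \<in> space ?N. \<not> small_increments r (chain_ratio ^ r) (dyadic_bridge \<omega>)}" for r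
  have tail: "N.prob {\<omega> \<in> space ?N. \<bar>dyadic_bridge \<omega> z - dyadic_bridge \<omega> y\<bar> > chain_ratio ^ r}
      \<le> 2 * exp (real CARD('m) - (1 / chain_ratio) ^ r)"
    if y: "y \<in> dyadic_grid r" and z: "z \<in> dyadic_grid r" and near: "dyadic_near r y z" for r and y z :: "real^'m"
  proof -
    define v where "v = bridge_kernel z z - 2 * bridge_kernel y z + bridge_kernel y y"
    have yz: "y \<in> dyadics" "z \<in> dyadics" using y z by (auto simp: dyadics_def)
    have yzc: "y \<in> cbox 0 1" "z \<in> cbox 0 1" using yz dyadics_subset_cube by auto
    have law: "normal_law ?N (\<lambda>\<omega>. dyadic_bridge \<omega> z - dyadic_bridge \<omega> y) v"
    proof -
      have "normal_law ?N (\<lambda>\<omega>. \<Sum>a\<in>{True, False}. (if a then 1 else -1) * dyadic_bridge \<omega> (if a then z else y))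
          (\<Sum>a\<in>{True, False}. \<Sum>b\<in>{True, False}. (if a then 1 else -1) * (if b then 1 else -1) * bridge_kernel (if a then z else y) (if b then z else y))"
        by (rule normal_law_dyadic_bridge) (use yz in auto)
      then show ?thesis by (simp add: v_def bridge_kernel_commute[of z y] algebra_simps)
    qed
    have min_yz: "min (y $ j) (z $ j) = y $ j" for j using near by (simp add: dyadic_near_def min_def)
    have vol: "volume_below z - volume_below y \<le> real CARD('m) * (1 / 2 ^ r)"
    proof -
      have "\<bar>z $ j - y $ j\<bar> \<le> 1 / 2 ^ r" for j
        using near by (simp add: dyadic_near_def abs_le_iff algebra_simps)
      from volume_below_diff_le[OF yzc(2,1) this] show ?thesis by linarith
    qed
    have "v = (volume_below z - volume_below y) - (volume_below z - volume_below y)\<^sup>2"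
      unfolding v_def bridge_kernel_def min_yz min.idem volume_below_def[symmetric]
      by (simp add: power2_eq_square algebra_simps)
    moreover have "0 \<le> (volume_below z - volume_below y)\<^sup>2" by simp
    ultimately have "v \<le> real CARD('m) * (1 / 2 ^ r)" using vol by linarith
    then have v: "v \<le> real CARD('m) / 2 ^ r" by simp
    have v0: "v \<ge> 0" using law by (simp add: normal_law_def)
    define l where "l = (1 / chain_ratio) ^ (2 * r)"
    have l0: "l > 0" using chain_ratio by (simp add: l_def)
    have l2: "l\<^sup>2 = 2 ^ r" unfolding l_def by (rule chain_rate(1))
    have "l\<^sup>2 * v \<le> l\<^sup>2 * (real CARD('m) / 2 ^ r)" using v by (intro mult_left_mono) auto
    moreover have "0 \<le> l\<^sup>2 * v" using v0 by simp
    ultimately have b: "l\<^sup>2 * v / 2 \<le> real CARD('m)" by (simp add: l2)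
    have "N.prob {\<omega> \<in> space ?N. \<bar>dyadic_bridge \<omega> z - dyadic_bridge \<omega> y\<bar> > chain_ratio ^ r} \<le> 2 * exp (real CARD('m) - l * chain_ratio ^ r)"
    proof (rule N.mgf_tail[OF _ l0])
      show "(\<lambda>\<omega>. dyadic_bridge \<omega> z - dyadic_bridge \<omega> y) \<in> borel_measurable ?N"
        using law by (simp add: normal_law_def)
    qed (use normal_law_mgf[OF prob_space_noise_measure law, of l] normal_law_mgf[OF prob_space_noise_measure law, of "- l"] b in auto)
    also have "l * chain_ratio ^ r = (1 / chain_ratio) ^ r" unfolding l_def by (rule chain_rate(2))
    finally show ?thesis .
  qed
  have bad: "bad r \<in> sets ?N" "N.prob (bad r) \<le> chain_const CARD('m) / 2 ^ r" for r
    unfolding bad_def using N.small_increments_prob[OF dyadic_bridge_measurable tail] by auto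
  have "summable (\<lambda>r. N.prob (bad r))"
  proof (rule summable_comparison_test)
    show "\<exists>n0. \<forall>r\<ge>n0. norm (N.prob (bad r)) \<le> chain_const CARD('m) * (1/2) ^ r"
      using bad(2) by (simp add: power_divide)
    show "summable (\<lambda>r. chain_const CARD('m) * (1/2) ^ r :: real)"
      by (intro summable_mult summable_geometric) simp
  qed
  then have "AE \<omega> in ?N. \<forall>\<^sub>F r in sequentially. \<omega> \<in> space ?N - bad r"
    using bad(1) by (intro borel_cantelli_AE1) (auto simp: N.emeasure_eq_measure)
  then show ?thesis
    by eventually_elim (auto simp: regular_noise_def bad_def eventually_sequentially)
qed

text \<open>On regular noise the values at dyadic floors converge, and by continuity of the kernel
  so do the variances.\<close>

lemma normal_law_limit_bridge:
  fixes p :: "'a \<Rightarrow> real^'m"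
  assumes A: "finite A" and p: "\<And>a. a \<in> A \<Longrightarrow> p a \<in> cbox 0 1"
  shows "normal_law noise_measure (\<lambda>\<omega>. \<Sum>a\<in>A. c a * limit_bridge \<omega> (p a))
    (\<Sum>a\<in>A. \<Sum>b\<in>A. c a * c b * bridge_kernel (p a) (p b))"
proof (rule normal_law_limit[OF prob_space_noise_measure])
  show "normal_law noise_measure (\<lambda>\<omega>. \<Sum>a\<in>A. c a * dyadic_bridge \<omega> (dyadic_floor k (p a)))
    (\<Sum>a\<in>A. \<Sum>b\<in>A. c a * c b * bridge_kernel (dyadic_floor k (p a)) (dyadic_floor k (p b)))" for k
    by (rule normal_law_dyadic_bridge) (use A p dyadic_floor_in_dyadics in auto)
  show "(\<lambda>\<omega>. \<Sum>a\<in>A. c a * limit_bridge \<omega> (p a)) \<in> borel_measurable noise_measure"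
    by (intro borel_measurable_sum borel_measurable_times limit_bridge_measurable) auto
  show "AE \<omega> in noise_measure. (\<lambda>k. \<Sum>a\<in>A. c a * dyadic_bridge \<omega> (dyadic_floor k (p a))) \<longlonglongrightarrow> (\<Sum>a\<in>A. c a * limit_bridge \<omega> (p a))"
    using AE_regular_noise
  proof eventually_elim
    case (elim \<omega>)
    then obtain k0 where k0: "\<And>r. k0 \<le> r \<Longrightarrow> small_increments r (chain_ratio ^ r) (dyadic_bridge \<omega>)"
      by (auto simp: regular_noise_def)
    show ?case
    proof (intro tendsto_sum tendsto_mult tendsto_const)
      fix a assume "a \<in> A"
      from dyadic_extension_convergent[OF k0 p[OF this]]
      show "(\<lambda>k. dyadic_bridge \<omega> (dyadic_floor k (p a))) \<longlonglongrightarrow> limit_bridge \<omega> (p a)"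
        using elim by (simp add: limit_bridge_def convergent_LIMSEQ_iff)
    qed
  qed
  show "(\<lambda>k. \<Sum>a\<in>A. \<Sum>b\<in>A. c a * c b * bridge_kernel (dyadic_floor k (p a)) (dyadic_floor k (p b)))
      \<longlonglongrightarrow> (\<Sum>a\<in>A. \<Sum>b\<in>A. c a * c b * bridge_kernel (p a) (p b))"
    by (intro tendsto_sum tendsto_mult tendsto_const bridge_kernel_tendsto dyadic_floor_tendsto)
qed

end

section \<open>Correction by the margins\<close>

definition axis_point :: "'m \<Rightarrow> real^'m \<Rightarrow> real^'m" where
  "axis_point j x = (\<chi> i. if i = j then x $ j else 1)"

text \<open>The map \<open>\<Phi>\<close>: \<open>f (axis_point j x)\<close> is the margin of
  \<open>f\<close> in direction \<open>j\<close>, and its weight is the product of the remaining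
  coordinates. For \<open>j\<close> outside \<open>V\<close> this is the partial derivative of the
  volume that arises when the factor \<open>x $ j\<close> is replaced by the empirical
  margin.\<close>

definition marginal_correction :: "'m set \<Rightarrow> (real^'m::finite \<Rightarrow> real) \<Rightarrow> real^'m \<Rightarrow> real" where
  "marginal_correction V f x = f x - (\<Sum>j\<in>UNIV - V. (\<Prod>i\<in>UNIV - {j}. x $ i) * f (axis_point j x))"

definition step_function :: "nat \<Rightarrow> (int^'m \<Rightarrow> real) \<Rightarrow> real^'m \<Rightarrow> real" where
  "step_function k v x = v (\<chi> j. \<lfloor>2 ^ k * x $ j\<rfloor>)"

lemma axis_point_cube: "x \<in> cbox 0 1 \<Longrightarrow> axis_point j x \<in> cbox 0 1"
  by (auto simp: mem_box_cart axis_point_def)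

text \<open>Splitting off one factor \<open>s\<close> gives the remainder
  \<open>b s * R + (a s - b s) * (difference of products)\<close>, the second term being quadratic.
  The constant survives the induction because
  \<open>c\<^sup>2 + c \<le> (c + 1)\<^sup>2\<close>.\<close>

lemma prod_diff_first_order:
  fixes a b :: "'a \<Rightarrow> real"
  assumes "finite S" and a: "\<And>i. i \<in> S \<Longrightarrow> 0 \<le> a i \<and> a i \<le> 1" and b: "\<And>i. i \<in> S \<Longrightarrow> 0 \<le> b i \<and> b i \<le> 1"
    and d: "\<And>i. i \<in> S \<Longrightarrow> \<bar>a i - b i\<bar> \<le> d"
  shows "\<bar>(\<Prod>i\<in>S. a i) - (\<Prod>i\<in>S. b i) - (\<Sum>j\<in>S. (\<Prod>i\<in>S - {j}. b i) * (a j - b j))\<bar> \<le> (real (card S))\<^sup>2 * d\<^sup>2"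
  using assms
proof (induction S rule: finite_induct)
  case (insert s T)
  define R where "R = (\<Prod>i\<in>T. a i) - (\<Prod>i\<in>T. b i) - (\<Sum>j\<in>T. (\<Prod>i\<in>T - {j}. b i) * (a j - b j))"
  have R: "\<bar>R\<bar> \<le> (real (card T))\<^sup>2 * d\<^sup>2" unfolding R_def by (rule insert.IH) (use insert.prems in auto)
  have d0: "0 \<le> d" using insert.prems(3)[of s] by force
  have D: "\<bar>(\<Prod>i\<in>T. a i) - (\<Prod>i\<in>T. b i)\<bar> \<le> real (card T) * d"
  proof -
    have "\<bar>(\<Prod>i\<in>T. a i) - (\<Prod>i\<in>T. b i)\<bar> \<le> (\<Sum>i\<in>T. \<bar>a i - b i\<bar>)"
      using norm_prod_diff[of T a b] insert.prems by (auto simp: abs_le_iff)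
    also have "\<dots> \<le> (\<Sum>i\<in>T. d)" using insert.prems by (intro sum_mono) auto
    finally show ?thesis by simp
  qed
  have "(\<Sum>j\<in>T. (\<Prod>i\<in>insert s T - {j}. b i) * (a j - b j)) = b s * (\<Sum>j\<in>T. (\<Prod>i\<in>T - {j}. b i) * (a j - b j))"
    unfolding sum_distrib_left
  proof (rule sum.cong)
    fix j assume j: "j \<in> T"
    then have "insert s T - {j} = insert s (T - {j})" using insert.hyps by auto
    then show "(\<Prod>i\<in>insert s T - {j}. b i) * (a j - b j) = b s * ((\<Prod>i\<in>T - {j}. b i) * (a j - b j))"
      using insert.hyps by simp
  qed simp
  moreover have "insert s T - {s} = T" using insert.hyps by auto
  ultimately have "(\<Prod>i\<in>insert s T. a i) - (\<Prod>i\<in>insert s T. b i) - (\<Sum>j\<in>insert s T. (\<Prod>i\<in>insert s T - {j}. b i) * (a j - b j))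
      = b s * R + (a s - b s) * ((\<Prod>i\<in>T. a i) - (\<Prod>i\<in>T. b i))"
    using insert.hyps by (simp add: R_def algebra_simps)
  also have "\<bar>\<dots>\<bar> \<le> \<bar>b s\<bar> * \<bar>R\<bar> + \<bar>a s - b s\<bar> * \<bar>(\<Prod>i\<in>T. a i) - (\<Prod>i\<in>T. b i)\<bar>"
    unfolding abs_mult[symmetric] by (rule abs_triangle_ineq)
  also have "\<dots> \<le> 1 * ((real (card T))\<^sup>2 * d\<^sup>2) + d * (real (card T) * d)"
    using insert.prems R D d0 by (intro add_mono mult_mono) auto
  also have "\<dots> = ((real (card T))\<^sup>2 + real (card T)) * d\<^sup>2" by (simp add: power2_eq_square algebra_simps)
  also have "\<dots> \<le> (real (card (insert s T)))\<^sup>2 * d\<^sup>2"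
    using insert.hyps by (intro mult_right_mono) (auto simp: power2_eq_square algebra_simps)
  finally show ?case .
qed simp

lemma marginal_correction_lipschitz:
  fixes f g :: "real^'m::finite \<Rightarrow> real"
  assumes fg: "\<And>x. x \<in> cbox 0 1 \<Longrightarrow> \<bar>f x - g x\<bar> \<le> e" and x: "x \<in> cbox 0 1"
  shows "\<bar>marginal_correction V f x - marginal_correction V g x\<bar> \<le> (1 + real CARD('m)) * e"
proof -
  have e: "0 \<le> e" using fg[OF x] by linarith
  have "marginal_correction V f x - marginal_correction V g x =
      (f x - g x) - (\<Sum>j\<in>UNIV - V. (\<Prod>i\<in>UNIV - {j}. x $ i) * (f (axis_point j x) - g (axis_point j x)))"
    by (simp add: marginal_correction_def sum_subtractf right_diff_distrib)
  also have "\<bar>\<dots>\<bar> \<le> \<bar>f x - g x\<bar> + (\<Sum>j\<in>UNIV - V. \<bar>(\<Prod>i\<in>UNIV - {j}. x $ i) * (f (axis_point j x) - g (axis_point j x))\<bar>)"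
    by (rule order_trans[OF abs_triangle_ineq4]) (intro add_left_mono sum_abs)
  also have "\<dots> \<le> e + (\<Sum>j\<in>UNIV - V. 1 * e)"
    unfolding abs_mult abs_prod
    using x by (intro add_mono sum_mono mult_mono fg axis_point_cube prod_le_1) (auto simp: mem_box_cart)
  also have "\<dots> \<le> e + real CARD('m) * e"
    using e by (auto intro!: mult_right_mono card_mono)
  finally show ?thesis by (simp add: algebra_simps)
qed

lemma continuous_on_marginal_correction:
  fixes f :: "real^'m::finite \<Rightarrow> real"
  assumes f: "continuous_on (cbox 0 1) f"
  shows "continuous_on (cbox 0 1) (marginal_correction V f)"
proof -
  have "continuous_on (cbox 0 1) (\<lambda>x. f (axis_point j x))" for j
  proof (rule continuous_on_compose2[OF f])
    have "continuous_on (cbox 0 1) (\<lambda>x :: real^'m. if i = j then x $ j else 1)" for i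
      by (cases "i = j") (auto intro!: continuous_intros)
    then show "continuous_on (cbox 0 1) (axis_point j :: real^'m \<Rightarrow> _)"
      unfolding axis_point_def by (intro continuous_on_vec_lambda)
  qed (auto intro: axis_point_cube)
  then show ?thesis unfolding marginal_correction_def by (intro continuous_intros f)
qed

lemma step_function_dyadic_floor: "step_function k (\<lambda>c. f (dyadic_point k c)) x = f (dyadic_floor k x)"
  by (simp add: step_function_def dyadic_floor_def)

section \<open>Corrected step functions as elements of the Skorohod space\<close>

lemma floor_in_dyadic_index:
  assumes "x \<in> cbox 0 (1::real^'m::finite)"
  shows "(\<chi> j. \<lfloor>2 ^ k * x $ j\<rfloor>) \<in> dyadic_index k"
proof -
  have "0 \<le> \<lfloor>2 ^ k * x $ j\<rfloor> \<and> \<lfloor>2 ^ k * x $ j\<rfloor> \<le> 2 ^ k" for j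
  proof -
    have xj: "0 \<le> x $ j" "x $ j \<le> 1" using assms by (auto simp: mem_box_cart)
    have "2 ^ k * x $ j \<le> of_int (2 ^ k)" using xj by (simp add: mult_left_le)
    then have "\<lfloor>2 ^ k * x $ j\<rfloor> \<le> 2 ^ k" by linarith
    then show ?thesis using xj by simp
  qed
  then show ?thesis by (simp add: dyadic_index_def)
qed

lemma cadlag_cong:
  fixes f g :: "real^'m::finite \<Rightarrow> real"
  assumes "cadlag f" and eq: "\<And>x. x \<in> cbox 0 1 \<Longrightarrow> f x = g x"
  shows "cadlag g"
proof -
  have "restrict f (cbox 0 1) = restrict g (cbox 0 1)" using eq by (auto simp: restrict_def)
  then have "restrict g (cbox 0 1) \<in> skorohod_space" using restrict_in_skorohod_space[OF assms(1)] by simp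
  from skorohod_space_cadlag[OF this]
  have *: "cadlag (restrict g (cbox 0 1))" .
  show ?thesis
    unfolding cadlag_def
  proof (intro ballI conjI allI)
    fix x :: "real^'m" and A assume x: "x \<in> cbox 0 1"
    show "\<exists>l. (g \<longlongrightarrow> l) (at x within quadrant x A)" "(g \<longlongrightarrow> g x) (at x within quadrant x UNIV)"
      using * x unfolding cadlag_def tendsto_restrict_quadrant by auto
  qed
qed

text \<open>The correction evaluates a step function at axis points, so composition with
  \<open>axis_point j\<close> has to be covered. Each coordinate of \<open>u\<close> is kept or
  frozen, and the composite is a finite sum over cells of products of half-open interval indicators
  or constants.\<close>

lemma cadlag_step_compose:
  fixes u :: "real^'m::finite \<Rightarrow> real^'m"
  assumes u: "\<And>x. x \<in> cbox 0 1 \<Longrightarrow> u x \<in> cbox 0 1"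
    and coord: "\<And>i. (\<forall>x. u x $ i = x $ i) \<or> (\<exists>c. \<forall>x. u x $ i = c)"
  shows "cadlag (\<lambda>x. step_function k v (u x))"
proof -
  define \<phi> where "\<phi> g i x = (of_bool (\<lfloor>2 ^ k * u x $ i\<rfloor> = g $ i) :: real)" for g :: "int^'m" and i x
  have \<phi>: "cadlag (\<phi> g i)" for g i
  proof (cases "\<forall>x. u x $ i = x $ i")
    case True
    have floor: "\<lfloor>2 ^ k * t\<rfloor> = g $ i \<longleftrightarrow> of_int (g $ i) / 2 ^ k \<le> t \<and> \<not> (of_int (g $ i) + 1) / 2 ^ k \<le> t" for t :: real
      by (auto simp: floor_eq_iff field_simps not_le)
    have mono: "of_int (g $ i) / 2 ^ k \<le> (of_int (g $ i) + 1) / (2 ^ k :: real)" by (simp add: divide_right_mono)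
    have "\<phi> g i x = of_bool (of_int (g $ i) / 2 ^ k \<le> x $ i) - of_bool ((of_int (g $ i) + 1) / 2 ^ k \<le> x $ i)" for x
      unfolding \<phi>_def floor using True mono by auto
    then have "\<phi> g i = (\<lambda>x. of_bool (of_int (g $ i) / 2 ^ k \<le> x $ i) - of_bool ((of_int (g $ i) + 1) / 2 ^ k \<le> x $ i))" by (rule ext)
    then show ?thesis by (simp only:) (intro cadlag_diff cadlag_ge_indicator)
  next
    case False
    then obtain c where "\<And>x. u x $ i = c" using coord by blast
    then have "\<phi> g i = (\<lambda>_. of_bool (\<lfloor>2 ^ k * c\<rfloor> = g $ i))" unfolding \<phi>_def by (intro ext) simp
    then show ?thesis by (simp only: cadlag_const)
  qed
  have "cadlag (\<lambda>x. \<Sum>g\<in>dyadic_index k. v g * (\<Prod>i\<in>UNIV. \<phi> g i x))"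
    by (intro cadlag_sum cadlag_mult cadlag_const cadlag_prod \<phi>)
  then show ?thesis
  proof (rule cadlag_cong)
    fix x :: "real^'m" assume x: "x \<in> cbox 0 1"
    let ?g = "\<chi> j. \<lfloor>2 ^ k * u x $ j\<rfloor>"
    have g: "?g \<in> dyadic_index k" by (rule floor_in_dyadic_index[OF u[OF x]])
    have "(\<Prod>i\<in>UNIV. \<phi> g i x) = of_bool (g = ?g)" for g
    proof (cases "g = ?g")
      case False
      then obtain i where "g $ i \<noteq> \<lfloor>2 ^ k * u x $ i\<rfloor>" by (auto simp: vec_eq_iff)
      then have "\<phi> g i x = 0" by (auto simp: \<phi>_def)
      then show ?thesis using False by (auto intro!: prod_zero)
    qed (simp add: \<phi>_def)
    then have "(\<Sum>g\<in>dyadic_index k. v g * (\<Prod>i\<in>UNIV. \<phi> g i x)) = (\<Sum>g\<in>dyadic_index k. if g = ?g then v g else 0)"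
      by (intro sum.cong) auto
    also have "\<dots> = v ?g" using g by (simp add: finite_dyadic_index)
    finally show "(\<Sum>g\<in>dyadic_index k. v g * (\<Prod>i\<in>UNIV. \<phi> g i x)) = step_function k v (u x)"
      by (simp add: step_function_def)
  qed
qed

lemma corrected_step_in_skorohod_space:
  "restrict (marginal_correction V (step_function k v)) (cbox 0 1) \<in> skorohod_space"
proof (rule restrict_in_skorohod_space)
  have "cadlag (step_function k v)"
    using cadlag_step_compose[of "\<lambda>x. x" k v] by simp
  moreover have "cadlag (\<lambda>x. step_function k v (axis_point j x))" for j
    by (rule cadlag_step_compose) (auto simp: axis_point_cube, auto simp: axis_point_def)
  moreover have "cadlag (\<lambda>x. \<Prod>i\<in>UNIV - {j}. x $ i)" for j
    by (intro cadlag_prod) (auto intro!: cadlag_continuous continuous_intros)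
  ultimately show "cadlag (marginal_correction V (step_function k v))"
    unfolding marginal_correction_def by (intro cadlag_diff cadlag_sum cadlag_mult)
qed

lemma corrected_step_dist_le:
  fixes v w :: "int^'m::finite \<Rightarrow> real"
  assumes "\<And>c. c \<in> dyadic_index k \<Longrightarrow> \<bar>v c - w c\<bar> \<le> e"
  shows "skorohod_dist (restrict (marginal_correction V (step_function k v)) (cbox 0 1))
    (restrict (marginal_correction V (step_function k w)) (cbox 0 1)) \<le> (1 + real CARD('m)) * e"
proof (rule skorohod_dist_le_sup[OF corrected_step_in_skorohod_space corrected_step_in_skorohod_space])
  fix x :: "real^'m" assume x: "x \<in> cbox 0 1"
  have "\<bar>marginal_correction V (step_function k v) x - marginal_correction V (step_function k w) x\<bar> \<le> (1 + real CARD('m)) * e"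
    by (rule marginal_correction_lipschitz[OF _ x]) (simp add: step_function_def assms floor_in_dyadic_index)
  then show "\<bar>restrict (marginal_correction V (step_function k v)) (cbox 0 1) x -
      restrict (marginal_correction V (step_function k w)) (cbox 0 1) x\<bar> \<le> (1 + real CARD('m)) * e"
    using x by simp
qed

text \<open>The path depends on finitely many grid values and is Lipschitz in them, so rounding the
  values to dyadic numbers gives approximations with countable range that converge in the Skorohod
  metric.\<close>

lemma measurable_corrected_step:
  fixes Y :: "'w \<Rightarrow> int^'m::finite \<Rightarrow> real"
  assumes Y: "\<And>c. c \<in> dyadic_index k \<Longrightarrow> (\<lambda>\<omega>. Y \<omega> c) \<in> borel_measurable P"
  shows "(\<lambda>\<omega>. restrict (marginal_correction V (step_function k (Y \<omega>))) (cbox 0 1))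
    \<in> measurable P (borel_sigma skorohod_topology)"
proof (rule measurable_skorohod_limit)
  let ?Z = "\<lambda>v :: int^'m \<Rightarrow> real. restrict (marginal_correction V (step_function k v)) (cbox 0 1)"
  let ?r = "\<lambda>q \<omega> c. of_int \<lfloor>2 ^ q * Y \<omega> c\<rfloor> / (2 ^ q :: real)"
  obtain cs :: "(int^'m) list" where cs: "set cs = dyadic_index k"
    using finite_list[OF finite_dyadic_index] by blast
  show "(\<lambda>\<omega>. ?Z (?r q \<omega>)) \<in> measurable P (borel_sigma skorohod_topology)" for q
  proof -
    define g where "g \<omega> = map (\<lambda>c. \<lfloor>2 ^ q * Y \<omega> c\<rfloor>) cs" for \<omega>
    \<comment> \<open>The finite family of integers is stored as a list, a countable type, and
      looked up through the fixed enumeration \<open>cs\<close> of the grid.\<close>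
    define U where "U l = ?Z (\<lambda>c. of_int (the (map_of (zip cs l) c)) / 2 ^ q)" for l
    have "g \<in> measurable P (count_space UNIV)"
      unfolding g_def
    proof (rule measurable_map_count_space)
      fix c assume "c \<in> set cs"
      then have [measurable]: "(\<lambda>\<omega>. Y \<omega> c) \<in> borel_measurable P" using Y cs by simp
      show "(\<lambda>\<omega>. \<lfloor>2 ^ q * Y \<omega> c\<rfloor>) \<in> measurable P (count_space UNIV)" by simp
    qed
    then have "(\<lambda>\<omega>. U (g \<omega>)) \<in> measurable P (borel_sigma skorohod_topology)"
    proof (rule measurable_countable_range[rotated])
      show "U (g \<omega>) \<in> topspace skorohod_topology" for \<omega>
        unfolding U_def topspace_skorohod by (rule corrected_step_in_skorohod_space)
    qed
    moreover have "U (g \<omega>) = ?Z (?r q \<omega>)" for \<omega>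
    proof -
      have "the (map_of (zip cs (g \<omega>)) c) = \<lfloor>2 ^ q * Y \<omega> c\<rfloor>" if "c \<in> dyadic_index k" for c
        using that cs by (simp add: g_def map_of_zip_map)
      then have "step_function k (\<lambda>c. of_int (the (map_of (zip cs (g \<omega>)) c)) / 2 ^ q) x = step_function k (?r q \<omega>) x"
        if "x \<in> cbox 0 1" for x
        using floor_in_dyadic_index[OF that, of k] by (simp add: step_function_def)
      then show ?thesis
        unfolding U_def by (auto simp: marginal_correction_def axis_point_cube restrict_def)
    qed
    ultimately show ?thesis by simp
  qed
  show "(\<lambda>q. skorohod_dist (?Z (?r q \<omega>)) (?Z (Y \<omega>))) \<longlonglongrightarrow> 0" for \<omega>
  proof (rule Lim_null_comparison)
    show "\<forall>\<^sub>F q in sequentially. norm (skorohod_dist (?Z (?r q \<omega>)) (?Z (Y \<omega>))) \<le> (1 + real CARD('m)) * (1/2) ^ q"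
    proof (intro always_eventually allI)
      fix q
      have "\<bar>?r q \<omega> c - Y \<omega> c\<bar> \<le> (1/2) ^ q" for c
      proof -
        have "\<bar>of_int \<lfloor>2 ^ q * Y \<omega> c\<rfloor> - 2 ^ q * Y \<omega> c\<bar> \<le> 1" by linarith
        then have "\<bar>of_int \<lfloor>2 ^ q * Y \<omega> c\<rfloor> - 2 ^ q * Y \<omega> c\<bar> / 2 ^ q \<le> 1 / 2 ^ q" by (intro divide_right_mono) auto
        moreover have "\<bar>of_int \<lfloor>2 ^ q * Y \<omega> c\<rfloor> - 2 ^ q * Y \<omega> c\<bar> / 2 ^ q = \<bar>?r q \<omega> c - Y \<omega> c\<bar>"
        proof -
          have "?r q \<omega> c - Y \<omega> c = (of_int \<lfloor>2 ^ q * Y \<omega> c\<rfloor> - 2 ^ q * Y \<omega> c) / 2 ^ q"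
            by (simp add: diff_divide_distrib)
          then show ?thesis by (simp add: abs_divide)
        qed
        ultimately show ?thesis by (simp add: power_divide)
      qed
      from corrected_step_dist_le[OF this]
      show "norm (skorohod_dist (?Z (?r q \<omega>)) (?Z (Y \<omega>))) \<le> (1 + real CARD('m)) * (1/2) ^ q"
        by simp
    qed
    have "(\<lambda>q. (1 + real CARD('m)) * (1/2) ^ q) \<longlonglongrightarrow> (1 + real CARD('m)) * 0"
      by (intro tendsto_mult_left LIMSEQ_realpow_zero) auto
    then show "(\<lambda>q. (1 + real CARD('m)) * (1/2) ^ q) \<longlonglongrightarrow> 0" by simp
  qed
qed (rule corrected_step_in_skorohod_space)

section \<open>The covariance function\<close>

text \<open>Solves the recurrence: no other member of the family lies inside the complement of a
  single \<open>j\<close>, so these complements have coefficient 1, and the equation at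
  \<open>UNIV\<close> leaves \<open>1 - card (UNIV - V)\<close> for the top.\<close>

lemma cov_fun_index_family:
  fixes V :: "'m::finite set"
  assumes a: "recurrent_coeffs (index_family V) a"
  shows "cov_fun (index_family V) a x y = (\<Prod>j\<in>UNIV. min (x $ j) (y $ j))
    - (1 - real (card (UNIV - V))) * (volume_below x * volume_below y)
    - (\<Sum>j\<in>UNIV - V. min (x $ j) (y $ j) * (\<Prod>i\<in>UNIV - {j}. x $ i * y $ i))"
proof -
  let ?c = "\<lambda>j. UNIV - {j} :: 'm set"
  have fam: "index_family V = insert UNIV (?c ` (UNIV - V))"
    unfolding index_family_def by (auto simp: card_1_singleton_iff)
  have inj: "inj_on ?c (UNIV - V)" by (auto simp: inj_on_def)
  have notin: "UNIV \<notin> ?c ` (UNIV - V)" by auto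
  have one: "a (?c j) = 1" if "j \<in> UNIV - V" for j
  proof -
    have "W = ?c j" if W: "W \<in> index_family V" "W \<subseteq> ?c j" for W
    proof -
      have "j \<notin> W" using W(2) by auto
      then obtain i where i: "W = ?c i" using W(1) unfolding fam by auto
      then have "i = j" using \<open>j \<notin> W\<close> by simp
      then show ?thesis using i by simp
    qed
    moreover have "?c j \<in> index_family V" unfolding fam using that by simp
    ultimately have "{W \<in> index_family V. W \<subseteq> ?c j} = {?c j}" by auto
    moreover have "(\<Sum>W\<in>{W \<in> index_family V. W \<subseteq> ?c j}. a W) = 1"
      using a that unfolding recurrent_coeffs_def by (auto simp: fam)
    ultimately show ?thesis by simp
  qed
  have "(\<Sum>W\<in>{W \<in> index_family V. W \<subseteq> UNIV}. a W) = 1"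
    using a unfolding recurrent_coeffs_def by (auto simp: fam)
  moreover have "{W \<in> index_family V. W \<subseteq> UNIV} = insert UNIV (?c ` (UNIV - V))" by (auto simp: fam)
  ultimately have "a UNIV + (\<Sum>j\<in>UNIV - V. a (?c j)) = 1"
    using notin by (simp add: sum.reindex[OF inj])
  then have top: "a UNIV = 1 - real (card (UNIV - V))" using one by simp
  have "(\<Sum>U\<in>index_family V. a U * (\<Prod>j\<in>UNIV - U. min (x $ j) (y $ j)) * (\<Prod>i\<in>U. x $ i * y $ i)) =
      a UNIV * (\<Prod>i\<in>UNIV. x $ i * y $ i) +
      (\<Sum>j\<in>UNIV - V. a (?c j) * (\<Prod>j\<in>UNIV - ?c j. min (x $ j) (y $ j)) * (\<Prod>i\<in>?c j. x $ i * y $ i))"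
    using notin by (simp add: fam sum.reindex[OF inj])
  also have "(\<Sum>j\<in>UNIV - V. a (?c j) * (\<Prod>j\<in>UNIV - ?c j. min (x $ j) (y $ j)) * (\<Prod>i\<in>?c j. x $ i * y $ i)) =
      (\<Sum>j\<in>UNIV - V. min (x $ j) (y $ j) * (\<Prod>i\<in>?c j. x $ i * y $ i))"
    by (intro sum.cong refl) (simp add: one Diff_Diff_Int)
  finally show ?thesis
    by (simp add: cov_fun_def top volume_below_def prod.distrib)
qed

text \<open>The correction as a finite combination of point evaluations: \<open>None\<close> stands
  for \<open>x\<close> itself, \<open>Some j\<close> for the margin in direction
  \<open>j\<close>.\<close>

definition correction_coeff :: "real^'m::finite \<Rightarrow> 'm option \<Rightarrow> real" where
  "correction_coeff x a = (case a of None \<Rightarrow> 1 | Some j \<Rightarrow> - (\<Prod>i\<in>UNIV - {j}. x $ i))"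

definition correction_point :: "real^'m::finite \<Rightarrow> 'm option \<Rightarrow> real^'m" where
  "correction_point x a = (case a of None \<Rightarrow> x | Some j \<Rightarrow> axis_point j x)"

lemma sum_option: "(\<Sum>a\<in>insert None (Some ` S). f a) = f None + (\<Sum>j\<in>S. f (Some j))" if "finite S"
  using that by (simp add: sum.reindex image_iff)

lemma marginal_correction_eq_sum:
  "marginal_correction V f x = (\<Sum>a\<in>insert None (Some ` (UNIV - V)). correction_coeff x a * f (correction_point x a))"
  unfolding sum_option[OF finite]
  by (simp add: marginal_correction_def correction_coeff_def correction_point_def sum_negf)

lemma volume_below_split: "volume_below x = x $ j * (\<Prod>i\<in>UNIV - {j}. x $ i)"
  unfolding volume_below_def by (rule prod.remove) auto

lemma volume_below_axis_point [simp]: "volume_below (axis_point j x) = x $ j"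
proof -
  have "(\<Prod>i\<in>UNIV - {j}. axis_point j x $ i) = 1" by (rule prod.neutral) (auto simp: axis_point_def)
  then show ?thesis by (simp add: volume_below_split[of _ j]) (simp add: axis_point_def)
qed

lemma bridge_kernel_axis_point:
  assumes x: "x \<in> cbox 0 1" and y: "y \<in> cbox 0 1"
  shows "bridge_kernel x (axis_point j y) = (\<Prod>i\<in>UNIV - {j}. x $ i) * (min (x $ j) (y $ j) - x $ j * y $ j)"
proof -
  have "(\<Prod>i\<in>UNIV. min (x $ i) (axis_point j y $ i)) =
      min (x $ j) (axis_point j y $ j) * (\<Prod>i\<in>UNIV - {j}. min (x $ i) (axis_point j y $ i))"
    by (rule prod.remove) auto
  also have "\<dots> = min (x $ j) (y $ j) * (\<Prod>i\<in>UNIV - {j}. x $ i)"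
    using x by (intro arg_cong2[where f = "(*)"] prod.cong) (auto simp: axis_point_def mem_box_cart)
  finally show ?thesis by (simp add: bridge_kernel_def volume_below_split[of x j] algebra_simps)
qed

lemma bridge_kernel_axis_points:
  assumes x: "x \<in> cbox 0 1" and y: "y \<in> cbox 0 1"
  shows "bridge_kernel (axis_point j x) (axis_point l y) = (if j = l then min (x $ j) (y $ j) - x $ j * y $ j else 0)"
proof -
  have "(\<Prod>i\<in>UNIV - {l}. axis_point j x $ i) = (if j = l then 1 else x $ j)"
  proof (cases "j = l")
    case False
    have "(\<Prod>i\<in>UNIV - {l}. axis_point j x $ i) = axis_point j x $ j * (\<Prod>i\<in>UNIV - {l} - {j}. axis_point j x $ i)"
      using False by (intro prod.remove) auto
    also have "(\<Prod>i\<in>UNIV - {l} - {j}. axis_point j x $ i) = 1" by (rule prod.neutral) (auto simp: axis_point_def)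
    finally show ?thesis using False by (simp add: axis_point_def)
  qed (auto simp: axis_point_def intro!: prod.neutral)
  moreover have "y $ l \<le> 1" using y by (simp add: mem_box_cart)
  ultimately show ?thesis
    unfolding bridge_kernel_axis_point[OF axis_point_cube[OF x] y] by (auto simp: axis_point_def)
qed

text \<open>Here \<open>\<mu> j\<close> is the Brownian bridge kernel in coordinate
  \<open>j\<close>; margins in distinct directions are uncorrelated. In each row
  \<open>Some j\<close> the covariance with the full bridge cancels the diagonal margin term, so
  only the row \<open>None\<close> remains and gives \<open>bridge_kernel x y - S\<close>.\<close>

lemma corrected_kernel:
  fixes V :: "'m::finite set"
  assumes a: "recurrent_coeffs (index_family V) a" and x: "x \<in> cbox 0 1" and y: "y \<in> cbox 0 1"
  defines "Q \<equiv> insert None (Some ` (UNIV - V))"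
  shows "(\<Sum>a\<in>Q. \<Sum>b\<in>Q. correction_coeff x a * correction_coeff y b * bridge_kernel (correction_point x a) (correction_point y b))
    = cov_fun (index_family V) a x y"
proof -
  define \<gamma> where "\<gamma> z j = (\<Prod>i\<in>UNIV - {j}. z $ i)" for z :: "real^'m" and j
  define \<mu> where "\<mu> j = min (x $ j) (y $ j) - x $ j * y $ j" for j
  define S where "S = (\<Sum>j\<in>UNIV - V. \<gamma> x j * \<gamma> y j * \<mu> j)"
  have k1: "bridge_kernel x (axis_point j y) = \<gamma> x j * \<mu> j" for j
    by (simp add: bridge_kernel_axis_point[OF x y] \<gamma>_def \<mu>_def)
  have k2: "bridge_kernel (axis_point j x) y = \<gamma> y j * \<mu> j" for j
    by (subst bridge_kernel_commute)
       (simp add: bridge_kernel_axis_point[OF y x] \<gamma>_def \<mu>_def min.commute mult.commute)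
  have k3: "bridge_kernel (axis_point j x) (axis_point l y) = (if j = l then \<mu> j else 0)" for j l
    by (simp add: bridge_kernel_axis_points[OF x y] \<mu>_def)
  have "(\<Sum>a\<in>Q. \<Sum>b\<in>Q. correction_coeff x a * correction_coeff y b * bridge_kernel (correction_point x a) (correction_point y b))
      = bridge_kernel x y - S"
  proof -
    have cc: "correction_coeff z None = 1" "correction_coeff z (Some j) = - \<gamma> z j"
      "correction_point z None = z" "correction_point z (Some j) = axis_point j z" for z j
      by (simp_all add: correction_coeff_def correction_point_def \<gamma>_def)
    have s1: "(\<Sum>l\<in>UNIV - V. 1 * - \<gamma> y l * (\<gamma> x l * \<mu> l)) = - S"
      unfolding S_def sum_negf[symmetric] by (rule sum.cong) auto
    have s2: "- \<gamma> x j * 1 * (\<gamma> y j * \<mu> j) + (\<Sum>l\<in>UNIV - V. - \<gamma> x j * - \<gamma> y l * (if j = l then \<mu> j else 0)) = 0"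
      if "j \<in> UNIV - V" for j
    proof -
      have "(\<Sum>l\<in>UNIV - V. - \<gamma> x j * - \<gamma> y l * (if j = l then \<mu> j else 0)) =
          (\<Sum>l\<in>UNIV - V. if j = l then \<gamma> x j * \<gamma> y l * \<mu> j else 0)"
        by (rule sum.cong) auto
      also have "\<dots> = \<gamma> x j * \<gamma> y j * \<mu> j" using that by simp
      finally show ?thesis by simp
    qed
    have s3: "(\<Sum>j\<in>UNIV - V. - \<gamma> x j * 1 * (\<gamma> y j * \<mu> j) + (\<Sum>l\<in>UNIV - V. - \<gamma> x j * - \<gamma> y l * (if j = l then \<mu> j else 0))) = 0"
      by (rule sum.neutral) (use s2 in blast)
    show ?thesis
      unfolding Q_def sum_option[OF finite] cc k1 k2 k3 s1 s3 by simp
  qed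
  also have "S = (\<Sum>j\<in>UNIV - V. min (x $ j) (y $ j) * (\<Prod>i\<in>UNIV - {j}. x $ i * y $ i)) - real (card (UNIV - V)) * (volume_below x * volume_below y)"
  proof -
    have "\<gamma> x j * \<gamma> y j * \<mu> j = min (x $ j) (y $ j) * (\<Prod>i\<in>UNIV - {j}. x $ i * y $ i) - volume_below x * volume_below y" for j
      by (simp add: volume_below_split[of _ j] \<gamma>_def \<mu>_def prod.distrib algebra_simps)
    then show ?thesis by (simp add: S_def sum_subtractf)
  qed
  finally show ?thesis
    unfolding cov_fun_index_family[OF a] bridge_kernel_def by (simp add: algebra_simps)
qed

section \<open>The limit process\<close>

definition limit_process :: "'m set \<Rightarrow> (real^'m::finite \<Rightarrow> real) \<Rightarrow> real^'m \<Rightarrow> real" where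
  "limit_process V \<omega> = restrict (marginal_correction V (limit_bridge \<omega>)) (cbox 0 1)"

definition corrected_step :: "'m set \<Rightarrow> nat \<Rightarrow> (int^'m::finite \<Rightarrow> real) \<Rightarrow> real^'m \<Rightarrow> real" where
  "corrected_step V k v = restrict (marginal_correction V (step_function k v)) (cbox 0 1)"

lemma limit_process_in_skorohod_space: "limit_process V \<omega> \<in> skorohod_space"
  unfolding limit_process_def
  by (intro restrict_in_skorohod_space cadlag_continuous continuous_on_marginal_correction limit_bridge_continuous)

lemma corrected_step_approx:
  fixes f :: "real^'m::finite \<Rightarrow> real"
  assumes "\<And>x. x \<in> cbox 0 1 \<Longrightarrow> \<bar>f x - f (dyadic_floor k x)\<bar> \<le> e" and x: "x \<in> cbox 0 1"
  shows "\<bar>marginal_correction V f x - corrected_step V k (\<lambda>c. f (dyadic_point k c)) x\<bar> \<le> (1 + real CARD('m)) * e"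
  unfolding corrected_step_def using x
  by (simp add: marginal_correction_lipschitz assms step_function_dyadic_floor)

lemma limit_process_approx:
  fixes \<omega> :: "real^'m::finite \<Rightarrow> real"
  shows "(\<lambda>k. skorohod_dist (corrected_step V k (\<lambda>c. limit_bridge \<omega> (dyadic_point k c))) (limit_process V \<omega>)) \<longlonglongrightarrow> 0"
proof (rule Lim_null_comparison)
  obtain k0 where k0: "\<And>k x. k \<ge> k0 \<Longrightarrow> x \<in> cbox 0 1 \<Longrightarrow>
      \<bar>limit_bridge \<omega> x - limit_bridge \<omega> (dyadic_floor k x)\<bar> \<le> chain_ratio ^ k / (1 - chain_ratio)"
    using limit_bridge_floor_close[of \<omega>] by auto
  show "\<forall>\<^sub>F k in sequentially. norm (skorohod_dist (corrected_step V k (\<lambda>c. limit_bridge \<omega> (dyadic_point k c))) (limit_process V \<omega>))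
      \<le> (1 + real CARD('m)) * (chain_ratio ^ k / (1 - chain_ratio))"
    using eventually_ge_at_top[of k0]
  proof eventually_elim
    case (elim k)
    have "skorohod_dist (limit_process V \<omega>) (corrected_step V k (\<lambda>c. limit_bridge \<omega> (dyadic_point k c)))
        \<le> (1 + real CARD('m)) * (chain_ratio ^ k / (1 - chain_ratio))"
    proof (rule skorohod_dist_le_sup[OF limit_process_in_skorohod_space])
      show "corrected_step V k (\<lambda>c. limit_bridge \<omega> (dyadic_point k c)) \<in> skorohod_space"
        unfolding corrected_step_def by (rule corrected_step_in_skorohod_space)
      fix x :: "real^'m" assume x: "x \<in> cbox 0 1"
      show "\<bar>limit_process V \<omega> x - corrected_step V k (\<lambda>c. limit_bridge \<omega> (dyadic_point k c)) x\<bar>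
          \<le> (1 + real CARD('m)) * (chain_ratio ^ k / (1 - chain_ratio))"
        using corrected_step_approx[of "limit_bridge \<omega>" k _ x V, OF k0[OF elim] x] x by (simp add: limit_process_def)
    qed
    then show ?case by (simp add: skorohod.commute skorohod_dist_nonneg)
  qed
  have "(\<lambda>k. (1 + real CARD('m)) * (chain_ratio ^ k / (1 - chain_ratio))) \<longlonglongrightarrow> (1 + real CARD('m)) * (0 / (1 - chain_ratio))"
    using chain_ratio by (intro tendsto_intros LIMSEQ_realpow_zero) auto
  then show "(\<lambda>k. (1 + real CARD('m)) * (chain_ratio ^ k / (1 - chain_ratio))) \<longlonglongrightarrow> 0" by simp
qed

text \<open>The approximation by grid values that carries the convergence proof also gives
  measurability.\<close>

lemma measurable_limit_process: "limit_process V \<in> measurable noise_measure (borel_sigma skorohod_topology)"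
proof (rule measurable_skorohod_limit)
  show "(\<lambda>\<omega>. corrected_step V k (\<lambda>c. limit_bridge \<omega> (dyadic_point k c))) \<in> measurable noise_measure (borel_sigma skorohod_topology)" for k
    unfolding corrected_step_def by (intro measurable_corrected_step limit_bridge_measurable)
qed (rule limit_process_in_skorohod_space limit_process_approx)+

section \<open>Tail bounds on a finite grid\<close>

lemma exp_tail_choice:
  fixes c e :: real
  assumes "c \<ge> 0" "e > 0"
  shows "\<exists>A>0. c * (2 * exp (1 - A)) \<le> e"
proof (intro exI[of _ "max 1 (1 - ln (e / (2 * (c + 1))))"] conjI)
  let ?A = "max 1 (1 - ln (e / (2 * (c + 1))))"
  have pos: "e / (2 * (c + 1)) > 0" using assms by simp
  have "exp (1 - ?A) \<le> exp (ln (e / (2 * (c + 1))))" by simp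
  also have "\<dots> = e / (2 * (c + 1))" by (rule exp_ln[OF pos])
  finally have "c * (2 * exp (1 - ?A)) \<le> c * (2 * (e / (2 * (c + 1))))" using assms by (intro mult_left_mono) auto
  also have "\<dots> \<le> e" using assms by (simp add: field_simps)
  finally show "c * (2 * exp (1 - ?A)) \<le> e" .
qed simp

lemma (in prob_space) tail_union_bound:
  fixes Y :: "'c \<Rightarrow> 'a \<Rightarrow> real"
  assumes F: "finite F" and Y: "\<And>c. c \<in> F \<Longrightarrow> Y c \<in> borel_measurable M"
    and tail: "\<And>c. c \<in> F \<Longrightarrow> prob {\<omega> \<in> space M. \<bar>Y c \<omega>\<bar> > A} \<le> p"
  shows "{\<omega> \<in> space M. \<exists>c\<in>F. \<bar>Y c \<omega>\<bar> > A} \<in> events"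
    and "prob {\<omega> \<in> space M. \<exists>c\<in>F. \<bar>Y c \<omega>\<bar> > A} \<le> real (card F) * p"
proof -
  have ev: "{\<omega> \<in> space M. \<bar>Y c \<omega>\<bar> > A} \<in> events" if "c \<in> F" for c
  proof -
    have [measurable]: "Y c \<in> borel_measurable M" by (rule Y[OF that])
    show ?thesis by measurable
  qed
  have eq: "{\<omega> \<in> space M. \<exists>c\<in>F. \<bar>Y c \<omega>\<bar> > A} = (\<Union>c\<in>F. {\<omega> \<in> space M. \<bar>Y c \<omega>\<bar> > A})" by auto
  show "{\<omega> \<in> space M. \<exists>c\<in>F. \<bar>Y c \<omega>\<bar> > A} \<in> events" unfolding eq using F ev by (intro sets.finite_UN) auto
  have "prob (\<Union>c\<in>F. {\<omega> \<in> space M. \<bar>Y c \<omega>\<bar> > A}) \<le> (\<Sum>c\<in>F. prob {\<omega> \<in> space M. \<bar>Y c \<omega>\<bar> > A})"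
    using F ev by (intro finite_measure_subadditive_finite) auto
  also have "\<dots> \<le> (\<Sum>c\<in>F. p)" by (intro sum_mono tail)
  finally show "prob {\<omega> \<in> space M. \<exists>c\<in>F. \<bar>Y c \<omega>\<bar> > A} \<le> real (card F) * p" unfolding eq by simp
qed

lemma dyadic_point_in_cube: "c \<in> dyadic_index k \<Longrightarrow> dyadic_point k c \<in> cbox 0 1"
  using dyadic_grid_subset_cube by (auto simp: dyadic_grid_def)

section \<open>Convergence of the integrals of Lipschitz functions, and the law of the limit
  process\<close>

context uniform_sample
begin

lemma limit_bridge_tail:
  assumes x: "x \<in> cbox 0 (1::real^'m)"
  shows "measure noise_measure {\<omega> \<in> space noise_measure. \<bar>limit_bridge \<omega> x\<bar> > t} \<le> 2 * exp (1 - t)"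
proof -
  interpret N: prob_space "noise_measure :: (real^'m \<Rightarrow> real) measure" by (rule prob_space_noise_measure)
  have "normal_law noise_measure (\<lambda>\<omega>. \<Sum>a\<in>{()}. 1 * limit_bridge \<omega> x) (\<Sum>a\<in>{()}. \<Sum>b\<in>{()}. 1 * 1 * bridge_kernel x x)"
    by (rule normal_law_limit_bridge) (use x in auto)
  then have law: "normal_law noise_measure (\<lambda>\<omega>. limit_bridge \<omega> x) (bridge_kernel x x)" by simp
  have "bridge_kernel x x = volume_below x - (volume_below x)\<^sup>2"
    by (simp add: bridge_kernel_def volume_below_def power2_eq_square)
  then have "bridge_kernel x x \<le> volume_below x" by simp
  then have "bridge_kernel x x \<le> 1" using volume_below_bounds(2)[OF x] by linarith
  then have "N.prob {\<omega> \<in> space noise_measure. \<bar>limit_bridge \<omega> x\<bar> > t} \<le> 2 * exp (1 - 1 * t)"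
    using normal_law_mgf[OF prob_space_noise_measure law, of 1] normal_law_mgf[OF prob_space_noise_measure law, of "-1"]
    by (intro N.mgf_tail limit_bridge_measurable) auto
  then show ?thesis by simp
qed

text \<open>For fixed \<open>k\<close> the functional depends continuously on finitely many grid
  values. Linear combinations of these values have matching limits on both sides, because the
  variance in the central limit theorem is the quadratic form of the limit bridge.\<close>

lemma corrected_step_integral_tendsto:
  fixes h :: "(real^'m \<Rightarrow> real) \<Rightarrow> real"
  assumes L: "L > 0" and lip: "skorohod_lipschitz h L" and b: "\<And>f. f \<in> skorohod_space \<Longrightarrow> \<bar>h f\<bar> \<le> b"
  shows "(\<lambda>n. expectation (\<lambda>\<omega>. h (corrected_step V k (\<lambda>c. bridge n \<omega> (dyadic_point k c)))))
    \<longlonglongrightarrow> (\<integral>\<omega>. h (corrected_step V k (\<lambda>c. limit_bridge \<omega> (dyadic_point k c))) \<partial>noise_measure)"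
proof (rule cramer_wold[where F = "dyadic_index k" and b = b and H = "\<lambda>v. h (corrected_step V k v)"
      and V = "\<lambda>n \<omega> c. bridge n \<omega> (dyadic_point k c)" and W = "\<lambda>\<omega> c. limit_bridge \<omega> (dyadic_point k c)"])
  let ?F = "dyadic_index k :: (int^'m) set"
  have in_space: "corrected_step V k v \<in> skorohod_space" for v
    unfolding corrected_step_def by (rule corrected_step_in_skorohod_space)
  have hm: "h \<in> borel_measurable (borel_sigma skorohod_topology)"
    by (rule continuous_map_borel_measurable[OF skorohod_lipschitz_continuous_map[OF lip L]])
  show "finite ?F" by (rule finite_dyadic_index)
  show "(\<lambda>n. expectation (\<lambda>\<omega>. cos ((\<Sum>x\<in>?F. t x * bridge n \<omega> (dyadic_point k x)) + b)))
      \<longlonglongrightarrow> (\<integral>\<omega>. cos ((\<Sum>x\<in>?F. t x * limit_bridge \<omega> (dyadic_point k x)) + b) \<partial>noise_measure)" for t b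
  proof -
    have "normal_law noise_measure (\<lambda>\<omega>. \<Sum>a\<in>?F. t a * limit_bridge \<omega> (dyadic_point k a))
        (\<Sum>a\<in>?F. \<Sum>b\<in>?F. t a * t b * bridge_kernel (dyadic_point k a) (dyadic_point k b))"
      by (rule normal_law_limit_bridge[OF finite_dyadic_index dyadic_point_in_cube])
    from normal_law_integral(1)[OF prob_space_noise_measure this, of "\<lambda>y. cos (y + b)"]
    show ?thesis using bridge_clt[of ?F "dyadic_point k" t b, OF dyadic_point_in_cube] by simp
  qed
  show "\<exists>A>0. (\<forall>n. prob {\<omega> \<in> space P. \<exists>x\<in>?F. \<bar>bridge n \<omega> (dyadic_point k x)\<bar> > A} \<le> e) \<and>
      measure noise_measure {\<omega> \<in> space noise_measure. \<exists>x\<in>?F. \<bar>limit_bridge \<omega> (dyadic_point k x)\<bar> > A} \<le> e" if e: "e > 0" for e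
  proof -
    interpret N: prob_space "noise_measure :: (real^'m \<Rightarrow> real) measure" by (rule prob_space_noise_measure)
    obtain A where A: "A > 0" "real (card ?F) * (2 * exp (1 - A)) \<le> e"
      using exp_tail_choice[of "real (card ?F)" e] e by auto
    have "prob {\<omega> \<in> space P. \<exists>x\<in>?F. \<bar>bridge n \<omega> (dyadic_point k x)\<bar> > A} \<le> e" for n
    proof (rule order_trans[OF tail_union_bound(2)[of ?F "\<lambda>c \<omega>. bridge n \<omega> (dyadic_point k c)"] A(2)])
      show "prob {\<omega> \<in> space P. \<bar>bridge n \<omega> (dyadic_point k c)\<bar> > A} \<le> 2 * exp (1 - A)" if "c \<in> ?F" for c
        by (rule bridge_tail[OF dyadic_point_in_cube[OF that]]) (use A in simp)
    qed (rule finite_dyadic_index bridge_measurable)+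
    moreover have "N.prob {\<omega> \<in> space noise_measure. \<exists>x\<in>?F. \<bar>limit_bridge \<omega> (dyadic_point k x)\<bar> > A} \<le> e"
    proof (rule order_trans[OF N.tail_union_bound(2)[of ?F "\<lambda>c \<omega>. limit_bridge \<omega> (dyadic_point k c)"] A(2)])
      show "N.prob {\<omega> \<in> space noise_measure. \<bar>limit_bridge \<omega> (dyadic_point k c)\<bar> > A} \<le> 2 * exp (1 - A)" if "c \<in> ?F" for c
        by (rule limit_bridge_tail[OF dyadic_point_in_cube[OF that]])
    qed (rule finite_dyadic_index limit_bridge_measurable)+
    ultimately show ?thesis using A(1) by blast
  qed
  have hdist: "\<bar>h (corrected_step V k v) - h (corrected_step V k w)\<bar> \<le> L * ((1 + real CARD('m)) * e)"
    if "\<And>c. c \<in> ?F \<Longrightarrow> \<bar>v c - w c\<bar> \<le> e" for v w e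
  proof -
    have "\<bar>h (corrected_step V k v) - h (corrected_step V k w)\<bar> \<le> L * skorohod_dist (corrected_step V k v) (corrected_step V k w)"
      using lip in_space by (simp add: skorohod_lipschitz_def)
    also have "\<dots> \<le> L * ((1 + real CARD('m)) * e)"
      unfolding corrected_step_def using L by (intro mult_left_mono corrected_step_dist_le that) auto
    finally show ?thesis .
  qed
  show "continuous_on {v. (\<forall>x\<in>?F. \<bar>v x\<bar> \<le> A) \<and> (\<forall>x. x \<notin> ?F \<longrightarrow> v x = 0)} (\<lambda>v. h (corrected_step V k v))" for A
    unfolding continuous_on_def
  proof
    fix w :: "int^'m \<Rightarrow> real"
    let ?S = "{v. (\<forall>x\<in>?F. \<bar>v x\<bar> \<le> A) \<and> (\<forall>x. x \<notin> ?F \<longrightarrow> v x = 0)}"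
    show "((\<lambda>v. h (corrected_step V k v)) \<longlongrightarrow> h (corrected_step V k w)) (at w within ?S)"
    proof (rule LIM_zero_cancel, rule Lim_null_comparison)
      show "\<forall>\<^sub>F v in at w within ?S. norm (h (corrected_step V k v) - h (corrected_step V k w))
          \<le> L * ((1 + real CARD('m)) * (\<Sum>c\<in>?F. \<bar>v c - w c\<bar>))"
        unfolding real_norm_def
        by (intro always_eventually allI hdist member_le_sum) (auto simp: finite_dyadic_index)
      have coord: "((\<lambda>v. v c) \<longlongrightarrow> w c) (at w within ?S)" for c
        using tendsto_within_subset[OF bspec[OF continuous_on_product_coordinates[of c, unfolded continuous_on_def] UNIV_I] subset_UNIV] .
      have "((\<lambda>v. L * ((1 + real CARD('m)) * (\<Sum>c\<in>?F. \<bar>v c - w c\<bar>))) \<longlongrightarrow>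
          L * ((1 + real CARD('m)) * (\<Sum>c\<in>?F. \<bar>w c - w c\<bar>))) (at w within ?S)"
        by (intro tendsto_mult tendsto_const tendsto_sum tendsto_rabs tendsto_diff coord)
      then show "((\<lambda>v. L * ((1 + real CARD('m)) * (\<Sum>c\<in>?F. \<bar>v c - w c\<bar>))) \<longlongrightarrow> 0) (at w within ?S)" by simp
    qed
  qed
  show "h (corrected_step V k v) = h (corrected_step V k (\<lambda>x. if x \<in> ?F then v x else 0))" for v
  proof -
    have "\<bar>h (corrected_step V k v) - h (corrected_step V k (\<lambda>x. if x \<in> ?F then v x else 0))\<bar> \<le> L * ((1 + real CARD('m)) * 0)"
      by (rule hdist) simp
    then show ?thesis by simp
  qed
  show "\<bar>h (corrected_step V k v)\<bar> \<le> b" for v by (rule b[OF in_space])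
  show "(\<lambda>\<omega>. h (corrected_step V k (\<lambda>c. bridge n \<omega> (dyadic_point k c)))) \<in> borel_measurable P" for n
    unfolding corrected_step_def by (rule measurable_compose[OF measurable_corrected_step hm]) (rule bridge_measurable)
  show "(\<lambda>\<omega>. h (corrected_step V k (\<lambda>c. limit_bridge \<omega> (dyadic_point k c)))) \<in> borel_measurable noise_measure"
    unfolding corrected_step_def by (rule measurable_compose[OF measurable_corrected_step hm]) (rule limit_bridge_measurable)
  show "prob_space P" by (rule prob_space_axioms)
  show "prob_space (noise_measure :: (real^'m \<Rightarrow> real) measure)" by (rule prob_space_noise_measure)
qed (rule bridge_measurable limit_bridge_measurable)+

lemma limit_process_integral_tendsto:
  fixes h :: "(real^'m \<Rightarrow> real) \<Rightarrow> real"
  assumes L: "L > 0" and lip: "skorohod_lipschitz h L" and b: "\<And>f. f \<in> skorohod_space \<Longrightarrow> \<bar>h f\<bar> \<le> b"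
  shows "(\<lambda>k. \<integral>\<omega>. h (corrected_step V k (\<lambda>c. limit_bridge \<omega> (dyadic_point k c))) \<partial>noise_measure)
    \<longlonglongrightarrow> (\<integral>\<omega>. h (limit_process V \<omega>) \<partial>noise_measure)"
proof (rule integral_dominated_convergence[where w = "\<lambda>_. b"])
  interpret N: prob_space "noise_measure :: (real^'m \<Rightarrow> real) measure" by (rule prob_space_noise_measure)
  have in_space: "corrected_step V k v \<in> skorohod_space" for k v
    unfolding corrected_step_def by (rule corrected_step_in_skorohod_space)
  have hm: "h \<in> borel_measurable (borel_sigma skorohod_topology)"
    by (rule continuous_map_borel_measurable[OF skorohod_lipschitz_continuous_map[OF lip L]])
  show "(\<lambda>\<omega>. h (limit_process V \<omega>)) \<in> borel_measurable noise_measure"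
    by (rule measurable_compose[OF measurable_limit_process hm])
  show "(\<lambda>\<omega>. h (corrected_step V k (\<lambda>c. limit_bridge \<omega> (dyadic_point k c)))) \<in> borel_measurable noise_measure" for k
    unfolding corrected_step_def by (rule measurable_compose[OF measurable_corrected_step hm]) (rule limit_bridge_measurable)
  show "integrable noise_measure (\<lambda>_ :: real^'m \<Rightarrow> real. b)" by simp
  show "AE \<omega> in noise_measure. norm (h (corrected_step V k (\<lambda>c. limit_bridge \<omega> (dyadic_point k c)))) \<le> b" for k
    using b[OF in_space] by simp
  show "AE \<omega> in noise_measure. (\<lambda>k. h (corrected_step V k (\<lambda>c. limit_bridge \<omega> (dyadic_point k c)))) \<longlonglongrightarrow> h (limit_process V \<omega>)"
  proof (rule AE_I2, rule LIM_zero_cancel, rule Lim_null_comparison)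
    fix \<omega> :: "real^'m \<Rightarrow> real"
    show "\<forall>\<^sub>F k in sequentially. norm (h (corrected_step V k (\<lambda>c. limit_bridge \<omega> (dyadic_point k c))) - h (limit_process V \<omega>))
        \<le> L * skorohod_dist (corrected_step V k (\<lambda>c. limit_bridge \<omega> (dyadic_point k c))) (limit_process V \<omega>)"
      unfolding real_norm_def
      by (intro always_eventually allI)
         (rule lip[unfolded skorohod_lipschitz_def, rule_format, OF in_space limit_process_in_skorohod_space])
    show "(\<lambda>k. L * skorohod_dist (corrected_step V k (\<lambda>c. limit_bridge \<omega> (dyadic_point k c))) (limit_process V \<omega>)) \<longlonglongrightarrow> 0"
      using tendsto_mult_left[OF limit_process_approx[of V \<omega>], of L] by simp
  qed
qed

text \<open>The empirical margin equals the empirical distribution function at an axis point only if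
  no other coordinate of the sample exceeds 1, which the uniform law guarantees almost
  surely.\<close>

lemma AE_sample_le_1: "AE \<omega> in P. \<forall>i\<in>{1..n}. \<forall>j. X i \<omega> $ j \<le> 1"
proof (rule AE_finite_allI)
  fix i assume "i \<in> {1..n}"
  then have i: "i \<ge> 1" by simp
  have one: "(1 :: real^'m) \<in> cbox 0 1" by (simp add: mem_box_cart)
  have int: "integrable P (\<lambda>\<omega>. 1 - below_indicator 1 (X i \<omega>))"
    using below_indicator_integrable[OF i] by simp
  have "expectation (\<lambda>\<omega>. 1 - below_indicator 1 (X i \<omega>)) = 0"
    using below_indicator_integrable[OF i] expectation_below_indicator[OF i one] by (simp add: prob_space volume_below_def)
  then have "AE \<omega> in P. 1 - below_indicator 1 (X i \<omega>) = 0"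
    using integral_nonneg_eq_0_iff_AE[OF int] by (simp add: below_indicator_eq of_bool_def)
  then show "AE \<omega> in P. \<forall>j. X i \<omega> $ j \<le> 1"
    by eventually_elim (simp add: below_indicator_eq)
qed simp

lemma marg_emp_cdf_eq:
  assumes "\<And>i j. i \<in> {1..n} \<Longrightarrow> X i \<omega> $ j \<le> 1"
  shows "marg_emp_cdf X j n \<omega> (x $ j) = emp_cdf X n \<omega> (axis_point j x)"
proof -
  have "(\<Prod>l\<in>UNIV. of_bool (X i \<omega> $ l \<le> axis_point j x $ l)) = (of_bool (X i \<omega> $ j \<le> x $ j) :: real)" if "i \<in> {1..n}" for i
    using assms[OF that] below_indicator_eq[of "axis_point j x" "X i \<omega>"]
    by (auto simp: below_indicator_def axis_point_def)
  then show ?thesis unfolding marg_emp_cdf_def emp_cdf_def by simp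
qed

text \<open>The margins differ from \<open>x $ j\<close> by at most \<open>A / sqrt n\<close>, since
  they are bridge values at axis points. The first-order terms of the product are exactly the sum in
  \<open>marginal_correction\<close>; what remains is quadratic in \<open>A / sqrt n\<close> and is
  multiplied by \<open>sqrt n\<close> once.\<close>

lemma emp_process_remainder:
  assumes X1: "\<And>i j. i \<in> {1..n} \<Longrightarrow> X i \<omega> $ j \<le> 1" and n: "n \<ge> 1"
    and A: "\<And>x. x \<in> cbox 0 1 \<Longrightarrow> \<bar>bridge n \<omega> x\<bar> \<le> A" and x: "x \<in> cbox 0 1"
  shows "\<bar>emp_process X V n \<omega> x - marginal_correction V (bridge n \<omega>) x\<bar> \<le> (real CARD('m))\<^sup>2 * A\<^sup>2 / sqrt (real n)"
proof -
  define S where "S = UNIV - V"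
  define s where "s = sqrt (real n)"
  define F where "F j = marg_emp_cdf X j n \<omega> (x $ j)" for j
  define R where "R = (\<Prod>j\<in>S. F j) - (\<Prod>j\<in>S. x $ j) - (\<Sum>j\<in>S. (\<Prod>i\<in>S - {j}. x $ i) * (F j - x $ j))"
  define pV where "pV = (\<Prod>i\<in>V. x $ i)"
  have s: "s > 0" using n by (simp add: s_def)
  have xj: "0 \<le> x $ j \<and> x $ j \<le> 1" for j using x by (simp add: mem_box_cart)
  have b: "bridge n \<omega> (axis_point j x) = s * (F j - x $ j)" for j
  proof -
    have "F j = emp_cdf X n \<omega> (axis_point j x)" unfolding F_def by (rule marg_emp_cdf_eq[OF X1])
    then show ?thesis by (simp add: bridge_def s_def)
  qed
  have d: "\<bar>F j - x $ j\<bar> \<le> A / s" for j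
  proof -
    have "s * \<bar>F j - x $ j\<bar> \<le> A" using A[OF axis_point_cube[OF x], of j] s by (simp add: b abs_mult)
    then show ?thesis using s by (simp add: pos_le_divide_eq mult.commute)
  qed
  have R: "\<bar>R\<bar> \<le> (real (card S))\<^sup>2 * (A / s)\<^sup>2"
    unfolding R_def using d xj by (intro prod_diff_first_order) (auto simp: F_def marg_emp_cdf_bounds)
  have vol: "volume_below x = pV * (\<Prod>j\<in>S. x $ j)"
    unfolding volume_below_def pV_def S_def by (subst prod.union_disjoint[symmetric]) (auto intro!: prod.cong)
  have gam: "(\<Prod>i\<in>UNIV - {j}. x $ i) = pV * (\<Prod>i\<in>S - {j}. x $ i)" if "j \<in> S" for j
    unfolding pV_def using that by (subst prod.union_disjoint[symmetric]) (auto simp: S_def intro!: prod.cong)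
  have "(\<Sum>j\<in>S. (\<Prod>i\<in>UNIV - {j}. x $ i) * bridge n \<omega> (axis_point j x)) = s * pV * (\<Sum>j\<in>S. (\<Prod>i\<in>S - {j}. x $ i) * (F j - x $ j))"
    unfolding sum_distrib_left by (intro sum.cong refl) (simp add: gam b)
  then have Phi: "marginal_correction V (bridge n \<omega>) x = s * (emp_cdf X n \<omega> x - pV * (\<Prod>j\<in>S. x $ j)) - s * pV * (\<Sum>j\<in>S. (\<Prod>i\<in>S - {j}. x $ i) * (F j - x $ j))"
    by (simp add: marginal_correction_def S_def[symmetric] bridge_def[of n \<omega> x] vol s_def)
  have Z: "emp_process X V n \<omega> x = s * (emp_cdf X n \<omega> x - pV * (\<Prod>j\<in>S. F j))"
    using x by (simp add: emp_process_def s_def pV_def F_def S_def)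
  have "emp_process X V n \<omega> x - marginal_correction V (bridge n \<omega>) x = - (s * pV * R)"
    unfolding Phi Z R_def by (simp add: algebra_simps)
  then have "\<bar>emp_process X V n \<omega> x - marginal_correction V (bridge n \<omega>) x\<bar> = s * \<bar>pV\<bar> * \<bar>R\<bar>"
    using s by (simp add: abs_mult)
  also have "\<dots> \<le> s * 1 * ((real CARD('m))\<^sup>2 * (A / s)\<^sup>2)"
  proof (intro mult_mono)
    show "\<bar>pV\<bar> \<le> 1" unfolding pV_def abs_prod using xj by (intro prod_le_1) auto
    have "(real (card S))\<^sup>2 \<le> (real CARD('m))\<^sup>2" by (intro power_mono) (auto intro: card_mono)
    then show "\<bar>R\<bar> \<le> (real CARD('m))\<^sup>2 * (A / s)\<^sup>2" using R by (meson mult_right_mono order_trans zero_le_power2)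
  qed (use s in auto)
  also have "\<dots> = (real CARD('m))\<^sup>2 * A\<^sup>2 / s" using s by (simp add: power_divide power2_eq_square)
  finally show ?thesis by (simp add: s_def)
qed

text \<open>Three events are excluded: failure of the chaining, a grid value beyond
  \<open>A\<close>, and the null set where the margins are not read off at axis points. Elsewhere
  the bridge is bounded by \<open>A + chain_error\<close> on the whole cube, so the quadratic
  remainder and the discretisation error add up; on the excluded events \<open>2 * b\<close> is the
  trivial bound.\<close>

lemma emp_process_step_error:
  fixes h :: "(real^'m \<Rightarrow> real) \<Rightarrow> real"
  assumes L: "L > 0" and lip: "skorohod_lipschitz h L" and b: "\<And>f. f \<in> skorohod_space \<Longrightarrow> \<bar>h f\<bar> \<le> b"
    and n: "2 ^ k \<le> n" and A: "A > 0"
  shows "\<bar>expectation (\<lambda>\<omega>. h (emp_process X V n \<omega>)) - expectation (\<lambda>\<omega>. h (corrected_step V k (\<lambda>c. bridge n \<omega> (dyadic_point k c))))\<bar>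
    \<le> L * ((real CARD('m))\<^sup>2 * (A + chain_error CARD('m))\<^sup>2 / sqrt (real n) + (1 + real CARD('m)) * (chain_error CARD('m) * chain_ratio ^ k))
      + 2 * b * (2 * chain_const CARD('m) / 2 ^ k + real (card (dyadic_index k :: (int^'m) set)) * (2 * exp (1 - A)))"
proof -
  let ?F = "dyadic_index k :: (int^'m) set"
  let ?m = "real CARD('m)"
  let ?C = "chain_error CARD('m)"
  let ?Z = "emp_process X V n"
  let ?Y = "\<lambda>\<omega>. corrected_step V k (\<lambda>c. bridge n \<omega> (dyadic_point k c))"
  have n1: "n \<ge> 1" using n by (meson one_le_numeral one_le_power order_trans)
  have Ysp: "?Y \<omega> \<in> skorohod_space" for \<omega> unfolding corrected_step_def by (rule corrected_step_in_skorohod_space)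
  have Zsp: "?Z \<omega> \<in> skorohod_space" for \<omega> by (rule emp_process_in_skorohod_space)
  have b0: "b \<ge> 0" using b[OF Ysp] abs_ge_zero order_trans by blast
  have hm: "h \<in> borel_measurable (borel_sigma skorohod_topology)"
    by (rule continuous_map_borel_measurable[OF skorohod_lipschitz_continuous_map[OF lip L]])
  have intZ: "integrable P (\<lambda>\<omega>. h (?Z \<omega>))"
  proof (rule integrable_const_bound[where B = b])
    show "(\<lambda>\<omega>. h (?Z \<omega>)) \<in> borel_measurable P"
      by (rule measurable_compose[OF measurable_emp_process[OF X_measurable] hm])
  qed (use b[OF Zsp] in simp)
  have intY: "integrable P (\<lambda>\<omega>. h (?Y \<omega>))"
  proof (rule integrable_const_bound[where B = b])
    show "(\<lambda>\<omega>. h (?Y \<omega>)) \<in> borel_measurable P"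
      unfolding corrected_step_def by (rule measurable_compose[OF measurable_corrected_step hm]) (rule bridge_measurable)
  qed (use b[OF Ysp] in simp)
  obtain G1 where G1: "G1 \<in> events" "prob (space P - G1) \<le> 2 * chain_const CARD('m) / 2 ^ k"
    "\<And>\<omega> x. \<omega> \<in> G1 \<Longrightarrow> x \<in> cbox 0 1 \<Longrightarrow> \<bar>bridge n \<omega> x - bridge n \<omega> (dyadic_floor k x)\<bar> \<le> ?C * chain_ratio ^ k"
    using bridge_sup_event[OF n] by blast
  define B2 where "B2 = {\<omega> \<in> space P. \<exists>c\<in>?F. \<bar>bridge n \<omega> (dyadic_point k c)\<bar> > A}"
  have tail: "prob {\<omega> \<in> space P. \<bar>bridge n \<omega> (dyadic_point k c)\<bar> > A} \<le> 2 * exp (1 - A)" if "c \<in> ?F" for c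
    by (rule bridge_tail[OF dyadic_point_in_cube[OF that]]) (use A in simp)
  note union = tail_union_bound[of ?F "\<lambda>c \<omega>. bridge n \<omega> (dyadic_point k c)", OF finite_dyadic_index bridge_measurable tail]
  have B2: "B2 \<in> events" "prob B2 \<le> real (card ?F) * (2 * exp (1 - A))"
    unfolding B2_def by (rule union(1), assumption) (rule union(2), assumption)
  define G3 where "G3 = {\<omega> \<in> space P. \<forall>i\<in>{1..n}. \<forall>j\<in>UNIV. X i \<omega> $ j \<le> 1}"
  have G3: "G3 \<in> events" "prob (space P - G3) = 0"
  proof -
    have "(\<lambda>\<omega>. X i \<omega> $ j) \<in> borel_measurable P" if "i \<in> {1..n}" for i j
      by (rule measurable_compose[OF X_measurable])
         (use that in \<open>auto intro!: borel_measurable_continuous_onI continuous_intros\<close>)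
    then show "G3 \<in> events" unfolding G3_def
      by (intro sets.sets_Collect_finite_All borel_measurable_le) auto
    moreover have "prob G3 = 1"
      using AE_sample_le_1[of n] \<open>G3 \<in> events\<close> unfolding G3_def by (subst prob_Collect_eq_1) auto
    ultimately show "prob (space P - G3) = 0" by (simp add: prob_compl)
  qed
  define G where "G = G1 \<inter> (space P - B2) \<inter> G3"
  have G: "G \<in> events" unfolding G_def using G1 B2 G3 by auto
  have "prob (space P - G) \<le> prob ((space P - G1) \<union> (B2 \<union> (space P - G3)))"
    unfolding G_def using G1 B2 G3 by (intro finite_measure_mono) auto
  also have "\<dots> \<le> prob (space P - G1) + prob (B2 \<union> (space P - G3))"
    using G1 B2 G3 by (intro measure_Un_le) auto
  also have "\<dots> \<le> prob (space P - G1) + (prob B2 + prob (space P - G3))"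
    using G1 B2 G3 by (intro add_left_mono measure_Un_le) auto
  finally have pG: "prob (space P - G) \<le> 2 * chain_const CARD('m) / 2 ^ k + real (card ?F) * (2 * exp (1 - A))"
    using G1 B2 G3 by simp
  define \<epsilon> where "\<epsilon> = ?m\<^sup>2 * (A + ?C)\<^sup>2 / sqrt (real n) + (1 + ?m) * (?C * chain_ratio ^ k)"
  have C: "?C > 0" by (rule chain_error_pos)
  have \<epsilon>: "\<epsilon> \<ge> 0" unfolding \<epsilon>_def using C chain_ratio by (intro add_nonneg_nonneg divide_nonneg_nonneg mult_nonneg_nonneg) auto
  have on: "\<bar>h (?Z \<omega>) - h (?Y \<omega>)\<bar> \<le> L * \<epsilon>" if w: "\<omega> \<in> G" for \<omega>
  proof -
    have close: "\<bar>bridge n \<omega> x - bridge n \<omega> (dyadic_floor k x)\<bar> \<le> ?C * chain_ratio ^ k" if "x \<in> cbox 0 1" for x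
      using G1(3) w that by (simp add: G_def)
    have sup: "\<bar>bridge n \<omega> x\<bar> \<le> A + ?C" if x: "x \<in> cbox 0 1" for x
    proof -
      have "(\<chi> j. \<lfloor>2 ^ k * x $ j\<rfloor>) \<in> ?F" by (rule floor_in_dyadic_index[OF x])
      then have "\<bar>bridge n \<omega> (dyadic_floor k x)\<bar> \<le> A"
        using w by (auto simp: G_def B2_def not_less dyadic_floor_def G3_def)
      moreover have "?C * chain_ratio ^ k \<le> ?C * 1" using C chain_ratio by (intro mult_left_mono power_le_one) auto
      ultimately show ?thesis using close[OF x] by linarith
    qed
    have "skorohod_dist (?Z \<omega>) (?Y \<omega>) \<le> \<epsilon>"
    proof (rule skorohod_dist_le_sup[OF emp_process_in_skorohod_space Ysp])
      fix x :: "real^'m" assume x: "x \<in> cbox 0 1"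
      have "\<bar>?Z \<omega> x - marginal_correction V (bridge n \<omega>) x\<bar> \<le> ?m\<^sup>2 * (A + ?C)\<^sup>2 / sqrt (real n)"
        by (rule emp_process_remainder[OF _ n1 sup x]) (use w in \<open>auto simp: G_def G3_def\<close>)
      moreover have "\<bar>marginal_correction V (bridge n \<omega>) x - ?Y \<omega> x\<bar> \<le> (1 + ?m) * (?C * chain_ratio ^ k)"
        by (rule corrected_step_approx[of "bridge n \<omega>", OF close x])
      ultimately show "\<bar>?Z \<omega> x - ?Y \<omega> x\<bar> \<le> \<epsilon>" unfolding \<epsilon>_def by linarith
    qed
    then have "L * skorohod_dist (?Z \<omega>) (?Y \<omega>) \<le> L * \<epsilon>" using L by simp
    moreover have "\<bar>h (?Z \<omega>) - h (?Y \<omega>)\<bar> \<le> L * skorohod_dist (?Z \<omega>) (?Y \<omega>)"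
      by (rule lip[unfolded skorohod_lipschitz_def, rule_format, OF Zsp Ysp])
    ultimately show ?thesis by linarith
  qed
  have off: "\<bar>h (?Z \<omega>) - h (?Y \<omega>)\<bar> \<le> 2 * b" for \<omega>
    using b[OF Zsp, of \<omega>] b[OF Ysp, of \<omega>] by linarith
  show ?thesis
    using integral_close_off_small_set[OF intZ intY G _ _ pG on off] L \<epsilon> b0 by (simp add: \<epsilon>_def)
qed

lemma emp_process_integral_tendsto:
  fixes h :: "(real^'m \<Rightarrow> real) \<Rightarrow> real"
  assumes L: "L > 0" and lip: "skorohod_lipschitz h L" and bdd: "bounded (h ` skorohod_space)"
  shows "(\<lambda>n. expectation (\<lambda>\<omega>. h (emp_process X V n \<omega>))) \<longlonglongrightarrow> (\<integral>\<omega>. h (limit_process V \<omega>) \<partial>noise_measure)"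
proof (rule tendstoI)
  fix e :: real assume e: "e > 0"
  let ?m = "real CARD('m)"
  let ?C = "chain_error CARD('m)"
  let ?c = "chain_const CARD('m)"
  let ?Y = "\<lambda>k n \<omega>. corrected_step V k (\<lambda>c. bridge n \<omega> (dyadic_point k c))"
  let ?B = "\<lambda>k. \<integral>\<omega>. h (corrected_step V k (\<lambda>c. limit_bridge \<omega> (dyadic_point k c))) \<partial>noise_measure"
  obtain b where b: "\<And>f. f \<in> skorohod_space \<Longrightarrow> \<bar>h f\<bar> \<le> b" using bdd by (auto simp: bounded_iff)
  have e8: "e / 8 > 0" using e by simp
  have "(\<lambda>k. L * ((1 + ?m) * (?C * chain_ratio ^ k)) + 2 * b * (2 * ?c * (1/2) ^ k)) \<longlonglongrightarrow> L * ((1 + ?m) * (?C * 0)) + 2 * b * (2 * ?c * 0)"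
    using chain_ratio by (intro tendsto_intros LIMSEQ_realpow_zero) auto
  then have "\<forall>\<^sub>F k in sequentially. L * ((1 + ?m) * (?C * chain_ratio ^ k)) + 2 * b * (2 * ?c * (1/2) ^ k) < e / 8"
    using e8 by (intro order_tendstoD(2)) auto
  moreover have "\<forall>\<^sub>F k in sequentially. dist (?B k) (\<integral>\<omega>. h (limit_process V \<omega>) \<partial>noise_measure) < e / 8"
    by (rule tendstoD[OF limit_process_integral_tendsto[OF L lip b] e8])
  ultimately have "\<forall>\<^sub>F k in sequentially. L * ((1 + ?m) * (?C * chain_ratio ^ k)) + 2 * b * (2 * ?c * (1/2) ^ k) < e / 8 \<and>
      dist (?B k) (\<integral>\<omega>. h (limit_process V \<omega>) \<partial>noise_measure) < e / 8"
    by (rule eventually_conj)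
  then obtain k where k: "L * ((1 + ?m) * (?C * chain_ratio ^ k)) + 2 * b * (2 * ?c * (1/2) ^ k) < e / 8"
    "dist (?B k) (\<integral>\<omega>. h (limit_process V \<omega>) \<partial>noise_measure) < e / 8"
    by (auto simp: eventually_sequentially)
  let ?N = "real (card (dyadic_index k :: (int^'m) set))"
  have b0: "b \<ge> 0" using b[OF limit_process_in_skorohod_space] abs_ge_zero order_trans by blast
  \<comment> \<open>The order of the choices matters: \<open>A\<close> depends on the number of grid
    points, hence on \<open>k\<close>, and only then is \<open>n\<close> sent to infinity. Three
    errors and two distances of size \<open>e / 8\<close> stay below \<open>e\<close>.\<close>
  obtain A where A: "A > 0" "(2 * b * ?N) * (2 * exp (1 - A)) \<le> e / 8"
    using exp_tail_choice[of "2 * b * ?N" "e / 8"] b0 e8 by auto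
  have "(\<lambda>n. L * (?m\<^sup>2 * (A + ?C)\<^sup>2 / sqrt (real n))) \<longlonglongrightarrow> 0"
    by (intro tendsto_mult_right_zero tendsto_divide_0[OF tendsto_const] filterlim_at_top_imp_at_infinity
        filterlim_compose[OF sqrt_at_top filterlim_real_sequentially])
  then have "\<forall>\<^sub>F n in sequentially. L * (?m\<^sup>2 * (A + ?C)\<^sup>2 / sqrt (real n)) < e / 8"
    using e8 by (rule order_tendstoD(2))
  moreover have "\<forall>\<^sub>F n in sequentially. dist (expectation (\<lambda>\<omega>. h (?Y k n \<omega>))) (?B k) < e / 8"
    by (rule tendstoD[OF corrected_step_integral_tendsto[OF L lip b] e8])
  ultimately show "\<forall>\<^sub>F n in sequentially. dist (expectation (\<lambda>\<omega>. h (emp_process X V n \<omega>))) (\<integral>\<omega>. h (limit_process V \<omega>) \<partial>noise_measure) < e"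
    using eventually_ge_at_top[of "2 ^ k"]
  proof eventually_elim
    case (elim n)
    define \<epsilon>1 where "\<epsilon>1 = L * (?m\<^sup>2 * (A + ?C)\<^sup>2 / sqrt (real n))"
    define \<epsilon>2 where "\<epsilon>2 = L * ((1 + ?m) * (?C * chain_ratio ^ k)) + 2 * b * (2 * ?c * (1/2) ^ k)"
    define \<epsilon>3 where "\<epsilon>3 = (2 * b * ?N) * (2 * exp (1 - A))"
    have "\<bar>expectation (\<lambda>\<omega>. h (emp_process X V n \<omega>)) - expectation (\<lambda>\<omega>. h (?Y k n \<omega>))\<bar> \<le> \<epsilon>1 + \<epsilon>2 + \<epsilon>3"
      using emp_process_step_error[OF L lip b elim(3) A(1), of V]
      unfolding \<epsilon>1_def \<epsilon>2_def \<epsilon>3_def by (simp add: distrib_left power_divide mult.assoc add.assoc)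
    moreover have "\<epsilon>1 < e / 8" "\<epsilon>2 < e / 8" "\<epsilon>3 \<le> e / 8"
      using elim(1) k(1) A(2) by (simp_all add: \<epsilon>1_def \<epsilon>2_def \<epsilon>3_def)
    ultimately show ?case using elim(2) k(2) e unfolding dist_real_def by linarith
  qed
qed

text \<open>A combination of limit process values is a combination of bridge values indexed by
  \<open>T \<times> Q\<close>. The underlying points may coincide, which the formulation with
  families allows; regrouping the variance by pairs in \<open>T\<close> produces the corrected
  kernel.\<close>

lemma normal_law_limit_process:
  fixes V :: "'m set" and T :: "(real^'m) set"
  assumes a: "recurrent_coeffs (index_family V) a" and T: "finite T" "T \<subseteq> cbox 0 1"
  shows "normal_law noise_measure (\<lambda>\<omega>. \<Sum>t\<in>T. c t * limit_process V \<omega> t)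
    (\<Sum>s\<in>T. \<Sum>t\<in>T. c s * c t * cov_fun (index_family V) a s t)"
proof -
  define Q where "Q = insert None (Some ` (UNIV - V))"
  let ?k = "\<lambda>s a t b. correction_coeff s a * correction_coeff t b * bridge_kernel (correction_point s a) (correction_point t b)"
  have pt: "correction_point t q \<in> cbox 0 1" if "t \<in> T" for t q
    using that T axis_point_cube by (auto simp: correction_point_def split: option.split)
  have "normal_law noise_measure (\<lambda>\<omega>. \<Sum>z\<in>T \<times> Q. (c (fst z) * correction_coeff (fst z) (snd z)) * limit_bridge \<omega> (correction_point (fst z) (snd z)))
    (\<Sum>z\<in>T \<times> Q. \<Sum>w\<in>T \<times> Q. (c (fst z) * correction_coeff (fst z) (snd z)) * (c (fst w) * correction_coeff (fst w) (snd w)) *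
       bridge_kernel (correction_point (fst z) (snd z)) (correction_point (fst w) (snd w)))"
    by (rule normal_law_limit_bridge[where p = "\<lambda>z. correction_point (fst z) (snd z)"
          and c = "\<lambda>z. c (fst z) * correction_coeff (fst z) (snd z)"])
       (use T pt in \<open>auto simp: Q_def\<close>)
  moreover have "(\<Sum>z\<in>T \<times> Q. (c (fst z) * correction_coeff (fst z) (snd z)) * limit_bridge \<omega> (correction_point (fst z) (snd z))) =
      (\<Sum>t\<in>T. c t * limit_process V \<omega> t)" for \<omega>
  proof -
    have "c t * limit_process V \<omega> t = (\<Sum>q\<in>Q. (c t * correction_coeff t q) * limit_bridge \<omega> (correction_point t q))" if "t \<in> T" for t
      using that T by (simp add: limit_process_def marginal_correction_eq_sum Q_def[symmetric] sum_distrib_left mult.assoc subset_iff)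
    then show ?thesis by (simp add: sum.cartesian_product case_prod_beta)
  qed
  moreover have "(\<Sum>z\<in>T \<times> Q. \<Sum>w\<in>T \<times> Q. (c (fst z) * correction_coeff (fst z) (snd z)) * (c (fst w) * correction_coeff (fst w) (snd w)) *
       bridge_kernel (correction_point (fst z) (snd z)) (correction_point (fst w) (snd w)))
     = (\<Sum>s\<in>T. \<Sum>t\<in>T. c s * c t * cov_fun (index_family V) a s t)"
  proof -
    have "(\<Sum>z\<in>T \<times> Q. \<Sum>w\<in>T \<times> Q. (c (fst z) * correction_coeff (fst z) (snd z)) * (c (fst w) * correction_coeff (fst w) (snd w)) *
       bridge_kernel (correction_point (fst z) (snd z)) (correction_point (fst w) (snd w)))
      = (\<Sum>s\<in>T. \<Sum>p\<in>Q. \<Sum>t\<in>T. \<Sum>q\<in>Q. c s * c t * ?k s p t q)"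
      by (simp only: sum.cartesian_product' fst_conv snd_conv) (simp add: ac_simps)
    also have "\<dots> = (\<Sum>s\<in>T. \<Sum>t\<in>T. \<Sum>p\<in>Q. \<Sum>q\<in>Q. c s * c t * ?k s p t q)"
      by (intro sum.cong refl sum.swap)
    also have "\<dots> = (\<Sum>s\<in>T. \<Sum>t\<in>T. c s * c t * (\<Sum>p\<in>Q. \<Sum>q\<in>Q. ?k s p t q))"
      by (simp add: sum_distrib_left)
    also have "\<dots> = (\<Sum>s\<in>T. \<Sum>t\<in>T. c s * c t * cov_fun (index_family V) a s t)"
      using T corrected_kernel[OF a, folded Q_def] by (intro sum.cong refl) (auto simp: subset_iff)
    finally show ?thesis .
  qed
  ultimately show ?thesis by simp
qed

lemma centered_gaussian_limit_process:
  fixes V :: "'m set"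
  assumes a: "recurrent_coeffs (index_family V) a"
  shows "centered_gaussian_process noise_measure (cbox 0 1) (\<lambda>x \<omega>. limit_process V \<omega> x) (cov_fun (index_family V) a)"
  unfolding centered_gaussian_process_def gaussian_process_def
proof (intro conjI allI impI ballI)
  let ?N = "noise_measure :: (real^'m \<Rightarrow> real) measure"
  note N = prob_space_noise_measure
  fix F :: "(real^'m) set" and c assume "finite F \<and> F \<subseteq> cbox 0 1"
  then show "normal_rv ?N (\<lambda>\<omega>. \<Sum>t\<in>F. c t * limit_process V \<omega> t)"
    by (intro normal_law_normal_rv[OF N normal_law_limit_process[OF a]]) auto
next
  let ?N = "noise_measure :: (real^'m \<Rightarrow> real) measure"
  let ?K = "cov_fun (index_family V) a"
  note N = prob_space_noise_measure
  have single: "normal_law ?N (\<lambda>\<omega>. limit_process V \<omega> t) (?K t t)" if "t \<in> cbox 0 1" for t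
    using normal_law_limit_process[OF a, of "{t}" "\<lambda>_. 1"] that by simp
  then show mean: "(\<integral>\<omega>. limit_process V \<omega> t \<partial>?N) = 0" if "t \<in> cbox 0 1" for t
    using normal_law_moments(1)[OF N] that by blast
  have K_sym: "?K s t = ?K t s" for s t :: "real^'m"
    by (simp add: cov_fun_def min.commute mult.commute)
  fix s t :: "real^'m" assume s: "s \<in> cbox 0 1" and t: "t \<in> cbox 0 1"
  note ms = normal_law_moments[OF N single[OF s]] and mt = normal_law_moments[OF N single[OF t]]
  have "covariance ?N (\<lambda>\<omega>. limit_process V \<omega> s) (\<lambda>\<omega>. limit_process V \<omega> t) = (\<integral>\<omega>. limit_process V \<omega> s * limit_process V \<omega> t \<partial>?N)"
    by (simp add: covariance_def mean s t)
  also have "\<dots> = ?K s t"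
  \<comment> \<open>Polarisation recovers the covariance from the variance of the sum. For equal
    points the set \<open>{s, t}\<close> has a single element, and the variance itself is the
    claim.\<close>
  proof (cases "s = t")
    case True
    then show ?thesis using ms(3) by (simp add: power2_eq_square)
  next
    case False
    have "normal_law ?N (\<lambda>\<omega>. limit_process V \<omega> s + limit_process V \<omega> t) (?K s s + 2 * ?K s t + ?K t t)"
      using normal_law_limit_process[OF a, of "{s, t}" "\<lambda>_. 1"] False s t K_sym[of t s] by (simp add: algebra_simps)
    note mst = normal_law_moments[OF N this]
    have "(\<integral>\<omega>. limit_process V \<omega> s * limit_process V \<omega> t \<partial>?N) =
        (\<integral>\<omega>. ((limit_process V \<omega> s + limit_process V \<omega> t)\<^sup>2 - (limit_process V \<omega> s)\<^sup>2 - (limit_process V \<omega> t)\<^sup>2) / 2 \<partial>?N)"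
      by (intro Bochner_Integration.integral_cong) (auto simp: power2_eq_square algebra_simps)
    also have "\<dots> = ((?K s s + 2 * ?K s t + ?K t t) - ?K s s - ?K t t) / 2"
      using ms mt mst by simp
    finally show ?thesis by simp
  qed
  finally show "covariance ?N (\<lambda>\<omega>. limit_process V \<omega> s) (\<lambda>\<omega>. limit_process V \<omega> t) = ?K s t" .
qed

end

theorem theorem2:
  fixes P :: "'w measure" and X :: "nat \<Rightarrow> 'w \<Rightarrow> real^'m::finite"
    and V :: "'m set" and a :: "'m set \<Rightarrow> real"
  assumes "CARD('m) \<ge> 2"
    and "prob_space P"
    and "prob_space.indep_vars P (\<lambda>_. borel) X {1..}"
    and "\<And>i. i \<ge> 1 \<Longrightarrow> distr P borel (X i) = uniform_measure lborel (cbox 0 1)"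
    and "recurrent_coeffs (index_family V) a"
  shows "\<exists>(N :: (real^'m \<Rightarrow> real) measure) (W :: (real^'m \<Rightarrow> real) \<Rightarrow> real^'m \<Rightarrow> real).
           prob_space N \<and>
           centered_gaussian_process N (cbox 0 1) (\<lambda>x \<omega>. W \<omega> x) (cov_fun (index_family V) a) \<and>
           converges_in_distribution skorohod_topology P (emp_process X V) N W"
proof (intro exI conjI)
  interpret uniform_sample P X
    by (intro uniform_sample.intro uniform_sample_axioms.intro assms)
  show "prob_space (noise_measure :: (real^'m \<Rightarrow> real) measure)" by (rule prob_space_noise_measure)
  show "centered_gaussian_process noise_measure (cbox 0 1) (\<lambda>x \<omega>. limit_process V \<omega> x) (cov_fun (index_family V) a)"
    by (rule centered_gaussian_limit_process[OF assms(5)])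
  show "converges_in_distribution skorohod_topology P (emp_process X V) noise_measure (limit_process V)"
    by (rule converges_in_distribution_skorohodI[OF assms(2) prob_space_noise_measure
          measurable_emp_process[OF X_measurable] measurable_limit_process emp_process_integral_tendsto])
qed

end
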